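(* Let $n\ge 1$ and let $X=\{f=0\}\subset\mathbb{C}^3$ with $f=xy-z^{n+1}$ (the $A_n$ singularity). The weight vectors of $A_n$ give a toric minimal embedded resolution of $X\subset\mathbb{C}^3$: there is a regular subdivision $\Sigma$ of the Newton dual fan $\Gamma(f)$ whose one-dimensional cones are exactly those spanned by $e_1,e_2,e_3$ and by the weight vectors $v(\mathcal{C})$, $\mathcal{C}\in EC(A_n)$, and $\mu_\Sigma$ is a minimal toric embedded resolution of $X\subset\mathbb{C}^3$. In particular, the set $EC(A_n)$ of essential components is in bijection, via $\mathcal{C}\mapsto$ the divisor corresponding to the ray $\mathbb{R}_{\ge0}\,v(\mathcal{C})$, with the set of (exceptional) divisors which appear on every toric minimal embedded resolution of $X\subset \mathbb{C}^3$.
   Context: Jets. For $m\ge0$, $X_m$ is the $m$-th jet scheme of $X$ (its closed points are the morphisms $\mathrm{Spec}\,\mathbb{C}[t]/(t^{m+1})\to X$), $\pi_{m,p}:X_m\to X_p$ ($m>p$) are the truncation maps, $X_m\subset(\mathbb{C}^3)_m=\mathrm{Spec}\,\mathbb{C}[x_i,y_i,z_i;\,0\le i\le m]$, and $X_m^0=\pi_{m,0}^{-1}(O)$ with $O$ the origin. Codimensions of subsets of $X_m$ are taken in $(\mathbb{C}^3)_m$. $\psi_m^a:\mathbb{C}^3_\infty\to(\mathbb{C}^3)_m$ is the truncation from the arc space of $\mathbb{C}^3$, and $Cont^p(f)=\{\gamma\in\mathbb{C}^3_\infty:\ \mathrm{ord}_t f\circ\gamma=p\}$. Property $(\star)$ for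 an irreducible component $\mathcal{C}_m$ of $X_m^0$: for every irreducible component $\mathcal{C}_{m+1}$ of $X_{m+1}^0$ with $\pi_{m+1,m}(\mathcal{C}_{m+1})\subset\mathcal{C}_m$, one has $\mathrm{codim}(\mathcal{C}_{m+1})>\mathrm{codim}(\mathcal{C}_m)$. Weight vectors. If $(\psi_m^a)^{-1}(\mathcal{C}_m)\cap Cont^{m+1}(f)\neq\emptyset$ (this holds under $(\star)$), let $\gamma$ be its generic point, put $\nu_{\mathcal{C}_m}(h)=\mathrm{ord}_t(h\circ\gamma)$ for $h\in\mathbb{C}[x,y,z]$, and define the weight vector $v(\mathcal{C}_m)=(\nu_{\mathcal{C}_m}(x),\nu_{\mathcal{C}_m}(y),\nu_{\mathcal{C}_m}(z))\in\mathbb{N}^3$. Essential components. $EC(X)$ consists of: (i) the irreducible components $\mathcal{C}_m$ of $X_m^0$, $m\ge1$, satisfying $(\star)$ and such that $v(\mathcal{C}_m)\ne v(\mathcal{C}_{m-1})$ for every irreducible component $\mathcal{C}_{m-1}$ of $X_{m-1}^0$ (with $m-1\ge1$ and weight vector defined) such that $\pi_{m,m-1}(\mathcal{C}_m)\subset\mathcal{C}_{m-1}$; and (ii) for each coordinate axis $\ell$ of $\mathbb{C}^3$ contained in $X$, the irreducible sets $\mathcal{C}_m^{\ell}=\overline{\pi_{m,0}^{-1}(\ell\setminus\{O\})}\subset X_m$, $m\ge0$, for $m=0$ and for those $m\geq 1$ for which the associated vector changes, i.e. $v(\mathcal{C}^\ell_m)\neq v(\mathcal{C}^\ell_{m-1})$,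 where $v(\mathcal{C}^\ell_m)=(\mathrm{ord}_t(x\circ\gamma),\mathrm{ord}_t(y\circ\gamma),\mathrm{ord}_t(z\circ\gamma))$ with $\gamma$ the generic point of $(\psi_m^a)^{-1}(\mathcal{C}^\ell_m)\cap Cont^{m+1}(f)$. For $A_n$, the axes contained in $X$ are the $x$-axis and the $y$-axis. $EC(A_n)$ denotes $EC(X)$ for this $X$. Toric notions. $\Gamma(f)$ is the fan subdividing $\mathbb{R}_{\ge0}^3$ dual to the Newton polyhedron $NP^+(f)=\mathrm{conv}\bigcup_{c_i\neq0}(i+\mathbb{R}_{\ge0}^3)$ of $f=\sum c_i x^{i_1}y^{i_2}z^{i_3}$: two covectors in $\mathbb{R}_{\ge0}^3$ lie in the relative interior of the same cone iff they attain their minimum on $NP^+(f)$ along the same face. $e_1,e_2,e_3$ is the standard basis of $\mathbb{Z}^3$. A fan is regular if each cone is generated by part of a basis of $\mathbb{Z}^3$. For a regular subdivision $\Sigma$ of $\Gamma(f)$, $\mu_\Sigma:Z_\Sigma\to\mathbb{C}^3$ is the induced proper birational toric morphism; since $f$ is Newton non-degenerate it is an embedded resolution of $X\subset\mathbb{C}^3$, and these are what we call toric embedded resolutions. The irreducible components of the exceptional divisor correspond to the rays of $\Sigma$ other than those of $e_1,e_2,e_3$. For a strongly convex rational cone $\sigma$, $G_\sigma$ is the set of $x\in\sigma\cap\mathbb{Z}^3\setminus\{0\}$ such that $x=n_1+n_2$ with $n_1,n_2\in\sigma\cap\mathbb{Z}^3$ implies $n_1=0$ or $n_2=0$. The toric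 embedded resolution given by $\Sigma$ is minimal if every one-dimensional cone of $\Sigma$ is either a one-dimensional cone of $\Gamma(f)$ or is spanned by an element of $G_\sigma$ for some maximal-dimensional cone $\sigma\in\Gamma(f)$. *)

theory Defs
  imports
    "HOL-Analysis.Analysis"
    "HOL-Library.Poly_Mapping"
    "HOL-Computational_Algebra.Formal_Power_Series"
begin

section \<open>Polynomials in three variables\<close>

text \<open>Throughout, the index type \<open>3\<close> has the elements \<open>1\<close>, \<open>2\<close> and \<open>3 = 0\<close>, standing for the
  coordinates $x$, $y$, $z$.\<close>

type_synonym poly3 = "(nat^3) \<Rightarrow>\<^sub>0 complex"

definition coord_var :: "3 \<Rightarrow> poly3" where
  "coord_var k = Poly_Mapping.single (axis k 1) 1"

definition eval_poly :: "(complex \<Rightarrow> 'a::comm_ring_1) \<Rightarrow> poly3 \<Rightarrow> 'a^3 \<Rightarrow> 'a" where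
  "eval_poly \<phi> h a =
     (\<Sum>i\<in>Poly_Mapping.keys h. \<phi> (Poly_Mapping.lookup h i) * (\<Prod>k\<in>UNIV. (a $ k) ^ (i $ k)))"

definition zero_set :: "poly3 \<Rightarrow> (complex^3) set" where
  "zero_set f = {p. eval_poly (\<lambda>c. c) f p = 0}"

definition A_poly :: "nat \<Rightarrow> poly3" where
  "A_poly n = coord_var 1 * coord_var 2 - coord_var 3 ^ (n + 1)"


section \<open>Irreducible sets, components and codimension\<close>

definition irreducible_in :: "'a topology \<Rightarrow> 'a set \<Rightarrow> bool" where
  "irreducible_in T S \<longleftrightarrow> S \<subseteq> topspace T \<and> S \<noteq> {} \<and>
     (\<forall>A B. closedin T A \<and> closedin T B \<and> S \<subseteq> A \<union> B \<longrightarrow> S \<subseteq> A \<or> S \<subseteq> B)"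

definition irreducible_component :: "'a topology \<Rightarrow> 'a set \<Rightarrow> 'a set \<Rightarrow> bool" where
  "irreducible_component T Y C \<longleftrightarrow> irreducible_in T C \<and> C \<subseteq> Y \<and>
     (\<forall>D. irreducible_in T D \<and> C \<subseteq> D \<and> D \<subseteq> Y \<longrightarrow> D = C)"

definition codim_in :: "'a topology \<Rightarrow> 'a set \<Rightarrow> enat" where
  "codim_in T Z = (SUP k \<in> {k. \<exists>c. c 0 = Z
       \<and> (\<forall>i\<le>k. closedin T (c i) \<and> irreducible_in T (c i))
       \<and> (\<forall>i<k. c i \<subset> c (Suc i))}. enat k)"


section \<open>Arcs and jets\<close>

text \<open>A closed point of the arc space of $\mathbb{C}^3$ is a triple of power series. An \<open>m\<close>-jet,
  a triple in $\mathbb{C}[t]/(t^{m+1})$, is represented by its lift of degree at most \<open>m\<close>, so that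
  the $x_i, y_i, z_i$ are the coefficients and every truncation map is \<open>truncate_arc\<close>.\<close>

type_synonym arc = "complex fps ^ 3"

definition compose_arc :: "poly3 \<Rightarrow> arc \<Rightarrow> complex fps" where
  "compose_arc h \<gamma> = eval_poly fps_const h \<gamma>"

definition truncate_arc :: "nat \<Rightarrow> arc \<Rightarrow> arc" where
  "truncate_arc m \<gamma> = (\<chi> k. fps_cutoff (Suc m) (\<gamma> $ k))"

definition arc_center :: "arc \<Rightarrow> complex^3" where
  "arc_center \<gamma> = (\<chi> k. fps_nth (\<gamma> $ k) 0)"

definition affine_jets :: "nat \<Rightarrow> arc set" where
  "affine_jets m = range (truncate_arc m)"

definition jets :: "poly3 \<Rightarrow> nat \<Rightarrow> arc set" where
  "jets f m = {\<gamma> \<in> affine_jets m. \<forall>j\<le>m. fps_nth (compose_arc f \<gamma>) j = 0}"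

definition jets_at_origin :: "poly3 \<Rightarrow> nat \<Rightarrow> arc set" where
  "jets_at_origin f m = {\<gamma> \<in> jets f m. arc_center \<gamma> = 0}"

text \<open>The coordinate ring $\mathbb{C}[x_i, y_i, z_i;\ i \ge 0]$ of the arc space, as functions on
  closed points; its restriction to \<open>affine_jets m\<close> is $\mathbb{C}[x_i, y_i, z_i;\ i \le m]$, since
  the other coordinates vanish there.\<close>

inductive_set arc_ring :: "(arc \<Rightarrow> complex) set" where
  "(\<lambda>\<gamma>. c) \<in> arc_ring"
| "(\<lambda>\<gamma>. fps_nth (\<gamma> $ k) i) \<in> arc_ring"
| "\<phi> \<in> arc_ring \<Longrightarrow> \<psi> \<in> arc_ring \<Longrightarrow> (\<lambda>\<gamma>. \<phi> \<gamma> + \<psi> \<gamma>) \<in> arc_ring"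
| "\<phi> \<in> arc_ring \<Longrightarrow> \<psi> \<in> arc_ring \<Longrightarrow> (\<lambda>\<gamma>. \<phi> \<gamma> * \<psi> \<gamma>) \<in> arc_ring"

definition zariski_jets :: "nat \<Rightarrow> arc topology" where
  "zariski_jets m = topology_generated_by ((\<lambda>\<phi>. {\<gamma> \<in> affine_jets m. \<phi> \<gamma> \<noteq> 0}) ` arc_ring)"

abbreviation jet_component :: "poly3 \<Rightarrow> nat \<Rightarrow> arc set \<Rightarrow> bool" where
  "jet_component f m C \<equiv> irreducible_component (zariski_jets m) (jets_at_origin f m) C"

abbreviation jet_codim :: "nat \<Rightarrow> arc set \<Rightarrow> enat" where
  "jet_codim m C \<equiv> codim_in (zariski_jets m) C"

definition star_property :: "poly3 \<Rightarrow> nat \<Rightarrow> arc set \<Rightarrow> bool" where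
  "star_property f m C \<longleftrightarrow>
     (\<forall>D. jet_component f (Suc m) D \<and> truncate_arc m ` D \<subseteq> C \<longrightarrow> jet_codim (Suc m) D > jet_codim m C)"


section \<open>Weight vectors\<close>

definition contact_locus :: "nat \<Rightarrow> poly3 \<Rightarrow> arc set" where
  "contact_locus p f = {\<gamma>. compose_arc f \<gamma> \<noteq> 0 \<and> subdegree (compose_arc f \<gamma>) = p}"

definition contact_cylinder :: "poly3 \<Rightarrow> nat \<Rightarrow> arc set \<Rightarrow> arc set" where
  "contact_cylinder f m C = truncate_arc m -` C \<inter> contact_locus (m + 1) f"

text \<open>A point of the arc space, as a scheme, is a prime ideal $P$ of \<open>arc_ring\<close>. The generic point of
  an irreducible set \<open>W\<close> of closed points is the ideal of functions vanishing on \<open>W\<close>.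
  The point $P$ is an arc with coefficients in the residue field of $P$; the coefficient of
  $t^j$ in \<open>h \<circ> \<gamma>\<close> is the class of the corresponding function, so it is zero iff that function is
  in $P$. For the sets occurring below and coordinate functions \<open>h\<close> the order is finite, so that
  \<open>LEAST\<close> is meaningful.\<close>

definition generic_point :: "arc set \<Rightarrow> (arc \<Rightarrow> complex) set" where
  "generic_point W = {\<phi> \<in> arc_ring. \<forall>\<gamma>\<in>W. \<phi> \<gamma> = 0}"

definition order_at_point :: "(arc \<Rightarrow> complex) set \<Rightarrow> poly3 \<Rightarrow> nat" where
  "order_at_point P h = (LEAST j. (\<lambda>\<gamma>. fps_nth (compose_arc h \<gamma>) j) \<notin> P)"

definition weight_vector :: "poly3 \<Rightarrow> nat \<Rightarrow> arc set \<Rightarrow> nat^3" where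
  "weight_vector f m C =
     (\<chi> k. order_at_point (generic_point (contact_cylinder f m C)) (coord_var k))"


section \<open>Essential components\<close>

definition coord_axis :: "3 \<Rightarrow> (complex^3) set" where
  "coord_axis k = range (axis k)"

definition axis_jets :: "poly3 \<Rightarrow> nat \<Rightarrow> 3 \<Rightarrow> arc set" where
  "axis_jets f m k =
     zariski_jets m closure_of {\<gamma> \<in> jets f m. arc_center \<gamma> \<in> coord_axis k - {0}}"

text \<open>An essential component is a pair of a level \<open>m\<close> and a subset of \<open>jets f m\<close>.\<close>

definition EC_origin :: "poly3 \<Rightarrow> (nat \<times> arc set) set" where
  "EC_origin f = {(m, C). m \<ge> 1 \<and> jet_component f m C \<and> star_property f m C \<and>
     (\<forall>D. m - 1 \<ge> 1 \<and> jet_component f (m - 1) D \<and> contact_cylinder f (m - 1) D \<noteq> {} \<and>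
          truncate_arc (m - 1) ` C \<subseteq> D \<longrightarrow> weight_vector f m C \<noteq> weight_vector f (m - 1) D)}"

definition EC_axes :: "poly3 \<Rightarrow> (nat \<times> arc set) set" where
  "EC_axes f = {(m, axis_jets f m k) | m k. coord_axis k \<subseteq> zero_set f \<and>
     (m = 0 \<or> m \<ge> 1 \<and> weight_vector f m (axis_jets f m k)
                      \<noteq> weight_vector f (m - 1) (axis_jets f (m - 1) k))}"

definition EC :: "poly3 \<Rightarrow> (nat \<times> arc set) set" where
  "EC f = EC_origin f \<union> EC_axes f"


section \<open>Cones, fans and the Newton dual fan\<close>

definition lattice3 :: "(real^3) set" where
  "lattice3 = {x. \<forall>k. x $ k \<in> \<int>}"

definition octant :: "(real^3) set" where
  "octant = {x. \<forall>k. 0 \<le> x $ k}"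

abbreviation ray :: "real^3 \<Rightarrow> (real^3) set" where
  "ray v \<equiv> convex_cone hull {v}"

definition strongly_convex_rational_cone :: "(real^3) set \<Rightarrow> bool" where
  "strongly_convex_rational_cone \<sigma> \<longleftrightarrow>
     (\<exists>V. finite V \<and> V \<subseteq> lattice3 \<and> \<sigma> = convex_cone hull V) \<and> \<sigma> \<inter> uminus ` \<sigma> = {0}"

text \<open>The library counts the empty set among the faces of a convex set.\<close>

definition is_fan :: "(real^3) set set \<Rightarrow> bool" where
  "is_fan \<Sigma> \<longleftrightarrow> finite \<Sigma> \<and> \<Sigma> \<noteq> {} \<and> (\<forall>\<sigma>\<in>\<Sigma>. strongly_convex_rational_cone \<sigma>) \<and>
     (\<forall>\<sigma>\<in>\<Sigma>. \<forall>\<tau>. \<tau> face_of \<sigma> \<and> \<tau> \<noteq> {} \<longrightarrow> \<tau> \<in> \<Sigma>) \<and>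
     (\<forall>\<sigma>\<in>\<Sigma>. \<forall>\<tau>\<in>\<Sigma>. (\<sigma> \<inter> \<tau>) face_of \<sigma> \<and> (\<sigma> \<inter> \<tau>) face_of \<tau>)"

definition lattice_basis :: "(real^3) set \<Rightarrow> bool" where
  "lattice_basis B \<longleftrightarrow> B \<subseteq> lattice3 \<and> independent B \<and>
     (\<forall>x\<in>lattice3. \<exists>c. x = (\<Sum>b\<in>B. of_int (c b) *\<^sub>R b))"

definition regular_cone :: "(real^3) set \<Rightarrow> bool" where
  "regular_cone \<sigma> \<longleftrightarrow> (\<exists>B V. lattice_basis B \<and> V \<subseteq> B \<and> \<sigma> = convex_cone hull V)"

definition regular_subdivision :: "(real^3) set set \<Rightarrow> (real^3) set set \<Rightarrow> bool" where
  "regular_subdivision \<Sigma> \<Gamma> \<longleftrightarrow> is_fan \<Sigma> \<and> (\<forall>\<sigma>\<in>\<Sigma>. regular_cone \<sigma>) \<and>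
     \<Union>\<Sigma> = \<Union>\<Gamma> \<and> (\<forall>\<sigma>\<in>\<Sigma>. \<exists>\<tau>\<in>\<Gamma>. \<sigma> \<subseteq> \<tau>)"

definition rays :: "(real^3) set set \<Rightarrow> (real^3) set set" where
  "rays \<Sigma> = {\<rho> \<in> \<Sigma>. dim \<rho> = 1}"

definition newton_polyhedron :: "poly3 \<Rightarrow> (real^3) set" where
  "newton_polyhedron f =
     convex hull (\<Union>i\<in>Poly_Mapping.keys f. {p. \<forall>k. real (i $ k) \<le> p $ k})"

definition newton_face :: "poly3 \<Rightarrow> real^3 \<Rightarrow> (real^3) set" where
  "newton_face f w = {p \<in> newton_polyhedron f. \<forall>q\<in>newton_polyhedron f. w \<bullet> p \<le> w \<bullet> q}"

text \<open>Each cone is the closure of its relative interior, a class of covectors with the same face.\<close>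

definition dual_fan :: "poly3 \<Rightarrow> (real^3) set set" where
  "dual_fan f = (\<lambda>w. closure {w' \<in> octant. newton_face f w' = newton_face f w}) ` octant"

definition indecomposables :: "(real^3) set \<Rightarrow> (real^3) set" where
  "indecomposables \<sigma> = {x \<in> \<sigma> \<inter> lattice3 - {0}.
     \<forall>a\<in>\<sigma> \<inter> lattice3. \<forall>b\<in>\<sigma> \<inter> lattice3. x = a + b \<longrightarrow> a = 0 \<or> b = 0}"

definition minimal_subdivision :: "(real^3) set set \<Rightarrow> (real^3) set set \<Rightarrow> bool" where
  "minimal_subdivision \<Sigma> \<Gamma> \<longleftrightarrow>
     (\<forall>\<rho>\<in>rays \<Sigma>. \<rho> \<in> rays \<Gamma> \<or> (\<exists>\<sigma>\<in>\<Gamma>. dim \<sigma> = 3 \<and> (\<exists>x\<in>indecomposables \<sigma>. \<rho> = ray x)))"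

definition standard_rays :: "(real^3) set set" where
  "standard_rays = range (\<lambda>k. ray (axis k 1))"

text \<open>The components of the exceptional divisor are represented by their rays. A ray determines the
  divisorial valuation, so this identifies divisors on different toric modifications
  when they have the same valuation.\<close>

definition exceptional_rays :: "(real^3) set set \<Rightarrow> (real^3) set set" where
  "exceptional_rays \<Sigma> = rays \<Sigma> - standard_rays"

definition weight_ray :: "nat^3 \<Rightarrow> (real^3) set" where
  "weight_ray v = ray (\<chi> k. real (v $ k))"


section \<open>Toric modifications of affine space\<close>

definition pairing :: "int^3 \<Rightarrow> real^3 \<Rightarrow> real" where
  "pairing m w = (\<Sum>k\<in>UNIV. of_int (m $ k) * w $ k)"

definition dual_monoid :: "(real^3) set \<Rightarrow> (int^3) set" where
  "dual_monoid \<sigma> = {m. \<forall>w\<in>\<sigma>. 0 \<le> pairing m w}"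

definition perp_lattice :: "(real^3) set \<Rightarrow> (int^3) set" where
  "perp_lattice \<tau> = {m. \<forall>w\<in>\<tau>. pairing m w = 0}"

text \<open>The closed points of the toric variety, by orbits: the orbit of \<open>\<tau>\<close> consists of the characters
  of the group \<open>perp_lattice \<tau>\<close>. Extended by zero, a character gives on \<open>dual_monoid \<sigma>\<close>, for each
  \<open>\<sigma>\<close> containing \<open>\<tau>\<close>, the monoid homomorphism to $\mathbb{C}$ that is the point of the affine
  chart of \<open>\<sigma>\<close>.\<close>

definition toric_orbit :: "(real^3) set \<Rightarrow> (int^3 \<Rightarrow> complex) set" where
  "toric_orbit \<tau> = {u. (\<forall>m. u m \<noteq> 0 \<longleftrightarrow> m \<in> perp_lattice \<tau>) \<and>
     (\<forall>m\<in>perp_lattice \<tau>. \<forall>m'\<in>perp_lattice \<tau>. u (m + m') = u m * u m')}"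

type_synonym toric_point = "(real^3) set \<times> (int^3 \<Rightarrow> complex)"

definition toric_variety :: "(real^3) set set \<Rightarrow> toric_point set" where
  "toric_variety \<Sigma> = Sigma \<Sigma> toric_orbit"

definition toric_chart :: "(real^3) set set \<Rightarrow> (real^3) set \<Rightarrow> toric_point set" where
  "toric_chart \<Sigma> \<sigma> = {z \<in> toric_variety \<Sigma>. fst z \<subseteq> \<sigma>}"

text \<open>The classical topology: the charts are open, and the topology on a chart is the
  coarsest one in which its regular monomials are continuous.\<close>

definition toric_topology :: "(real^3) set set \<Rightarrow> toric_point topology" where
  "toric_topology \<Sigma> = topology_generated_by
     {{z \<in> toric_chart \<Sigma> \<sigma>. snd z m \<in> U} | \<sigma> m U. \<sigma> \<in> \<Sigma> \<and> m \<in> dual_monoid \<sigma> \<and> open U}"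

definition toric_map :: "toric_point \<Rightarrow> complex^3" where
  "toric_map z = (\<chi> k. snd z (axis k 1))"

definition exceptional_locus :: "(real^3) set set \<Rightarrow> toric_point set" where
  "exceptional_locus \<Sigma> = {z \<in> toric_variety \<Sigma>. \<exists>\<rho>\<in>exceptional_rays \<Sigma>. \<rho> \<subseteq> fst z}"

text \<open>The classical and Zariski closures of the constructible set below agree.\<close>

definition strict_transform :: "poly3 \<Rightarrow> (real^3) set set \<Rightarrow> toric_point set" where
  "strict_transform f \<Sigma> = toric_topology \<Sigma> closure_of
     {z \<in> toric_variety \<Sigma> - exceptional_locus \<Sigma>. toric_map z \<in> zero_set f}"

text \<open>Generators \<open>v 1, v 2, v 3\<close> of a regular three-dimensional cone and their dual basis \<open>w\<close>. The
  monomials \<open>w k\<close> are coordinates that identify the chart with $\mathbb{C}^3$, and the divisor of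
  the ray of \<open>v k\<close> is where the \<open>k\<close>-th coordinate is zero.\<close>

definition chart_frame :: "(real^3) set \<Rightarrow> (3 \<Rightarrow> real^3) \<Rightarrow> (3 \<Rightarrow> int^3) \<Rightarrow> bool" where
  "chart_frame \<sigma> v w \<longleftrightarrow> range v \<subseteq> lattice3 \<and> \<sigma> = convex_cone hull (range v) \<and>
     (\<forall>j k. pairing (w j) (v k) = (if j = k then 1 else 0))"

definition chart_coords :: "(3 \<Rightarrow> int^3) \<Rightarrow> toric_point \<Rightarrow> complex^3" where
  "chart_coords w z = (\<chi> k. snd z (w k))"

text \<open>Near each of its points \<open>p\<close>, the strict transform is a hypersurface \<open>g = 0\<close> whose
  differential at \<open>p\<close> does not vanish on the intersection of the tangent spaces of the exceptional
  components through \<open>p\<close>. So it is smooth and has simple normal crossings with the exceptional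
  divisor.\<close>

definition smooth_transversal_strict_transform :: "poly3 \<Rightarrow> (real^3) set set \<Rightarrow> bool" where
  "smooth_transversal_strict_transform f \<Sigma> \<longleftrightarrow>
     (\<forall>\<sigma>\<in>\<Sigma>. \<forall>v w. chart_frame \<sigma> v w \<longrightarrow>
       (let S = chart_coords w ` (strict_transform f \<Sigma> \<inter> toric_chart \<Sigma> \<sigma>) in
        \<forall>p\<in>S. \<exists>N g k. open N \<and> p \<in> N \<and> S \<inter> N = zero_set g \<inter> N \<and>
          \<not> (ray (v k) \<in> exceptional_rays \<Sigma> \<and> p $ k = 0) \<and>
          deriv (\<lambda>t. eval_poly (\<lambda>c. c) g (p + axis k t)) 0 \<noteq> 0))"

text \<open>Birationality: the dense torus of the toric variety is mapped bijectively onto that of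
  $\mathbb{C}^3$. The source is smooth when \<open>\<Sigma>\<close> is regular.\<close>

definition embedded_resolution :: "poly3 \<Rightarrow> (real^3) set set \<Rightarrow> bool" where
  "embedded_resolution f \<Sigma> \<longleftrightarrow> is_fan \<Sigma> \<and> (\<forall>\<sigma>\<in>\<Sigma>. regular_cone \<sigma>) \<and>
     proper_map (toric_topology \<Sigma>) euclidean toric_map \<and>
     bij_betw toric_map ({{0}} \<times> toric_orbit {0}) {p. \<forall>k. p $ k \<noteq> 0} \<and>
     smooth_transversal_strict_transform f \<Sigma>"

text \<open>For Newton non-degenerate \<open>f\<close>, as for \<open>A_poly n\<close>, every regular subdivision of \<open>dual_fan f\<close> gives
  an embedded resolution. So the minimal toric embedded resolutions are given by the following
  fans.\<close>

definition minimal_toric_resolution :: "poly3 \<Rightarrow> (real^3) set set \<Rightarrow> bool" where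
  "minimal_toric_resolution f \<Sigma> \<longleftrightarrow>
     regular_subdivision \<Sigma> (dual_fan f) \<and> minimal_subdivision \<Sigma> (dual_fan f)"

end

theory Submission
  imports Defs
    "HOL-Computational_Algebra.Fundamental_Theorem_Algebra"
    "HOL-Computational_Algebra.Polynomial_FPS"
begin

text \<open>The weight vectors turn out to be the lattice points $(a, b, 1) \neq (0, 0, 1)$ with $a, b \ge 0$ and
  $a + b \le n + 1$.

  An \<open>m\<close>-jet over the origin satisfies $\mathrm{ord}\,x + \mathrm{ord}\,y \ge e$ with
  $e = \min(m + 1, n + 1)$, so the jets over the origin are covered by the closed sets
  $\mathrm{ord}\,x \ge a$, $\mathrm{ord}\,y \ge b$ with $a, b \ge 1$ and $a + b = e$. After division of
  $x, y, z$ by $t^a, t^b, t$ such a set consists of jets of the same surface at a lower level, and each of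
  these is a limit of jets with invertible $x$, for which $y$ is a function of $x$ and $z$. So the sets are
  irreducible, and they are the components. The coordinate axes give the points with $a = 0$ or $b = 0$.

  The points $(a, b, 1)$ are indecomposable in the two maximal cones of the Newton dual fan, so they span
  rays of every regular subdivision. Conversely, a coherent unimodular triangulation has no other rays
  besides those of $e_1, e_2, e_3$. In each of its charts, $f$ is a monomial times $1 - \chi$ with a
  nontrivial monomial $\chi$, and $1 - \chi = 0$ is smooth and misses the divisors on which $\chi$
  vanishes.\<close>

section \<open>Lattice frames and simplicial cones\<close>

text \<open>Three points carry the difficulty. After the division, y = z^(n+1) / x makes no sense
  near a jet whose \<open>x\<close> is not a unit, so perturbing \<open>x\<close> alone leaves the
  surface. Perturbing the constant term of \<open>z\<close> instead makes the product xy a unit, and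
  continuity of roots lets both factors follow. The star property compares suprema of chain lengths,
  so a strict inequality requires finite ones. Lengths are bounded by counting: too many
  algebraically independent functions would have more products than there are monomials to express
  them. A longest chain above a component, pulled back one level, then gains a member at the bottom.
  Finally, one explicit arc of exact orders (a, b, 1) and contact order m + 1 both determines the
  weight vector and shows that no component one level up is a full preimage. The sum a + b is m + 1
  up to level n and constant afterwards, so (a, b, 1) is new exactly at level a + b - 1.\<close>

lemma pairing_inner: "pairing m x = (\<chi> k. of_int (m $ k)) \<bullet> x"
  by (simp add: pairing_def inner_vec_def)

lemma pairing_add: "pairing m (x + y) = pairing m x + pairing m y"
  by (simp add: pairing_inner inner_right_distrib)

lemma pairing_scaleR: "pairing m (c *\<^sub>R x) = c * pairing m x"
  by (simp add: pairing_inner)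

lemma pairing_diff: "pairing m (x - y) = pairing m x - pairing m y"
  by (simp add: pairing_inner inner_diff_right)

lemma pairing_0: "pairing m 0 = 0"
  by (simp add: pairing_inner)

lemma pairing_sum: "pairing m (sum f A) = (\<Sum>a\<in>A. pairing m (f a))"
  by (simp add: pairing_inner inner_sum_right)

lemma pairing_left_add: "pairing (m + m') x = pairing m x + pairing m' x"
  by (simp add: pairing_def sum.distrib algebra_simps)

lemma pairing_left_0: "pairing 0 x = 0"
  by (simp add: pairing_def)

lemma pairing_minus: "pairing (- m) x = - pairing m x"
  by (simp add: pairing_def sum_negf)

lemma pairing_minus_right: "pairing m (- x) = - pairing m x"
  by (simp add: pairing_inner)

lemma pairing_axis: "pairing (axis k 1) x = x $ k"
  by (simp add: pairing_def axis_def if_distrib[of of_int] if_distrib[of "\<lambda>t. t * _"] cong: if_cong)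

lemma pairing_eq_0_axes:
  assumes "\<And>k. pairing m (axis k 1) = 0"
  shows "m = 0"
proof -
  have "pairing m (axis k 1) = of_int (m $ k)" for k
    by (simp add: pairing_def axis_def if_distrib sum.delta cong: if_cong)
  with assms show ?thesis by (simp add: vec_eq_iff)
qed

lemma pairing_int:
  assumes "x \<in> lattice3"
  shows "pairing m x \<in> \<int>"
  using assms by (auto simp: pairing_def lattice3_def intro!: Ints_sum Ints_mult)

text \<open>An integral dual basis is what makes three lattice vectors a basis of the lattice.
  Keeping it as data turns membership in a spanned cone into sign conditions on coordinates.\<close>

definition lattice_frame :: "(3 \<Rightarrow> real^3) \<Rightarrow> (3 \<Rightarrow> int^3) \<Rightarrow> bool" where
  "lattice_frame v w \<longleftrightarrow> range v \<subseteq> lattice3 \<and>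
     (\<forall>j k. pairing (w j) (v k) = (if j = k then 1 else 0))"

lemma chart_frame_iff: "chart_frame \<sigma> v w \<longleftrightarrow> lattice_frame v w \<and> \<sigma> = convex_cone hull (range v)"
  by (auto simp: chart_frame_def lattice_frame_def)

context
  fixes v :: "3 \<Rightarrow> real^3" and w :: "3 \<Rightarrow> int^3"
  assumes fr: "lattice_frame v w"
begin

lemma frame_pairing: "pairing (w j) (v k) = (if j = k then 1 else 0)"
  using fr by (auto simp: lattice_frame_def)

lemma frame_lattice: "v k \<in> lattice3"
  using fr by (auto simp: lattice_frame_def)

lemma frame_pairing_sum: "pairing (w j) (\<Sum>k\<in>UNIV. c k *\<^sub>R v k) = c j"
  by (simp add: pairing_sum pairing_scaleR frame_pairing if_distrib cong: if_cong)

lemma frame_inj: "inj v"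
  by (rule injI) (metis frame_pairing zero_neq_one)

lemma frame_independent: "independent (range v)"
unfolding independent_explicit_module
proof (intro allI impI)
  fix t u b assume "finite t" "t \<subseteq> range v" and s: "(\<Sum>b\<in>t. u b *\<^sub>R b) = 0" and b: "b \<in> t"
  then obtain j where j: "b = v j" by auto
  have "pairing (w j) (\<Sum>b\<in>t. u b *\<^sub>R b) = (\<Sum>c\<in>t. u c * (if c = b then 1 else 0))"
    unfolding pairing_sum
  proof (rule sum.cong)
    fix c assume "c \<in> t"
    then obtain k where k: "c = v k" using \<open>t \<subseteq> range v\<close> by auto
    show "pairing (w j) (u c *\<^sub>R c) = u c * (if c = b then 1 else 0)"
      using frame_inj by (auto simp: pairing_scaleR k frame_pairing j inj_eq)
  qed simp
  also have "\<dots> = u b"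
    using b \<open>finite t\<close> by (simp add: if_distrib cong: if_cong)
  finally show "u b = 0" using s by (simp add: pairing_0)
qed

lemma frame_span: "span (range v) = UNIV"
proof -
  have "card (range v) = dim (UNIV :: (real^3) set)"
    using frame_inj by (simp add: card_image)
  then have "UNIV \<subseteq> span (range v)"
    using card_ge_dim_independent[OF subset_UNIV frame_independent] by simp
  then show ?thesis by auto
qed

lemma frame_expand: "x = (\<Sum>k\<in>UNIV. pairing (w k) x *\<^sub>R v k)"
proof -
  have "x \<in> span (range v)" by (simp add: frame_span)
  then obtain c where "x = (\<Sum>b\<in>range v. c b *\<^sub>R b)"
    by (auto simp: span_finite)
  then have x: "x = (\<Sum>k\<in>UNIV. c (v k) *\<^sub>R v k)"
    by (simp add: sum.reindex frame_inj)
  have "c (v k) = pairing (w k) x" for k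
    by (subst x) (simp only: frame_pairing_sum)
  with x show ?thesis by simp
qed

lemma frame_eqI: "(\<And>k. pairing (w k) x = pairing (w k) y) \<Longrightarrow> x = y"
  using frame_expand[of x] frame_expand[of y] by simp

lemma frame_dual_expand: "pairing m x = (\<Sum>k\<in>UNIV. pairing m (v k) * pairing (w k) x)"
  by (subst frame_expand[of x]) (simp add: pairing_sum pairing_scaleR mult.commute)

text \<open>The generators form a basis, so a nonnegative combination is unique and its coefficients
  are the values of the dual basis. Faces, dimensions and intersections are later read off from
  these coordinates.\<close>

lemma frame_cone_iff:
  "x \<in> convex_cone hull (v ` J) \<longleftrightarrow> (\<forall>k. 0 \<le> pairing (w k) x \<and> (k \<notin> J \<longrightarrow> pairing (w k) x = 0))"
  (is "_ \<longleftrightarrow> ?P x")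
proof
  have "convex_cone (Collect ?P)"
    by (auto simp: convex_cone_iff pairing_0 pairing_add pairing_scaleR)
  moreover have "v ` J \<subseteq> Collect ?P"
    by (auto simp: frame_pairing)
  ultimately have "convex_cone hull (v ` J) \<subseteq> Collect ?P"
    by (simp add: hull_minimal)
  then show "x \<in> convex_cone hull (v ` J) \<Longrightarrow> ?P x" by auto
next
  assume P: "?P x"
  have "pairing (w k) x *\<^sub>R v k \<in> convex_cone hull (v ` J)" for k
  proof (cases "k \<in> J")
    case True then show ?thesis using P by (simp add: convex_cone_hull_mul hull_inc)
  next
    case False then show ?thesis using P by (simp add: convex_cone_hull_contains_0)
  qed
  then have "(\<Sum>k\<in>K. pairing (w k) x *\<^sub>R v k) \<in> convex_cone hull (v ` J)" for K
    by (induct K rule: infinite_finite_induct)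
       (auto simp: convex_cone_hull_contains_0 intro: convex_cone_hull_add)
  then show "x \<in> convex_cone hull (v ` J)"
    using frame_expand[of x] by metis
qed

lemma frame_full_cone_iff: "x \<in> convex_cone hull (range v) \<longleftrightarrow> (\<forall>k. 0 \<le> pairing (w k) x)"
  using frame_cone_iff[of x UNIV] by simp

lemma frame_gen_mem_cone: "v k \<in> convex_cone hull (v ` J) \<longleftrightarrow> k \<in> J"
  by (auto simp: frame_cone_iff frame_pairing)

lemma frame_cone_subset: "convex_cone hull (v ` J) \<subseteq> convex_cone hull (v ` J') \<longleftrightarrow> J \<subseteq> J'"
proof
  assume "convex_cone hull (v ` J) \<subseteq> convex_cone hull (v ` J')"
  then show "J \<subseteq> J'" using frame_gen_mem_cone by blast
next
  assume "J \<subseteq> J'"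
  then show "convex_cone hull (v ` J) \<subseteq> convex_cone hull (v ` J')" by (intro hull_mono image_mono)
qed

lemma frame_strongly_convex: "strongly_convex_rational_cone (convex_cone hull (v ` J))"
  unfolding strongly_convex_rational_cone_def
proof
  show "\<exists>V. finite V \<and> V \<subseteq> lattice3 \<and> convex_cone hull (v ` J) = convex_cone hull V"
    using frame_lattice by (intro exI[of _ "v ` J"]) auto
  have "x = 0" if "x \<in> convex_cone hull (v ` J)" "- x \<in> convex_cone hull (v ` J)" for x
  proof (rule frame_eqI)
    fix k show "pairing (w k) x = pairing (w k) 0"
      using that[unfolded frame_cone_iff] by (metis neg_0_le_iff_le order_antisym pairing_0 pairing_scaleR scaleR_minus1_left mult_minus1)
  qed
  then show "convex_cone hull (v ` J) \<inter> uminus ` (convex_cone hull (v ` J)) = {0}"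
    by (auto simp: convex_cone_hull_contains_0 image_iff)
qed

lemma frame_face:
  assumes "J' \<subseteq> J"
  shows "convex_cone hull (v ` J') face_of convex_cone hull (v ` J)"
  unfolding face_of_def
proof (intro conjI ballI impI)
  show "convex_cone hull (v ` J') \<subseteq> convex_cone hull (v ` J)"
    using assms by (simp add: frame_cone_subset)
  show "convex (convex_cone hull (v ` J'))" by (rule convex_convex_cone_hull)
  fix a b x assume a: "a \<in> convex_cone hull (v ` J)" and b: "b \<in> convex_cone hull (v ` J)"
    and x: "x \<in> convex_cone hull (v ` J')" and seg: "x \<in> open_segment a b"
  then obtain u where u: "0 < u" "u < 1" "x = (1 - u) *\<^sub>R a + u *\<^sub>R b"
    by (auto simp: in_segment)
  \<comment> \<open>Both endpoints have nonnegative coordinates, so a coordinate that vanishes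
    inside the segment vanishes at both ends.\<close>
  have "pairing (w k) a = 0 \<and> pairing (w k) b = 0" if "k \<notin> J'" for k
  proof -
    have "(1 - u) * pairing (w k) a + u * pairing (w k) b = 0"
      using x that by (simp add: frame_cone_iff u(3) pairing_add pairing_scaleR)
    moreover have "0 \<le> pairing (w k) a" "0 \<le> pairing (w k) b"
      using a b by (auto simp: frame_cone_iff)
    ultimately show ?thesis using u
      by (smt (verit) mult_nonneg_nonneg mult_pos_pos)
  qed
  then show "a \<in> convex_cone hull (v ` J')" "b \<in> convex_cone hull (v ` J')"
    using a b by (auto simp: frame_cone_iff)
qed

text \<open>A point with coordinate c > 0 along \<open>v k\<close> is the midpoint of 2c
  \<open>v k\<close> and of twice the rest, both in the cone. A face that contains the midpoint
  contains the ends, and it is closed under scaling.\<close>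

lemma frame_face_generators:
  assumes F: "F face_of convex_cone hull (v ` J)" and x: "x \<in> F" and k: "pairing (w k) x \<noteq> 0"
  shows "v k \<in> F"
proof -
  let ?C = "convex_cone hull (v ` J)"
  have con: "conic F" using F conic_convex_cone_hull face_of_conic by blast
  define c where "c = pairing (w k) x"
  have xC: "x \<in> ?C" using F x face_of_imp_subset by blast
  then have kJ: "k \<in> J" and c: "c > 0" using k unfolding frame_cone_iff c_def by (auto simp: order_le_less)
  define y where "y = x - c *\<^sub>R v k"
  have y: "y \<in> ?C"
    using xC by (auto simp: y_def frame_cone_iff pairing_diff pairing_scaleR frame_pairing c_def)
  have vC: "(2 * c) *\<^sub>R v k \<in> ?C" using kJ c by (simp add: frame_gen_mem_cone convex_cone_hull_mul)
  have yC: "2 *\<^sub>R y \<in> ?C" using y by (simp add: convex_cone_hull_mul)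
  have ne: "(2 * c) *\<^sub>R v k \<noteq> 2 *\<^sub>R y"
  proof
    assume "(2 * c) *\<^sub>R v k = 2 *\<^sub>R y"
    then have "pairing (w k) ((2 * c) *\<^sub>R v k) = pairing (w k) (2 *\<^sub>R y)" by simp
    then show False using c by (simp add: y_def pairing_diff pairing_scaleR frame_pairing c_def)
  qed
  have "x = (1 - 1/2) *\<^sub>R ((2 * c) *\<^sub>R v k) + (1/2) *\<^sub>R (2 *\<^sub>R y)"
    by (simp add: y_def)
  then have "x \<in> open_segment ((2 * c) *\<^sub>R v k) (2 *\<^sub>R y)"
    using ne unfolding in_segment by (intro conjI exI[of _ "1/2"]) auto
  then have "(2 * c) *\<^sub>R v k \<in> F" using face_ofD[OF F _ vC yC x] by blast
  then have "(1 / (2 * c)) *\<^sub>R ((2 * c) *\<^sub>R v k) \<in> F" using con c unfolding conic_def by (meson divide_nonneg_pos le_numeral_extra(1) mult_pos_pos zero_less_numeral)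
  then show ?thesis using c by simp
qed

lemma frame_face_eq:
  assumes F: "F face_of convex_cone hull (v ` J)" and ne: "F \<noteq> {}"
  shows "F = convex_cone hull (v ` {k. v k \<in> F})" "{k. v k \<in> F} \<subseteq> J"
proof -
  show "{k. v k \<in> F} \<subseteq> J"
    using face_of_imp_subset[OF F] frame_gen_mem_cone by blast
  have "convex_cone F"
    unfolding convex_cone_def using ne face_of_conic[OF conic_convex_cone_hull F] face_of_imp_convex[OF F] by simp
  then have "convex_cone hull (v ` {k. v k \<in> F}) \<subseteq> F"
    by (intro hull_minimal) auto
  moreover have "x \<in> convex_cone hull (v ` {k. v k \<in> F})" if "x \<in> F" for x
    using frame_face_generators[OF F that] face_of_imp_subset[OF F] that
    by (auto simp: frame_cone_iff)
  ultimately show "F = convex_cone hull (v ` {k. v k \<in> F})" by blast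
qed

lemma frame_lattice_basis: "lattice_basis (range v)"
  unfolding lattice_basis_def
proof (intro conjI ballI)
  show "range v \<subseteq> lattice3" using frame_lattice by auto
  show "independent (range v)" by (rule frame_independent)
  fix x :: "real^3" assume x: "x \<in> lattice3"
  have "x = (\<Sum>k\<in>UNIV. of_int \<lfloor>pairing (w k) x\<rfloor> *\<^sub>R v k)"
    using frame_expand[of x] pairing_int[OF x] by simp
  also have "\<dots> = (\<Sum>b\<in>range v. of_int \<lfloor>pairing (w (the_inv v b)) x\<rfloor> *\<^sub>R b)"
    by (simp add: sum.reindex frame_inj the_inv_f_f)
  finally show "\<exists>c. x = (\<Sum>b\<in>range v. of_int (c b) *\<^sub>R b)"
    by (intro exI[of _ "\<lambda>b. \<lfloor>pairing (w (the_inv v b)) x\<rfloor>"])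
qed

lemma frame_regular: "regular_cone (convex_cone hull (v ` J))"
  unfolding regular_cone_def using frame_lattice_basis by blast

lemma frame_dim_cone: "dim (convex_cone hull (v ` J)) = card J"
proof -
  have "dim (convex_cone hull (v ` J)) = dim (v ` J)"
  proof (rule antisym)
    have "convex_cone hull (v ` J) \<subseteq> span (v ` J)"
      by (intro hull_minimal span_superset convex_cone_span)
    then show "dim (convex_cone hull (v ` J)) \<le> dim (v ` J)"
      by (metis dim_span dim_subset)
    show "dim (v ` J) \<le> dim (convex_cone hull (v ` J))"
      by (intro dim_subset hull_subset)
  qed
  also have "independent (v ` J)" using frame_independent by (rule independent_mono) auto
  then have "dim (v ` J) = card (v ` J)" by (rule dim_eq_card_independent)
  also have "\<dots> = card J" using frame_inj by (intro card_image) (auto intro: inj_on_subset)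
  finally show ?thesis .
qed

end

text \<open>The coordinates of the standard basis vectors in \<open>B\<close> are integers;
  transposed, they are the components of the dual covectors. Hence the dual basis is
  integral.\<close>

lemma lattice_basis_frame:
  assumes B: "lattice_basis B"
  obtains v w where "lattice_frame v w" "range v = B"
proof -
  have sub: "B \<subseteq> lattice3" and ind: "independent B"
    and ex: "\<And>x. x \<in> lattice3 \<Longrightarrow> \<exists>c. x = (\<Sum>b\<in>B. of_int (c b) *\<^sub>R b)"
    using B by (auto simp: lattice_basis_def)
  have finB: "finite B" using ind by (rule independent_imp_finite)
  have ax: "axis k 1 \<in> lattice3" for k :: 3 by (auto simp: lattice3_def axis_def)
  obtain c where c: "\<And>k. axis k 1 = (\<Sum>b\<in>B. of_int (c k b) *\<^sub>R b)" using ex[OF ax] by metis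
  have "axis k 1 \<in> span B" for k :: 3
    by (subst c) (intro span_sum span_scale span_base)
  then have "span B \<supseteq> span (range (\<lambda>k::3. axis k 1))"
    by (intro span_minimal) auto
  moreover have "x \<in> span (range (\<lambda>k::3. axis k 1))" for x :: "real^3"
  proof -
    have "x = (\<Sum>k\<in>UNIV. x $ k *\<^sub>R axis k 1)"
      by (simp add: vec_eq_iff axis_def if_distrib cong: if_cong)
    also have "\<dots> \<in> span (range (\<lambda>k::3. axis k 1))"
      by (intro span_sum span_scale span_base) auto
    finally show ?thesis .
  qed
  ultimately have "span B = UNIV" by blast
  then have "card B = CARD(3)"
    using dim_eq_card_independent[OF ind] by (metis dim_span dim_UNIV DIM_cart DIM_real mult.right_neutral)
  then obtain v :: "3 \<Rightarrow> real^3" where v: "bij_betw v UNIV B"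
    using finite_same_card_bij[of "UNIV :: 3 set" B] finB by auto
  define w where "w j = (\<chi> i. c i (v j))" for j
  have x: "x = (\<Sum>k\<in>UNIV. pairing (w k) x *\<^sub>R v k)" for x
  proof -
    have "x = (\<Sum>i\<in>UNIV. x $ i *\<^sub>R axis i 1)"
      by (simp add: vec_eq_iff axis_def if_distrib cong: if_cong)
    also have "\<dots> = (\<Sum>i\<in>UNIV. x $ i *\<^sub>R (\<Sum>k\<in>UNIV. of_int (c i (v k)) *\<^sub>R v k))"
      by (subst c) (simp add: sum.reindex_bij_betw[OF v, of "\<lambda>b. of_int (c _ b) *\<^sub>R b"])
    also have "\<dots> = (\<Sum>k\<in>UNIV. (\<Sum>i\<in>UNIV. (x $ i * of_int (c i (v k))) *\<^sub>R v k))"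
      unfolding scaleR_sum_right by (subst sum.swap) simp
    also have "\<dots> = (\<Sum>k\<in>UNIV. pairing (w k) x *\<^sub>R v k)"
      by (simp add: pairing_def w_def scaleR_sum_left mult.commute)
    finally show ?thesis .
  qed
  have "pairing (w j) (v k) = (if j = k then 1 else 0)" for j k
  proof -
    have inj: "inj v" and ran: "range v = B" using v by (auto simp: bij_betw_def)
    have "(\<Sum>i\<in>UNIV. (pairing (w i) (v k) - (if i = k then 1 else 0)) *\<^sub>R v i) = 0"
      using x[of "v k"] by (simp add: scaleR_diff_left sum_subtractf if_distrib[of "\<lambda>t. t *\<^sub>R _"] cong: if_cong)
    then have "(\<Sum>b\<in>range v. (pairing (w (the_inv v b)) (v k) - (if the_inv v b = k then 1 else 0)) *\<^sub>R b) = 0"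
      by (simp add: sum.reindex inj the_inv_f_f)
    then have "\<forall>b\<in>B. pairing (w (the_inv v b)) (v k) - (if the_inv v b = k then 1 else 0) = 0"
      using independentD[OF ind finB subset_refl, of "\<lambda>b. pairing (w (the_inv v b)) (v k) - (if the_inv v b = k then 1 else 0)"] ran by simp
    then have "pairing (w (the_inv v (v j))) (v k) - (if the_inv v (v j) = k then 1 else 0) = 0"
      using ran by blast
    then show ?thesis using inj by (auto simp: the_inv_f_f split: if_splits)
  qed
  then have "lattice_frame v w" using sub v by (auto simp: lattice_frame_def bij_betw_def)
  then show ?thesis using that v by (auto simp: bij_betw_def)
qed

section \<open>Fans of simplicial cones certified by a height function\<close>

definition frame_fan :: "((3 \<Rightarrow> real^3) \<times> (3 \<Rightarrow> int^3)) set \<Rightarrow> (real^3) set set" where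
  "frame_fan FR = {convex_cone hull (v ` J) | v w J. (v, w) \<in> FR}"

lemma frame_fanI: "(v, w) \<in> FR \<Longrightarrow> convex_cone hull (v ` J) \<in> frame_fan FR"
  by (auto simp: frame_fan_def)

text \<open>Both functionals agree at the common point \<open>x\<close> with the height, so that by strictness
  neither frame can use a generator outside the other one.\<close>

lemma coherent_frames_inter_le:
  assumes f: "lattice_frame v w" and f': "lattice_frame v' w'"
    and u: "\<And>k. u \<bullet> v k = \<phi> (v k)" "\<And>k. v' k \<notin> range v \<Longrightarrow> u \<bullet> v' k < \<phi> (v' k)"
    and u': "\<And>k. u' \<bullet> v' k = \<phi> (v' k)" "\<And>k. v k \<notin> range v' \<Longrightarrow> u' \<bullet> v k < \<phi> (v k)"
    and x: "x \<in> convex_cone hull (v ` J)" "x \<in> convex_cone hull (v' ` J')"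
  shows "x \<in> convex_cone hull (v ` {k \<in> J. v k \<in> v' ` J'})"
proof -
  define c where "c k = pairing (w k) x" for k
  define d where "d k = pairing (w' k) x" for k
  have xc: "x = (\<Sum>k\<in>UNIV. c k *\<^sub>R v k)" unfolding c_def by (rule frame_expand[OF f])
  have xd: "x = (\<Sum>k\<in>UNIV. d k *\<^sub>R v' k)" unfolding d_def by (rule frame_expand[OF f'])
  have c0: "0 \<le> c k" and cJ: "k \<notin> J \<Longrightarrow> c k = 0" for k
    using x(1) by (auto simp: frame_cone_iff[OF f] c_def)
  have d0: "0 \<le> d k" and dJ: "k \<notin> J' \<Longrightarrow> d k = 0" for k
    using x(2) by (auto simp: frame_cone_iff[OF f'] d_def)
  have ux: "u \<bullet> x = (\<Sum>k\<in>UNIV. c k * \<phi> (v k))"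
    by (subst xc) (simp add: inner_sum_right u)
  have ux': "u' \<bullet> x = (\<Sum>k\<in>UNIV. d k * \<phi> (v' k))"
    by (subst xd) (simp add: inner_sum_right u')
  have uxd: "u \<bullet> x = (\<Sum>k\<in>UNIV. d k * (u \<bullet> v' k))"
    by (subst xd) (simp add: inner_sum_right)
  have le: "u' \<bullet> v k \<le> \<phi> (v k)" "u \<bullet> v' k \<le> \<phi> (v' k)" for k
    using u u' by (smt (verit) rangeE)+
  have le1: "u \<bullet> x \<le> u' \<bullet> x"
    unfolding uxd ux' using d0 le by (intro sum_mono mult_left_mono) auto
  have "v k \<in> range v'" if "c k \<noteq> 0" for k
  proof (rule ccontr)
    assume "v k \<notin> range v'"
    then have "c k * (u' \<bullet> v k) < c k * \<phi> (v k)"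
      using that c0[of k] u'(2) by simp
    then have "(\<Sum>k\<in>UNIV. c k * (u' \<bullet> v k)) < (\<Sum>k\<in>UNIV. c k * \<phi> (v k))"
      using c0 le by (intro sum_strict_mono_ex1) (auto intro!: mult_left_mono)
    moreover have "u' \<bullet> x = (\<Sum>k\<in>UNIV. c k * (u' \<bullet> v k))"
      by (subst xc) (simp add: inner_sum_right)
    ultimately show False using le1 ux by simp
  qed
  note rng = this
  \<comment> \<open>The first expansion of \<open>x\<close> only involves generators of the second
    frame, so \<open>w' l\<close> picks a single coefficient from it: the two expansions are the
    same, and a nonzero coefficient has its index \<open>l\<close> in \<open>J'\<close>.\<close>
  have "v k \<in> v' ` J'" if ck: "c k \<noteq> 0" for k
  proof -
    obtain l where l: "v k = v' l" using rng[OF ck] by auto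
    have "d l = (\<Sum>j\<in>UNIV. c j * pairing (w' l) (v j))"
      unfolding d_def by (subst xc) (simp add: pairing_sum pairing_scaleR)
    also have "\<dots> = (\<Sum>j\<in>UNIV. if j = k then c k else 0)"
    proof (rule sum.cong)
      fix j show "c j * pairing (w' l) (v j) = (if j = k then c k else 0)"
      proof (cases "c j = 0")
        case False
        then obtain l' where "v j = v' l'" using rng by auto
        then show ?thesis using l frame_inj[OF f] frame_inj[OF f']
          injD[OF frame_inj[OF f], of j k]
          by (auto simp: frame_pairing[OF f'] inj_eq)
      qed (use ck in auto)
    qed simp
    finally have "d l = c k" by simp
    then show ?thesis using dJ ck l by (metis imageI)
  qed
  then show ?thesis
    using c0 cJ unfolding frame_cone_iff[OF f] c_def[symmetric] by auto
qed

text \<open>The linear function \<open>u\<close> interpolates the height on one cone and lies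
  strictly below it at every other generator. This is the criterion for a regular (coherent)
  triangulation: two cones meet exactly in the cone over their common generators, which is a face of
  both.\<close>

lemma coherent_fan:
  assumes fin: "finite FR" and ne: "FR \<noteq> {}"
    and fr: "\<And>v w. (v, w) \<in> FR \<Longrightarrow> lattice_frame v w"
    and ht: "\<And>v w. (v, w) \<in> FR \<Longrightarrow> \<exists>u. (\<forall>k. u \<bullet> v k = \<phi> (v k)) \<and>
               (\<forall>(v', w') \<in> FR. \<forall>k. v' k \<notin> range v \<longrightarrow> u \<bullet> v' k < \<phi> (v' k))"
  shows "is_fan (frame_fan FR)"
  unfolding is_fan_def
proof (intro conjI ballI allI impI)
  have "frame_fan FR = (\<lambda>((v, w), J). convex_cone hull (v ` J)) ` (FR \<times> UNIV)"
    by (force simp: frame_fan_def)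
  then show "finite (frame_fan FR)" using fin by simp
  show "frame_fan FR \<noteq> {}" using ne by (auto simp: frame_fan_def)
next
  fix \<sigma> assume "\<sigma> \<in> frame_fan FR"
  then obtain v w J where vw: "(v, w) \<in> FR" and \<sigma>: "\<sigma> = convex_cone hull (v ` J)"
    by (auto simp: frame_fan_def)
  show "strongly_convex_rational_cone \<sigma>"
    unfolding \<sigma> by (rule frame_strongly_convex[OF fr[OF vw]])
  fix \<tau> assume "\<tau> face_of \<sigma> \<and> \<tau> \<noteq> {}"
  then have "\<tau> = convex_cone hull (v ` {k. v k \<in> \<tau>})"
    using frame_face_eq[OF fr[OF vw]] \<sigma> by blast
  then show "\<tau> \<in> frame_fan FR" using frame_fanI[OF vw] by metis
next
  have inter: "convex_cone hull (v ` J) \<inter> convex_cone hull (v' ` J')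
      = convex_cone hull (v ` {k \<in> J. v k \<in> v' ` J'})"
    if vw: "(v, w) \<in> FR" and vw': "(v', w') \<in> FR" for v w v' w' J J'
  proof (intro equalityI subsetI IntI)
    fix x assume x: "x \<in> convex_cone hull (v ` J) \<inter> convex_cone hull (v' ` J')"
    obtain u where u: "\<And>k. u \<bullet> v k = \<phi> (v k)" "\<And>k. v' k \<notin> range v \<Longrightarrow> u \<bullet> v' k < \<phi> (v' k)"
      using ht[OF vw] vw' by blast
    obtain u' where u': "\<And>k. u' \<bullet> v' k = \<phi> (v' k)" "\<And>k. v k \<notin> range v' \<Longrightarrow> u' \<bullet> v k < \<phi> (v k)"
      using ht[OF vw'] vw by blast
    show "x \<in> convex_cone hull (v ` {k \<in> J. v k \<in> v' ` J'})"
      using coherent_frames_inter_le[of v w v' w' u \<phi> u' x J J'] u u' x fr[OF vw] fr[OF vw'] by auto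
  next
    fix x assume x: "x \<in> convex_cone hull (v ` {k \<in> J. v k \<in> v' ` J'})"
    show "x \<in> convex_cone hull (v ` J)"
      using x hull_mono[of "v ` {k \<in> J. v k \<in> v' ` J'}" "v ` J"] by blast
    show "x \<in> convex_cone hull (v' ` J')"
      using x hull_mono[of "v ` {k \<in> J. v k \<in> v' ` J'}" "v' ` J'"] by blast
  qed
  fix \<sigma> \<tau> assume "\<sigma> \<in> frame_fan FR" "\<tau> \<in> frame_fan FR"
  then obtain v w J v' w' J' where vw: "(v, w) \<in> FR" "(v', w') \<in> FR"
    and \<sigma>\<tau>: "\<sigma> = convex_cone hull (v ` J)" "\<tau> = convex_cone hull (v' ` J')"
    by (auto simp: frame_fan_def)
  show "(\<sigma> \<inter> \<tau>) face_of \<sigma>"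
    unfolding \<sigma>\<tau> inter[OF vw] by (rule frame_face[OF fr[OF vw(1)]]) auto
  show "(\<sigma> \<inter> \<tau>) face_of \<tau>"
    unfolding \<sigma>\<tau> inf_commute[of "convex_cone hull (v ` J)"] inter[OF vw(2,1)]
    by (rule frame_face[OF fr[OF vw(2)]]) auto
qed

lemma rays_frame_fan:
  assumes fr: "\<And>v w. (v, w) \<in> FR \<Longrightarrow> lattice_frame v w"
  shows "rays (frame_fan FR) = {ray (v k) | v w k. (v, w) \<in> FR}"
proof (intro equalityI subsetI)
  fix \<rho> assume "\<rho> \<in> rays (frame_fan FR)"
  then obtain v w J where vw: "(v, w) \<in> FR" and \<rho>: "\<rho> = convex_cone hull (v ` J)" "dim \<rho> = 1"
    by (auto simp: rays_def frame_fan_def)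
  then have "card J = 1" using frame_dim_cone[OF fr] by simp
  then obtain k where "J = {k}" by (auto simp: card_1_singleton_iff)
  then show "\<rho> \<in> {ray (v k) | v w k. (v, w) \<in> FR}" using vw \<rho> by auto
next
  fix \<rho> assume "\<rho> \<in> {ray (v k) | v w k. (v, w) \<in> FR}"
  then obtain v w k where vw: "(v, w) \<in> FR" and \<rho>: "\<rho> = ray (v k)" by auto
  then show "\<rho> \<in> rays (frame_fan FR)"
    using frame_fanI[OF vw, of "{k}"] frame_dim_cone[OF fr[OF vw], of "{k}"] by (simp add: rays_def)
qed

lemma ray_eq: "ray x = {c *\<^sub>R x | c. 0 \<le> c}"
proof
  have "convex_cone {c *\<^sub>R x | c. 0 \<le> c}"
    unfolding convex_cone_iff
    by (auto simp: scaleR_add_left[symmetric])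
  then show "ray x \<subseteq> {c *\<^sub>R x | c. 0 \<le> c}"
    by (rule hull_minimal[rotated]) (auto intro: exI[of _ 1])
  show "{c *\<^sub>R x | c. 0 \<le> c} \<subseteq> ray x"
    by (auto intro: convex_cone_hull_mul hull_inc)
qed

section \<open>A unimodular triangulation\<close>

text \<open>\<open>lat 0 0\<close> is the third basis vector, so one family contains this axis
  together with all weight vectors.\<close>

definition lat :: "nat \<Rightarrow> nat \<Rightarrow> real^3" where
  "lat a b = vector [real a, real b, 1]"

definition three :: "'a \<Rightarrow> 'a \<Rightarrow> 'a \<Rightarrow> 3 \<Rightarrow> 'a" where
  "three p q r k = (if k = 1 then p else if k = 2 then q else r)"

definition covec :: "int \<Rightarrow> int \<Rightarrow> int \<Rightarrow> int^3" where
  "covec a b c = vector [a, b, c]"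

lemma three_simps [simp]: "three p q r 1 = p" "three p q r 2 = q" "three p q r 3 = r"
  by (simp_all add: three_def)

lemma range_three: "range (three p q r) = {p, q, r}"
  unfolding UNIV_3 by simp

lemma lat_simps [simp]: "lat a b $ 1 = real a" "lat a b $ 2 = real b" "lat a b $ 3 = 1"
  by (simp_all add: lat_def vector_3)

lemma lat_eq_iff [simp]: "lat a b = lat c d \<longleftrightarrow> a = c \<and> b = d"
  by (auto simp: vec_eq_iff forall_3)

lemma axis3_simps [simp]:
  "axis 1 (x::'a::zero) $ (1::3) = x" "axis 1 x $ (2::3) = 0" "axis 1 x $ (3::3) = 0"
  "axis 2 x $ (1::3) = 0" "axis 2 x $ (2::3) = x" "axis 2 x $ (3::3) = 0"
  "axis 3 x $ (1::3) = 0" "axis 3 x $ (2::3) = 0" "axis 3 x $ (3::3) = x"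
  by (auto simp: axis_def)

lemma lat_00: "lat 0 0 = axis 3 1"
  by (auto simp: vec_eq_iff forall_3)

lemma pairing_covec: "pairing (covec a b c) x = of_int a * x $ 1 + of_int b * x $ 2 + of_int c * x $ 3"
  by (simp add: pairing_def sum_3 covec_def vector_3)

text \<open>The cones over a triangulation. At height one the triangle with corners
  \<open>lat 0 0\<close>, \<open>lat N 0\<close>, \<open>lat 0 N\<close> is cut into unit triangles
  of two orientations (\<open>lower\<close> and \<open>upper\<close>). Beyond its hypotenuse each
  unit edge is joined to the first axis (\<open>side\<close>), and one cone with both axes remains
  (\<open>corner\<close>). The second components are the dual bases.\<close>

inductive_set A_frames :: "nat \<Rightarrow> ((3 \<Rightarrow> real^3) \<times> (3 \<Rightarrow> int^3)) set" for N where
  lower: "i + j + 1 \<le> N \<Longrightarrow>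
    (three (lat i j) (lat (i + 1) j) (lat i (j + 1)),
     three (covec (- 1) (- 1) (int (i + j + 1))) (covec 1 0 (- int i)) (covec 0 1 (- int j))) \<in> A_frames N"
| upper: "i + j + 2 \<le> N \<Longrightarrow>
    (three (lat (i + 1) j) (lat i (j + 1)) (lat (i + 1) (j + 1)),
     three (covec 0 (- 1) (int (j + 1))) (covec (- 1) 0 (int (i + 1))) (covec 1 1 (- int (i + j + 1)))) \<in> A_frames N"
| side: "i + j + 1 = N \<Longrightarrow>
    (three (axis 1 1) (lat (i + 1) j) (lat i (j + 1)),
     three (covec 1 1 (- int N)) (covec 0 (- 1) (int (j + 1))) (covec 0 1 (- int j))) \<in> A_frames N"
| corner: "(three (axis 1 1) (axis 2 1) (lat 0 N),
     three (covec 1 0 0) (covec 0 1 (- int N)) (covec 0 0 1)) \<in> A_frames N"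

definition A_gens :: "nat \<Rightarrow> (real^3) set" where
  "A_gens N = {axis 1 1, axis 2 1} \<union> {lat a b | a b. a + b \<le> N}"

lemma lattice_lat: "lat a b \<in> lattice3" and lattice_axis: "axis k 1 \<in> lattice3"
  by (auto simp: lattice3_def forall_3 axis_def)

lemma lattice_frame_three:
  "lattice_frame (three p q r) (three a b c) \<longleftrightarrow> p \<in> lattice3 \<and> q \<in> lattice3 \<and> r \<in> lattice3 \<and>
     pairing a p = 1 \<and> pairing a q = 0 \<and> pairing a r = 0 \<and>
     pairing b p = 0 \<and> pairing b q = 1 \<and> pairing b r = 0 \<and>
     pairing c p = 0 \<and> pairing c q = 0 \<and> pairing c r = 1"
  by (auto simp: lattice_frame_def range_three forall_3)

lemma A_frames_frame: "(v, w) \<in> A_frames N \<Longrightarrow> lattice_frame v w"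
  by (erule A_frames.cases)
     (simp_all add: lattice_frame_three lattice_lat lattice_axis pairing_covec algebra_simps)

lemma A_frames_gens: "(v, w) \<in> A_frames N \<Longrightarrow> v k \<in> A_gens N"
  by (erule A_frames.cases) (auto simp: A_gens_def three_def)

lemma A_gens_frames:
  assumes "g \<in> A_gens N"
  shows "\<exists>v w k. (v, w) \<in> A_frames N \<and> g = v k"
proof -
  consider "g = axis 1 1" | "g = axis 2 1" | a b where "a + b < N" "g = lat a b"
    | a b where "a + b = N" "a \<noteq> 0" "g = lat a b" | "g = lat 0 N"
    using assms unfolding A_gens_def le_less by fastforce
  then show ?thesis
  proof cases
    case 1 then show ?thesis using corner[of N] three_simps(1) by metis
  next
    case 2 then show ?thesis using corner[of N] three_simps(2) by metis
  next
    case (3 a b) then show ?thesis using lower[of a b N] three_simps(1)[of "lat a b"] by (metis Suc_eq_plus1 Suc_leI)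
  next
    case (4 a b)
    then obtain i where "a = i + 1" by (metis Suc_eq_plus1 not0_implies_Suc)
    with 4 have "(three (axis 1 1) (lat (i + 1) b) (lat i (b + 1)),
     three (covec 1 1 (- int N)) (covec 0 (- 1) (int (b + 1))) (covec 0 1 (- int b))) \<in> A_frames N"
      by (intro side) auto
    moreover have "g = three (axis 1 1) (lat (i + 1) b) (lat i (b + 1)) 2" using 4 \<open>a = i + 1\<close> by simp
    ultimately show ?thesis by blast
  next
    case 5 then show ?thesis using corner[of N] three_simps(3) by metis
  qed
qed

lemma finite_A_frames: "finite (A_frames N)"
proof -
  define F1 where "F1 = (\<lambda>(i, j). (three (lat i j) (lat (i + 1) j) (lat i (j + 1)),
     three (covec (- 1) (- 1) (int (i + j + 1))) (covec 1 0 (- int i)) (covec 0 1 (- int j))))"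
  define F2 where "F2 = (\<lambda>(i, j). (three (lat (i + 1) j) (lat i (j + 1)) (lat (i + 1) (j + 1)),
     three (covec 0 (- 1) (int (j + 1))) (covec (- 1) 0 (int (i + 1))) (covec 1 1 (- int (i + j + 1)))))"
  define F3 where "F3 = (\<lambda>(i, j). (three (axis 1 1) (lat (i + 1) j) (lat i (j + 1)),
     three (covec 1 1 (- int N)) (covec 0 (- 1) (int (j + 1))) (covec 0 1 (- int j))))"
  let ?G = "{..N} \<times> {..N}"
  let ?c = "(three (axis 1 1) (axis 2 1) (lat 0 N), three (covec 1 0 0) (covec 0 1 (- int N)) (covec 0 0 1))"
  have "(v, w) \<in> F1 ` ?G \<union> F2 ` ?G \<union> F3 ` ?G \<union> {?c}"
    if "(v, w) \<in> A_frames N" for v w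
    using that
  proof cases
    case (lower i j)
    then have "(v, w) = F1 (i, j)" "(i, j) \<in> ?G" by (auto simp: F1_def)
    then show ?thesis by blast
  next
    case (upper i j)
    then have "(v, w) = F2 (i, j)" "(i, j) \<in> ?G" by (auto simp: F2_def)
    then show ?thesis by blast
  next
    case (side i j)
    then have "(v, w) = F3 (i, j)" "(i, j) \<in> ?G" by (auto simp: F3_def)
    then show ?thesis by blast
  next
    case corner then show ?thesis by blast
  qed
  then have "A_frames N \<subseteq> F1 ` ?G \<union> F2 ` ?G \<union> F3 ` ?G \<union> {?c}" by (rule subrelI)
  then show ?thesis by (rule finite_subset) auto
qed

text \<open>On the points \<open>lat a b\<close> the height is $a^2 + b^2 + (a + b)^2$. Interpolating each square linearly
  between consecutive integers gives the functional that certifies a simplex of the triangulation by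
  strips; the heights of the first two axes only have to be large enough.\<close>

definition A_height :: "nat \<Rightarrow> real^3 \<Rightarrow> real" where
  "A_height N x = (if x $ 3 = 0 then (4 * N + 3) * x $ 1 + (8 * N + 4) * x $ 2
                   else (x $ 1)^2 + (x $ 2)^2 + (x $ 1 + x $ 2)^2)"

text \<open>This is the gap between a^2 and the line through its values at i and i + 1. An integer
  never lies strictly between these two, so convexity gives the sign.\<close>

lemma strip_nonneg: "0 \<le> (real a - real i) * (real a - real i - 1)"
proof (cases "a \<le> i")
  case True then show ?thesis by (intro mult_nonpos_nonpos) auto
next
  case False then show ?thesis by (intro mult_nonneg_nonneg) auto
qed

lemma strip_pos:
  assumes "a \<noteq> i" "a \<noteq> i + 1"
  shows "0 < (real a - real i) * (real a - real i - 1)"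
proof (cases "a < i")
  case True then show ?thesis by (intro mult_neg_neg) auto
next
  case False then show ?thesis using assms by (intro mult_pos_pos) auto
qed

lemma inner3: "(u :: real^3) \<bullet> x = u $ 1 * x $ 1 + u $ 2 * x $ 2 + u $ 3 * x $ 3"
  by (simp add: inner_vec_def sum_3)

text \<open>\<open>u\<close> is the sum of the interpolations of a^2 on [i, i + 1], of b^2 on
  [j, j + 1] and of (a + b)^2 on [k, k + 1], so its difference to the height is the sum of three
  gaps. The bounds on \<open>k\<close> keep \<open>u\<close> below the chosen heights of the two
  axes.\<close>

lemma strip_height:
  fixes i j k N :: nat
  defines "u \<equiv> vector [real (2*i+1) + real (2*k+1), real (2*j+1) + real (2*k+1),
       - real (i*(i+1) + j*(j+1) + k*(k+1))] :: real^3"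
  assumes ijk: "k < N" "i + j \<le> k"
  shows "A_height N (lat a b) - u \<bullet> lat a b = (real a - real i) * (real a - real i - 1)
     + (real b - real j) * (real b - real j - 1) + (real (a + b) - real k) * (real (a + b) - real k - 1)"
    and "u \<bullet> axis 1 1 < A_height N (axis 1 1)" "u \<bullet> axis 2 1 < A_height N (axis 2 1)"
  using ijk by (simp_all add: u_def A_height_def inner3 vector_3 power2_eq_square algebra_simps)

lemma A_heights_gens:
  assumes "(v, w) \<in> A_frames N"
  shows "\<exists>u. (\<forall>k. u \<bullet> v k = A_height N (v k)) \<and> (\<forall>g\<in>A_gens N. g \<notin> range v \<longrightarrow> u \<bullet> g < A_height N g)"
  using assms
proof cases
  case (lower i j)
  \<comment> \<open>Three strips of width one meet in exactly the three vertices of the triangle,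
    and outside one of them its gap is positive.\<close>
  define u :: "real^3" where "u = vector [real (2*i+1) + real (2*(i + j)+1), real (2*j+1) + real (2*(i + j)+1),
       - real (i*(i+1) + j*(j+1) + (i + j)*(i + j+1))]"
  note h = strip_height[of "i + j" N i j, folded u_def]
  have eq: "u \<bullet> lat a b = A_height N (lat a b)" if "a \<in> {i, i+1}" "b \<in> {j, j+1}" "a + b \<in> {i+j, i+j+1}" for a b
    using h(1)[of a b] that lower by auto
  have lt: "u \<bullet> lat a b < A_height N (lat a b)" if nm: "\<not> (a \<in> {i, i+1} \<and> b \<in> {j, j+1} \<and> a + b \<in> {i+j, i+j+1})" for a b
  proof -
    have h': "A_height N (lat a b) - u \<bullet> lat a b = (real a - real i) * (real a - real i - 1)
        + (real b - real j) * (real b - real j - 1) + (real (a + b) - real (i + j)) * (real (a + b) - real (i + j) - 1)"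
      by (rule h(1)) (use lower(3) in auto)
    note nn = strip_nonneg[of a i] strip_nonneg[of b j] strip_nonneg[of "a + b" "i + j"]
    consider "a \<noteq> i" "a \<noteq> i + 1" | "b \<noteq> j" "b \<noteq> j + 1" | "a + b \<noteq> i + j" "a + b \<noteq> i + j + 1"
      using nm by blast
    then have "0 < A_height N (lat a b) - u \<bullet> lat a b"
    proof cases
      case 1 then show ?thesis unfolding h' using strip_pos[OF 1] nn by linarith
    next
      case 2 then show ?thesis unfolding h' using strip_pos[OF 2] nn by linarith
    next
      case 3 then show ?thesis unfolding h' using strip_pos[OF 3] nn by linarith
    qed
    then show ?thesis by simp
  qed
  show ?thesis
  proof (intro exI[of _ u] conjI allI ballI impI)
    fix k show "u \<bullet> v k = A_height N (v k)"
      unfolding lower three_def by (auto intro!: eq)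
  next
    fix g assume g: "g \<in> A_gens N" "g \<notin> range v"
    then show "u \<bullet> g < A_height N g"
      using h(2,3) lower(3) unfolding A_gens_def lower range_three by (auto intro!: lt)
  qed
next
  case (upper i j)
  \<comment> \<open>The strip for a + b is moved up by one, which selects the other half of the unit
    square.\<close>
  define u :: "real^3" where "u = vector [real (2*i+1) + real (2*(i + j + 1)+1), real (2*j+1) + real (2*(i + j + 1)+1),
       - real (i*(i+1) + j*(j+1) + (i + j + 1)*(i + j + 1+1))]"
  note h = strip_height[of "i + j + 1" N i j, folded u_def]
  have eq: "u \<bullet> lat a b = A_height N (lat a b)" if "a \<in> {i, i+1}" "b \<in> {j, j+1}" "a + b \<in> {i+j+1, i+j+1+1}" for a b
    using h(1)[of a b] that upper by auto
  have lt: "u \<bullet> lat a b < A_height N (lat a b)" if nm: "\<not> (a \<in> {i, i+1} \<and> b \<in> {j, j+1} \<and> a + b \<in> {i+j+1, i+j+1+1})" for a b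
  proof -
    have h': "A_height N (lat a b) - u \<bullet> lat a b = (real a - real i) * (real a - real i - 1)
        + (real b - real j) * (real b - real j - 1) + (real (a + b) - real (i + j + 1)) * (real (a + b) - real (i + j + 1) - 1)"
      by (rule h(1)) (use upper(3) in auto)
    note nn = strip_nonneg[of a i] strip_nonneg[of b j] strip_nonneg[of "a + b" "i + j + 1"]
    consider "a \<noteq> i" "a \<noteq> i + 1" | "b \<noteq> j" "b \<noteq> j + 1" | "a + b \<noteq> i + j + 1" "a + b \<noteq> i + j + 1 + 1"
      using nm by blast
    then have "0 < A_height N (lat a b) - u \<bullet> lat a b"
    proof cases
      case 1 then show ?thesis unfolding h' using strip_pos[OF 1] nn by linarith
    next
      case 2 then show ?thesis unfolding h' using strip_pos[OF 2] nn by linarith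
    next
      case 3 then show ?thesis unfolding h' using strip_pos[OF 3] nn by linarith
    qed
    then show ?thesis by simp
  qed
  show ?thesis
  proof (intro exI[of _ u] conjI allI ballI impI)
    fix k show "u \<bullet> v k = A_height N (v k)"
      unfolding upper three_def by (auto intro!: eq)
  next
    fix g assume g: "g \<in> A_gens N" "g \<notin> range v"
    then show "u \<bullet> g < A_height N g"
      using h(2,3) upper(3) unfolding A_gens_def upper range_three by (auto intro!: lt)
  qed
next
  case (side i j)
  \<comment> \<open>The first entry is the height of the first axis; the other two are solved from
    the heights of the two edge points on a + b = N.\<close>
  define u :: "real^3" where "u = vector [4*N+3, 4*N+3 + 2*(2*real j+1) - 2*real N, 
      - (4*N+3)*real N - 2*real j*(real j+1) + 2*(real N)^2]"
  \<comment> \<open>Along a + b = N the height is a quadratic in b with leading coefficient 2, hence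
    the first gap; the second term vanishes on that line and is positive below it.\<close>
  have diff: "A_height N (lat a b) - u \<bullet> lat a b = 2 * ((real b - real j) * (real b - real j - 1))
      + (real N - a - b) * (2 * (real N - a - b) + 3 + 2 * b)" for a b
    by (simp add: u_def A_height_def inner3 vector_3 power2_eq_square algebra_simps)
  have lt: "u \<bullet> lat a b < A_height N (lat a b)" if ab: "a + b \<le> N" and n: "\<not> (a + b = N \<and> b \<in> {j, j+1})" for a b
  proof -
    have s: "real N - a - b \<ge> 0" using ab by linarith
    have "0 < 2 * ((real b - real j) * (real b - real j - 1)) + (real N - a - b) * (2 * (real N - a - b) + 3 + 2 * b)"
    proof (cases "a + b = N")
      case True
      then have "0 < (real b - real j) * (real b - real j - 1)" using n by (intro strip_pos) auto
      then show ?thesis using True by auto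
    next
      case False
      then have "real N - a - b > 0" using ab by linarith
      then have "0 < (real N - a - b) * (2 * (real N - a - b) + 3 + 2 * b)"
        by (intro mult_pos_pos) auto
      then show ?thesis using strip_nonneg[of b j] by linarith
    qed
    then show ?thesis using diff[of a b] by linarith
  qed
  show ?thesis
  proof (intro exI[of _ u] conjI allI ballI impI)
    fix k show "u \<bullet> v k = A_height N (v k)"
    proof -
      have z: "real N - real (i + 1) - real j = 0" "real N - real i - real (j + 1) = 0"
        using side(3) by auto
      have "A_height N (lat (i + 1) j) - u \<bullet> lat (i + 1) j = 0"
        "A_height N (lat i (j + 1)) - u \<bullet> lat i (j + 1) = 0"
        unfolding diff z by simp_all
      moreover have "u \<bullet> axis 1 1 = A_height N (axis 1 1)"
        by (simp add: u_def A_height_def inner3 vector_3)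
      ultimately show ?thesis unfolding side three_def by simp
    qed
  next
    fix g assume g: "g \<in> A_gens N" "g \<notin> range v"
    have "u \<bullet> axis 2 1 < A_height N (axis 2 1)"
      using side(3) by (simp add: u_def A_height_def inner3 vector_3)
    show "u \<bullet> g < A_height N g"
    proof (cases "g = axis 2 1")
      case False
      have ran: "range v = {axis 1 1, lat (i + 1) j, lat i (j + 1)}" unfolding side(1) range_three ..
      then obtain a b where ab: "g = lat a b" "a + b \<le> N"
        using g False unfolding A_gens_def by blast
      have "\<not> (a + b = N \<and> b \<in> {j, j + 1})"
        using g(2) side(3) unfolding ran ab(1) by auto
      then show ?thesis unfolding ab(1) by (intro lt ab(2))
    qed (use \<open>u \<bullet> axis 2 1 < A_height N (axis 2 1)\<close> in simp)
  qed
next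
  case corner
  \<comment> \<open>Forced by the three vertices: the heights of the two axes, and 2 N^2 at
    \<open>lat 0 N\<close>.\<close>
  define u :: "real^3" where "u = vector [4*N+3, 8*N+4, 2*(real N)^2 - (8*N+4)*real N]"
  have lt: "u \<bullet> lat a b < A_height N (lat a b)" if ab: "a + b \<le> N" and n: "b \<noteq> N" for a b
  proof -
    \<comment> \<open>\<open>t\<close> measures the distance from b = N. As a \<le> t, every term of
      the gap below is nonnegative, and the last one is at least 1.\<close>
    define t where "t = real N - b"
    have b: "real b = real N - t" by (simp add: t_def)
    have t: "1 \<le> t" "real a \<le> t" using ab n by (auto simp: t_def)
    have eq: "A_height N (lat a b) - u \<bullet> lat a b = (real a)^2 + t^2 + (real a - t)^2 + 2 * real N * a
       + (4 * real N + 3) * (t - a) + t"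
      by (simp add: u_def A_height_def inner3 vector_3 b power2_eq_square algebra_simps)
    have "0 \<le> (4 * real N + 3) * (t - a)" using t by (intro mult_nonneg_nonneg) auto
    moreover have "0 \<le> 2 * real N * a" by simp
    moreover have "0 \<le> (real a)^2" "0 \<le> t^2" "0 \<le> (real a - t)^2" by simp_all
    ultimately show ?thesis using eq t(1) by linarith
  qed
  show ?thesis
  proof (intro exI[of _ u] conjI allI ballI impI)
    fix k show "u \<bullet> v k = A_height N (v k)"
      unfolding corner three_def by (auto simp: u_def A_height_def inner3 vector_3 power2_eq_square algebra_simps)
  next
    fix g assume g: "g \<in> A_gens N" "g \<notin> range v"
    then show "u \<bullet> g < A_height N g"
      unfolding A_gens_def corner range_three by (auto intro!: lt)
  qed
qed

definition A_fan :: "nat \<Rightarrow> (real^3) set set" where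
  "A_fan N = frame_fan (A_frames N)"

lemma is_fan_A_fan: "is_fan (A_fan N)"
  unfolding A_fan_def
proof (rule coherent_fan[where \<phi> = "A_height N"])
  show "finite (A_frames N)" by (rule finite_A_frames)
  show "A_frames N \<noteq> {}" using corner by blast
  fix v w assume vw: "(v, w) \<in> A_frames N"
  show "lattice_frame v w" by (rule A_frames_frame[OF vw])
  show "\<exists>u. (\<forall>k. u \<bullet> v k = A_height N (v k)) \<and>
       (\<forall>(v', w') \<in> A_frames N. \<forall>k. v' k \<notin> range v \<longrightarrow> u \<bullet> v' k < A_height N (v' k))"
  proof -
    obtain u where u: "\<forall>k. u \<bullet> v k = A_height N (v k)"
      "\<forall>g\<in>A_gens N. g \<notin> range v \<longrightarrow> u \<bullet> g < A_height N g"
      using A_heights_gens[OF vw] by blast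
    show ?thesis
    proof (intro exI[of _ u] conjI u(1) ballI, clarsimp)
      fix v' w' k assume "(v', w') \<in> A_frames N" "v' k \<notin> range v"
      then show "u \<bullet> v' k < A_height N (v' k)" using u(2) A_frames_gens[of v' w' N k] by simp
    qed
  qed
qed

lemma rays_A_fan: "rays (A_fan N) = ray ` A_gens N"
proof -
  have "A_gens N = {v k | v w k. (v, w) \<in> A_frames N}"
    using A_frames_gens A_gens_frames by blast
  then have "ray ` A_gens N = {ray (v k) | v w k. (v, w) \<in> A_frames N}" by auto
  then show ?thesis
    unfolding A_fan_def using rays_frame_fan[OF A_frames_frame, of "A_frames N"] by simp
qed

lemma A_frames_cover:
  assumes "x \<in> octant"
  shows "\<exists>(v, w) \<in> A_frames N. x \<in> convex_cone hull (range v)"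
proof -
  have nn: "0 \<le> x $ 1" "0 \<le> x $ 2" "0 \<le> x $ 3" using assms by (auto simp: octant_def)
  have mem: ?thesis if "(v, three p q r) \<in> A_frames N" "0 \<le> pairing p x" "0 \<le> pairing q x" "0 \<le> pairing r x" for v p q r
    using that frame_full_cone_iff[OF A_frames_frame[OF that(1)], of x] by (auto simp: forall_3)
  show ?thesis
  \<comment> \<open>The cone \<open>corner\<close> takes both the points at height zero, which
    cannot be scaled to height one, and those whose scaled second coordinate is at least N.\<close>
  proof (cases "x $ 3 = 0 \<or> x $ 2 \<ge> N * x $ 3")
    case True
    then show ?thesis using nn by (intro mem[OF corner]) (auto simp: pairing_covec)
  next
    case False
    then have z: "x $ 3 > 0" and y: "x $ 2 < N * x $ 3" using nn by auto
    \<comment> \<open>At height one the point lies in the unit square with lower corner (i, j); its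
      coordinate sum then decides between \<open>side\<close>, \<open>lower\<close> and
      \<open>upper\<close>.\<close>
    define i where "i = nat \<lfloor>x $ 1 / x $ 3\<rfloor>"
    define j where "j = nat \<lfloor>x $ 2 / x $ 3\<rfloor>"
    have i: "real i \<le> x $ 1 / x $ 3" "x $ 1 / x $ 3 < real i + 1"
      unfolding i_def using nn by (simp_all add: of_nat_nat) 
    have j: "real j \<le> x $ 2 / x $ 3" "x $ 2 / x $ 3 < real j + 1"
      unfolding j_def using nn by (simp_all add: of_nat_nat)
    have i': "real i * x $ 3 \<le> x $ 1" "x $ 1 \<le> (real i + 1) * x $ 3"
      using i z by (simp_all add: field_simps)
    have j': "real j * x $ 3 \<le> x $ 2" "x $ 2 \<le> (real j + 1) * x $ 3"
      using j z by (simp_all add: field_simps)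
    have jN: "j < N"
    proof -
      have "real j * x $ 3 < real N * x $ 3" using j'(1) y by linarith
      then show ?thesis using z by simp
    qed
    show ?thesis
    proof (cases "x $ 1 + x $ 2 \<ge> N * x $ 3")
      case True
      \<comment> \<open>Beyond the hypotenuse the edge is selected by \<open>j\<close> alone, and
        its other index N - 1 - j follows.\<close>
      have s: "(N - 1 - j) + j + 1 = N" using jN by simp
      show ?thesis using True j' by (intro mem[OF side[OF s]]) (auto simp: pairing_covec algebra_simps)
    next
      case False
      have "(real i + real j) * x $ 3 < N * x $ 3" using i' j' False by (simp add: algebra_simps)
      then have "real i + real j < real N" using z by simp
      then have ij: "i + j + 1 \<le> N" by linarith
      show ?thesis
      proof (cases "x $ 1 + x $ 2 \<le> (real i + real j + 1) * x $ 3")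
        case True
        then show ?thesis using i' j' by (intro mem[OF lower[OF ij]]) (auto simp: pairing_covec algebra_simps)
      next
        case F: False
        then have "(real i + real j + 1) * x $ 3 < N * x $ 3" using False by linarith
        then have "real i + real j + 1 < real N" using z by simp
        then have ij: "i + j + 2 \<le> N" by linarith
        show ?thesis using i' j' F by (intro mem[OF upper[OF ij]]) (auto simp: pairing_covec algebra_simps)
      qed
    qed
  qed
qed

lemma A_fan_framed:
  assumes "\<tau> \<in> A_fan N"
  obtains v w where "(v, w) \<in> A_frames N" "\<tau> \<subseteq> convex_cone hull (range v)"
  using assms unfolding A_fan_def frame_fan_def by clarify (metis hull_mono image_mono subset_UNIV)

section \<open>The polynomial of the singularity\<close>

lemma eval_poly_binomial:
  assumes "\<phi> 1 = 1" "\<phi> (- 1) = - 1" "i \<noteq> j"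
  shows "eval_poly \<phi> (Poly_Mapping.single i 1 - Poly_Mapping.single j 1) a =
    (\<Prod>k\<in>UNIV. (a $ k) ^ (i $ k)) - (\<Prod>k\<in>UNIV. (a $ k) ^ (j $ k))"
proof -
  have "Poly_Mapping.keys (Poly_Mapping.single i 1 - Poly_Mapping.single j 1 :: poly3) = {i, j}"
    using assms(3) by (auto simp: in_keys_iff lookup_minus lookup_single when_def split: if_splits)
  then show ?thesis
    using assms by (simp add: eval_poly_def lookup_minus lookup_single)
qed

lemma coord_var_power: "coord_var k ^ m = Poly_Mapping.single (axis k m) 1"
proof (induct m)
  case 0
  have "axis k 0 = (0 :: nat^3)" by (simp add: vec_eq_iff axis_def)
  then show ?case by (simp only: power_0 single_one)
next
  case (Suc m)
  have "axis k (Suc 0) + axis k m = (axis k (Suc m) :: nat^3)" by (simp add: vec_eq_iff axis_def)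
  then show ?case using Suc by (simp add: coord_var_def mult_single)
qed

lemma A_poly_eq: "A_poly n = Poly_Mapping.single (axis 1 1 + axis 2 1) 1 - Poly_Mapping.single (axis 3 (n + 1)) 1"
  unfolding A_poly_def coord_var_power by (simp add: coord_var_def mult_single)

lemma A_exponents_neq: "axis 1 1 + axis 2 1 \<noteq> (axis 3 (n + 1) :: nat^3)"
  by (auto simp: vec_eq_iff axis_def intro!: exI[of _ 1])

lemma keys_A_poly: "Poly_Mapping.keys (A_poly n) = {axis 1 1 + axis 2 1, axis 3 (n + 1)}"
  unfolding A_poly_eq using A_exponents_neq[of n]
  by (auto simp: in_keys_iff lookup_minus lookup_single when_def split: if_splits)

lemma eval_A_poly:
  assumes "\<phi> 1 = 1" "\<phi> (- 1) = - 1"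
  shows "eval_poly \<phi> (A_poly n) a = a $ 1 * a $ 2 - a $ 3 ^ (n + 1)"
  unfolding A_poly_eq eval_poly_binomial[OF assms A_exponents_neq]
  by (subst UNIV_3)+ (simp add: axis_def)

lemma zero_set_A_poly: "p \<in> zero_set (A_poly n) \<longleftrightarrow> p $ 1 * p $ 2 = p $ 3 ^ (n + 1)"
  by (simp add: zero_set_def eval_A_poly)

lemma compose_A_poly: "compose_arc (A_poly n) \<gamma> = \<gamma> $ 1 * \<gamma> $ 2 - \<gamma> $ 3 ^ (n + 1)"
proof -
  have "fps_const (- 1 :: complex) = - 1" by (simp flip: fps_const_neg)
  then show ?thesis unfolding compose_arc_def by (subst eval_A_poly) simp_all
qed

lemma compose_coord_var: "compose_arc (coord_var k) \<gamma> = \<gamma> $ k"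
proof -
  have "(\<Prod>j\<in>UNIV. (\<gamma> $ j) ^ (axis k 1 $ j)) = (\<Prod>j\<in>UNIV. if j = k then \<gamma> $ k else 1)"
    by (rule prod.cong) (auto simp: axis_def)
  then show ?thesis
    by (simp add: compose_arc_def eval_poly_def coord_var_def)
qed

section \<open>The Newton dual fan\<close>

context
  fixes n :: nat
begin

text \<open>The covectors for which the monomial xy has the least weight; \<open>high_cone\<close>
  is the same for z^(n+1). These are the two maximal cones of the dual fan.\<close>

definition low_cone :: "(real^3) set" where
  "low_cone = {x \<in> octant. x $ 1 + x $ 2 \<le> real (n + 1) * x $ 3}"

definition high_cone :: "(real^3) set" where
  "high_cone = {x \<in> octant. real (n + 1) * x $ 3 \<le> x $ 1 + x $ 2}"

definition p_low :: "real^3" where "p_low = vector [1, 1, 0]"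
definition p_high :: "real^3" where "p_high = vector [0, 0, real (n + 1)]"

lemma newton_polyhedron_A_poly: "newton_polyhedron (A_poly n) = convex hull ({p. \<forall>k. p_low $ k \<le> p $ k} \<union> {p. \<forall>k. p_high $ k \<le> p $ k})"
  by (simp add: newton_polyhedron_def keys_A_poly p_low_def p_high_def forall_3 vector_3)

lemma p_low_in: "p_low \<in> newton_polyhedron (A_poly n)" and p_high_in: "p_high \<in> newton_polyhedron (A_poly n)"
  unfolding newton_polyhedron_A_poly by (auto intro!: hull_inc)

lemma inner_low: "w \<bullet> p_low = w $ 1 + w $ 2" and inner_high: "w \<bullet> p_high = real (n + 1) * w $ 3"
  by (simp_all add: inner3 p_low_def p_high_def vector_3)

lemma inner_mono:
  assumes "w \<in> octant" "\<And>k. q $ k \<le> p $ k"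
  shows "w \<bullet> q \<le> w \<bullet> (p :: real^3)"
  using assms by (auto simp: inner3 octant_def intro!: add_mono mult_left_mono)

lemma newton_polyhedron_lower_bound:
  assumes w: "w \<in> octant" and q: "q \<in> newton_polyhedron (A_poly n)"
  shows "min (w \<bullet> p_low) (w \<bullet> p_high) \<le> w \<bullet> q"
proof -
  have "newton_polyhedron (A_poly n) \<subseteq> {q. w \<bullet> q \<ge> min (w \<bullet> p_low) (w \<bullet> p_high)}"
    unfolding newton_polyhedron_A_poly
  proof (rule hull_minimal)
    show "convex {q. w \<bullet> q \<ge> min (w \<bullet> p_low) (w \<bullet> p_high)}" by (rule convex_halfspace_ge)
    show "{p. \<forall>k. p_low $ k \<le> p $ k} \<union> {p. \<forall>k. p_high $ k \<le> p $ k}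
        \<subseteq> {q. w \<bullet> q \<ge> min (w \<bullet> p_low) (w \<bullet> p_high)}"
      using inner_mono[OF w] by (auto simp: min_le_iff_disj)
  qed
  then show ?thesis using q by auto
qed

lemma low_in_face: "w \<in> octant \<Longrightarrow> p_low \<in> newton_face (A_poly n) w \<longleftrightarrow> w \<in> low_cone"
  using newton_polyhedron_lower_bound[of w] p_low_in p_high_in
  by (auto simp: newton_face_def low_cone_def inner_low inner_high)

lemma high_in_face: "w \<in> octant \<Longrightarrow> p_high \<in> newton_face (A_poly n) w \<longleftrightarrow> w \<in> high_cone"
  using newton_polyhedron_lower_bound[of w] p_low_in p_high_in
  by (auto simp: newton_face_def high_cone_def inner_low inner_high)

text \<open>Strictly positive weights exclude all other points above \<open>p\<close>, and the
  second hypothesis excludes everything above \<open>q\<close>. To pass to the convex hull, the open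
  half-space beyond \<open>p\<close> with \<open>p\<close> added serves as a convex
  superset.\<close>

lemma face_singleton:
  assumes w: "\<And>k. 0 < w $ k" and lt: "w \<bullet> p < w \<bullet> q" and pq: "{p, q} = {p_low, p_high}"
  shows "newton_face (A_poly n) w = {p}"
proof -
  have oct: "w \<in> octant" using w by (auto simp: octant_def less_imp_le)
  have eqP: "newton_polyhedron (A_poly n) = convex hull ({x. \<forall>k. p $ k \<le> x $ k} \<union> {x. \<forall>k. q $ k \<le> x $ k})"
    using pq unfolding newton_polyhedron_A_poly by (auto simp: doubleton_eq_iff Un_commute)
  have strict: "w \<bullet> p < w \<bullet> x" if x: "\<And>k. p $ k \<le> x $ k" "x \<noteq> p" for x
  proof -
    obtain k where k: "x $ k \<noteq> p $ k" using x(2) by (auto simp: vec_eq_iff)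
    then have "p $ k < x $ k" using x(1)[of k] by simp
    then have "w $ k \<bullet> p $ k < w $ k \<bullet> x $ k" using w[of k] by simp
    then show ?thesis unfolding inner_vec_def
      using w x(1) by (intro sum_strict_mono_ex1) (auto intro!: mult_left_mono simp: less_imp_le)
  qed
  have "newton_polyhedron (A_poly n) \<subseteq> insert p {x. w \<bullet> p < w \<bullet> x}"
    unfolding eqP
  proof (rule hull_minimal)
    show "{x. \<forall>k. p $ k \<le> x $ k} \<union> {x. \<forall>k. q $ k \<le> x $ k} \<subseteq> insert p {x. w \<bullet> p < w \<bullet> x}"
      using strict inner_mono[OF oct, of q] lt by (auto intro: less_le_trans)
    show "convex (insert p {x. w \<bullet> p < w \<bullet> x})"
    proof (rule convexI)
      fix x y :: "real^3" and u v :: real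
      assume xy: "x \<in> insert p {x. w \<bullet> p < w \<bullet> x}" "y \<in> insert p {x. w \<bullet> p < w \<bullet> x}"
        and uv: "0 \<le> u" "0 \<le> v" "u + v = 1"
      have le: "w \<bullet> p \<le> w \<bullet> x" "w \<bullet> p \<le> w \<bullet> y" using xy by auto
      have eq: "w \<bullet> (u *\<^sub>R x + v *\<^sub>R y) - w \<bullet> p = u * (w \<bullet> x - w \<bullet> p) + v * (w \<bullet> y - w \<bullet> p)"
        using uv(3) by (simp add: inner_add_right algebra_simps) (metis distrib_right mult_1)
      show "u *\<^sub>R x + v *\<^sub>R y \<in> insert p {x. w \<bullet> p < w \<bullet> x}"
      proof (cases "(x = p \<or> u = 0) \<and> (y = p \<or> v = 0)")
        case True
        then have "u *\<^sub>R x + v *\<^sub>R y = p"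
          using uv by (auto simp: scaleR_add_left[symmetric])
        then show ?thesis by simp
      next
        case False
        then have "0 < u * (w \<bullet> x - w \<bullet> p) \<or> 0 < v * (w \<bullet> y - w \<bullet> p)"
          using xy uv by (auto simp: order_le_less)
        moreover have "0 \<le> u * (w \<bullet> x - w \<bullet> p)" "0 \<le> v * (w \<bullet> y - w \<bullet> p)"
          using uv le by auto
        ultimately show ?thesis using eq by auto
      qed
    qed
  qed
  moreover have "p \<in> newton_polyhedron (A_poly n)" using pq p_low_in p_high_in by (auto simp: doubleton_eq_iff)
  ultimately show ?thesis by (fastforce simp: newton_face_def)
qed

lemma closed_octant: "closed octant"
proof -
  have eq: "octant = (\<Inter>k. {x. axis k 1 \<bullet> x \<ge> 0})" by (auto simp: octant_def inner_axis')
  show ?thesis unfolding eq by (intro closed_INT ballI closed_halfspace_ge)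
qed

lemma closed_low_cone: "closed low_cone"
proof -
  have "low_cone = octant \<inter> {x. vector [1, 1, - real (n + 1)] \<bullet> x \<le> 0}"
    by (auto simp: low_cone_def inner3 vector_3 algebra_simps)
  then show ?thesis by (simp add: closed_octant closed_Int closed_halfspace_le)
qed

lemma closed_high_cone: "closed high_cone"
proof -
  have "high_cone = octant \<inter> {x. vector [1, 1, - real (n + 1)] \<bullet> x \<ge> 0}"
    by (auto simp: high_cone_def inner3 vector_3 algebra_simps)
  then show ?thesis by (simp add: closed_octant closed_Int closed_halfspace_ge)
qed

lemma closure_open_directions:
  fixes C :: "(real^3) set"
  assumes "x \<in> C" and "\<And>e. 0 < e \<Longrightarrow> x + e *\<^sub>R d \<in> D"
  shows "x \<in> closure D"
proof -
  have "((\<lambda>e. x + e *\<^sub>R d) \<longlongrightarrow> x + 0 *\<^sub>R d) (at_right 0)"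
    by (intro tendsto_intros)
  moreover have "\<forall>\<^sub>F e in at_right (0::real). x + e *\<^sub>R d \<in> closure D"
    using assms(2) closure_subset by (intro eventually_at_right_less[THEN eventually_mono]) blast
  ultimately show ?thesis
    using Lim_in_closed_set[of "closure D" "\<lambda>e. x + e *\<^sub>R d" "at_right (0::real)" "x + 0 *\<^sub>R d"] by simp
qed

lemma low_cone_in_dual_fan: "low_cone \<in> dual_fan (A_poly n)"
proof -
  \<comment> \<open>Interior for every \<open>n\<close>, since 2 < 3 (n + 1). Adding small positive
    multiples of \<open>w\<close> moves every point of the cone into the class of \<open>w\<close>,
    which is therefore dense.\<close>
  define w :: "real^3" where "w = vector [1, 1, 3]"
  have face: "newton_face (A_poly n) w' = {p_low}" if "\<And>k. 0 < w' $ k" "w' $ 1 + w' $ 2 < real (n + 1) * w' $ 3" for w'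
    using that by (intro face_singleton[of w' p_low p_high]) (auto simp: inner_low inner_high)
  have ww: "0 < w $ k" "w $ 1 + w $ 2 < real (n + 1) * w $ 3" "w \<in> octant" for k
    using exhaust_3[of k] by (auto simp: w_def vector_3 octant_def forall_3)
  let ?D = "{w' \<in> octant. newton_face (A_poly n) w' = newton_face (A_poly n) w}"
  have "?D \<subseteq> low_cone" using low_in_face face[OF ww(1,2)] by blast
  then have "closure ?D \<subseteq> low_cone" by (rule closure_minimal) (rule closed_low_cone)
  moreover have "x \<in> closure ?D" if "x \<in> low_cone" for x
  proof (rule closure_open_directions[OF that, of w])
    fix e :: real assume e: "0 < e"
    have pos: "0 < (x + e *\<^sub>R w) $ k" for k
      using that e ww(1)[of k] by (auto simp: low_cone_def octant_def intro!: add_nonneg_pos)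
    have "e * (w $ 1 + w $ 2) < e * (real (n + 1) * w $ 3)" using e ww(2) by simp
    then have lt: "(x + e *\<^sub>R w) $ 1 + (x + e *\<^sub>R w) $ 2 < real (n + 1) * (x + e *\<^sub>R w) $ 3"
      using that by (simp add: low_cone_def algebra_simps)
    show "x + e *\<^sub>R w \<in> ?D"
      using face[OF pos lt] face[OF ww(1,2)] pos by (auto simp: octant_def less_imp_le)
  qed
  ultimately have "low_cone = closure ?D" by blast
  then show ?thesis unfolding dual_fan_def using ww(3) by blast
qed

lemma high_cone_in_dual_fan: "high_cone \<in> dual_fan (A_poly n)"
proof -
  \<comment> \<open>Interior, since n + 1 < 2 (n + 1).\<close>
  define w :: "real^3" where "w = vector [real (n + 1), real (n + 1), 1]"
  have face: "newton_face (A_poly n) w' = {p_high}" if "\<And>k. 0 < w' $ k" "real (n + 1) * w' $ 3 < w' $ 1 + w' $ 2" for w'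
    using that by (intro face_singleton[of w' p_high p_low]) (auto simp: inner_low inner_high)
  have ww: "0 < w $ k" "real (n + 1) * w $ 3 < w $ 1 + w $ 2" "w \<in> octant" for k
    using exhaust_3[of k] by (auto simp: w_def vector_3 octant_def forall_3)
  let ?D = "{w' \<in> octant. newton_face (A_poly n) w' = newton_face (A_poly n) w}"
  have "?D \<subseteq> high_cone" using high_in_face face[OF ww(1,2)] by blast
  then have "closure ?D \<subseteq> high_cone" by (rule closure_minimal) (rule closed_high_cone)
  moreover have "x \<in> closure ?D" if "x \<in> high_cone" for x
  proof (rule closure_open_directions[OF that, of w])
    fix e :: real assume e: "0 < e"
    have pos: "0 < (x + e *\<^sub>R w) $ k" for k
      using that e ww(1)[of k] by (auto simp: high_cone_def octant_def intro!: add_nonneg_pos)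
    have "e * (real (n + 1) * w $ 3) < e * (w $ 1 + w $ 2)" using e ww(2) by simp
    then have lt: "real (n + 1) * (x + e *\<^sub>R w) $ 3 < (x + e *\<^sub>R w) $ 1 + (x + e *\<^sub>R w) $ 2"
      using that by (simp add: high_cone_def algebra_simps)
    show "x + e *\<^sub>R w \<in> ?D"
      using face[OF pos lt] face[OF ww(1,2)] pos by (auto simp: octant_def less_imp_le)
  qed
  ultimately have "high_cone = closure ?D" by blast
  then show ?thesis unfolding dual_fan_def using ww(3) by blast
qed

text \<open>The face of \<open>w\<close> contains \<open>p_low\<close> or \<open>p_high\<close>, all
  covectors of its class share this face, and both cones are closed. This replaces a list of all
  cones of the dual fan.\<close>

lemma dual_fan_cases:
  assumes "\<tau> \<in> dual_fan (A_poly n)"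
  shows "\<tau> \<subseteq> low_cone \<or> \<tau> \<subseteq> high_cone"
proof -
  obtain w where w: "w \<in> octant"
    and \<tau>: "\<tau> = closure {w' \<in> octant. newton_face (A_poly n) w' = newton_face (A_poly n) w}"
    using assms by (auto simp: dual_fan_def)
  have "w \<in> low_cone \<or> w \<in> high_cone" using w by (auto simp: low_cone_def high_cone_def)
  then show ?thesis
  proof
    assume "w \<in> low_cone"
    then have "\<tau> \<subseteq> low_cone"
      unfolding \<tau> by (intro closure_minimal closed_low_cone) (use low_in_face w in blast)
    then show ?thesis ..
  next
    assume "w \<in> high_cone"
    then have "\<tau> \<subseteq> high_cone"
      unfolding \<tau> by (intro closure_minimal closed_high_cone) (use high_in_face w in blast)
    then show ?thesis ..
  qed
qed

lemma Union_dual_fan: "\<Union> (dual_fan (A_poly n)) = octant"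
proof
  show "\<Union> (dual_fan (A_poly n)) \<subseteq> octant"
    using dual_fan_cases by (auto simp: low_cone_def high_cone_def)
  show "octant \<subseteq> \<Union> (dual_fan (A_poly n))"
  proof
    fix x assume "x \<in> octant"
    then have "x \<in> low_cone \<or> x \<in> high_cone" by (auto simp: low_cone_def high_cone_def)
    then show "x \<in> \<Union> (dual_fan (A_poly n))"
      using low_cone_in_dual_fan high_cone_in_dual_fan by blast
  qed
qed

lemma A_frame_in_dual_cone:
  assumes "(v, w) \<in> A_frames (n + 1)"
  shows "convex_cone hull (range v) \<subseteq> low_cone \<or> convex_cone hull (range v) \<subseteq> high_cone"
proof -
  have low: "convex_cone low_cone"
    by (auto simp: convex_cone_iff low_cone_def octant_def algebra_simps intro: add_mono)
      (metis distrib_left mult_left_mono add.commute)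
  have high: "convex_cone high_cone"
    by (auto simp: convex_cone_iff high_cone_def octant_def algebra_simps intro: add_mono)
      (metis distrib_left mult_left_mono add.commute)
  have "range v \<subseteq> low_cone \<or> range v \<subseteq> high_cone"
    using assms
    by cases (auto simp: range_three low_cone_def high_cone_def octant_def forall_3)
  then show ?thesis using hull_minimal[of _ _ convex_cone] low high by metis
qed

section \<open>Indecomposable lattice points of the two maximal cones\<close>

lemma axis_in_octant: "axis k 1 \<in> octant"
  by (auto simp: octant_def axis_def)

lemma lat_in_octant: "lat a b \<in> octant"
  by (auto simp: octant_def forall_3)

lemma octant_lattice_axis:
  assumes x: "x \<in> octant \<inter> lattice3" "y \<in> octant \<inter> lattice3" "axis k 1 = x + y"
  shows "x = 0 \<or> y = 0"
proof -
  have x: "0 \<le> x $ j" "x $ j \<in> \<int>" "0 \<le> y $ j" "y $ j \<in> \<int>" "axis k 1 $ j = x $ j + y $ j" for j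
    using assms by (auto simp: octant_def lattice3_def)
  have off: "x $ j = 0 \<and> y $ j = 0" if "j \<noteq> k" for j
    using x[of j] that by (simp add: axis_def add_nonneg_eq_0_iff)
  obtain c d where cd: "x $ k = of_int c" "y $ k = of_int d" using x(2,4)[of k] by (auto elim!: Ints_cases)
  have "real_of_int (c + d) = 1" "0 \<le> c" "0 \<le> d" using x(1,3,5)[of k] cd by (auto simp: axis_def)
  then have "c + d = 1" by linarith
  then have "c = 0 \<or> d = 0" using \<open>0 \<le> c\<close> \<open>0 \<le> d\<close> by linarith
  then show ?thesis using off cd by (auto simp: vec_eq_iff) (metis of_int_0)+
qed

text \<open>The third coordinate 1 is a sum of two nonnegative integers.\<close>

lemma lattice_height_split:
  assumes xy: "x \<in> lattice3" "y \<in> lattice3" "x \<in> octant" "y \<in> octant" "lat a b = x + y"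
  shows "x $ 3 = 0 \<or> y $ 3 = 0"
proof -
  have "x $ 3 \<in> \<int>" "y $ 3 \<in> \<int>" using xy by (auto simp: lattice3_def)
  then obtain c d where cd: "x $ 3 = of_int c" "y $ 3 = of_int d"
    by (metis Ints_cases)
  have "lat a b $ 3 = x $ 3 + y $ 3" using xy(5) by simp
  then have "real_of_int (c + d) = 1" using cd by simp
  moreover have "0 \<le> x $ 3" "0 \<le> y $ 3" using xy(3,4) by (auto simp: octant_def)
  then have "0 \<le> c" "0 \<le> d" using cd by simp_all
  ultimately have "c + d = 1" "0 \<le> c" "0 \<le> d" by linarith+
  then have "c = 0 \<or> d = 0" by linarith
  then show ?thesis using cd by auto
qed

lemma octant_zero: "x \<in> octant \<Longrightarrow> x $ 1 + x $ 2 \<le> 0 \<Longrightarrow> x $ 3 = 0 \<Longrightarrow> x = 0"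
  by (auto simp: octant_def vec_eq_iff forall_3)

text \<open>In this cone a summand at height zero has nonpositive sum of its first two coordinates,
  so it vanishes.\<close>

lemma lat_indecomposable_low:
  assumes "a + b \<le> n + 1"
  shows "lat a b \<in> indecomposables low_cone"
proof -
  have "real (a + b) \<le> real (n + 1)" using assms by (simp only: of_nat_le_iff)
  then have "lat a b \<in> low_cone" using lat_in_octant by (simp add: low_cone_def)
  moreover have "lat a b \<noteq> 0" by (simp add: vec_eq_iff forall_3)
  moreover have "x = 0 \<or> y = 0" if "x \<in> low_cone \<inter> lattice3" "y \<in> low_cone \<inter> lattice3" "lat a b = x + y" for x y
    using lattice_height_split[of x y a b] that octant_zero[of x] octant_zero[of y]
    by (auto simp: low_cone_def)
  ultimately show ?thesis using lattice_lat by (auto simp: indecomposables_def)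
qed

text \<open>If one summand has height zero, the other has height one and needs at least n + 1 in its
  first two coordinates, which is all that is available. For a + b > n + 1 an axis vector could be
  split off, hence the equality.\<close>

lemma lat_indecomposable_high:
  assumes "a + b = n + 1"
  shows "lat a b \<in> indecomposables high_cone"
proof -
  have ab: "real a + real b = real (n + 1)" using assms by (simp only: of_nat_add[symmetric])
  then have "lat a b \<in> high_cone" using lat_in_octant by (simp add: high_cone_def)
  moreover have "lat a b \<noteq> 0" by (simp add: vec_eq_iff forall_3)
  moreover have "x = 0 \<or> y = 0" if xy: "x \<in> high_cone \<inter> lattice3" "y \<in> high_cone \<inter> lattice3" "lat a b = x + y" for x y
  proof -
    have eqs: "lat a b $ k = x $ k + y $ k" for k using xy(3) by simp
    have s: "real (n + 1) = (x $ 1 + x $ 2) + (y $ 1 + y $ 2)" "1 = x $ 3 + y $ 3"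
      using eqs[of 1] eqs[of 2] eqs[of 3] ab by auto
    have "x $ 3 = 0 \<or> y $ 3 = 0" using lattice_height_split xy by (auto simp: high_cone_def)
    then show ?thesis
    proof
      assume z: "x $ 3 = 0"
      then have "real (n + 1) \<le> y $ 1 + y $ 2" using xy(2) s by (auto simp: high_cone_def)
      then show ?thesis using octant_zero[of x] z s xy(1) by (auto simp: high_cone_def)
    next
      assume z: "y $ 3 = 0"
      then have "real (n + 1) \<le> x $ 1 + x $ 2" using xy(1) s by (auto simp: high_cone_def)
      then show ?thesis using octant_zero[of y] z s xy(2) by (auto simp: high_cone_def)
    qed
  qed
  ultimately show ?thesis using lattice_lat by (auto simp: indecomposables_def)
qed

lemma axis_indecomposable_high:
  assumes "k \<noteq> 3"
  shows "axis k 1 \<in> indecomposables high_cone"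
proof -
  have "axis k 1 \<in> high_cone" using assms exhaust_3[of k] axis_in_octant by (auto simp: high_cone_def)
  moreover have "axis k 1 \<noteq> (0::real^3)" by (simp add: axis_eq_0_iff)
  ultimately show ?thesis
    using lattice_axis octant_lattice_axis[of _ _ k] by (auto simp: indecomposables_def high_cone_def)
qed

lemma dim_low_cone: "dim low_cone = 3"
proof -
  have "axis 3 1 \<in> low_cone" "lat 1 0 \<in> low_cone" "lat 0 1 \<in> low_cone"
    using lat_in_octant axis_in_octant by (auto simp: low_cone_def)
  moreover have "lattice_frame (three (axis 3 1) (lat 1 0) (lat 0 1)) (three (covec (-1) (-1) 1) (covec 1 0 0) (covec 0 1 0))"
    by (simp add: lattice_frame_three lattice_lat lattice_axis pairing_covec)
  then have "span (range (three (axis 3 1) (lat 1 0) (lat 0 1))) = UNIV" by (rule frame_span)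
  then have "span {axis 3 1, lat 1 0, lat 0 1} = UNIV" by (simp only: range_three)
  ultimately have "span low_cone = UNIV"
    by (metis span_mono top.extremum_uniqueI empty_subsetI insert_subset)
  then show ?thesis using dim_span[of low_cone] by simp
qed

lemma dim_high_cone: "dim high_cone = 3"
proof -
  have "axis 1 1 \<in> high_cone" "axis 2 1 \<in> high_cone" "lat 0 (n + 1) \<in> high_cone"
    using lat_in_octant axis_in_octant by (auto simp: high_cone_def)
  moreover have "span {axis 1 1, axis 2 1, lat 0 (n + 1)} = UNIV"
    using frame_span[OF A_frames_frame[OF corner]] unfolding range_three by metis
  ultimately have "span high_cone = UNIV"
    by (metis span_mono top.extremum_uniqueI empty_subsetI insert_subset)
  then show ?thesis using dim_span[of high_cone] by simp
qed

lemma regular_subdivision_A_fan: "regular_subdivision (A_fan (n + 1)) (dual_fan (A_poly n))"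
  unfolding regular_subdivision_def
proof (intro conjI ballI)
  show "is_fan (A_fan (n + 1))" by (rule is_fan_A_fan)
  fix \<sigma> assume \<sigma>: "\<sigma> \<in> A_fan (n + 1)"
  show "regular_cone \<sigma>"
    using \<sigma> frame_regular[OF A_frames_frame] by (auto simp: A_fan_def frame_fan_def)
  show "\<exists>\<tau>\<in>dual_fan (A_poly n). \<sigma> \<subseteq> \<tau>"
  proof -
    obtain v w where "(v, w) \<in> A_frames (n + 1)" "\<sigma> \<subseteq> convex_cone hull (range v)"
      using A_fan_framed[OF \<sigma>] by blast
    then have "\<sigma> \<subseteq> low_cone \<or> \<sigma> \<subseteq> high_cone" using A_frame_in_dual_cone by blast
    then show ?thesis using low_cone_in_dual_fan high_cone_in_dual_fan by blast
  qed
next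
  show "\<Union> (A_fan (n + 1)) = \<Union> (dual_fan (A_poly n))"
    unfolding Union_dual_fan
  proof
    show "\<Union> (A_fan (n + 1)) \<subseteq> octant"
    proof
      fix x assume "x \<in> \<Union> (A_fan (n + 1))"
      then obtain \<sigma> where \<sigma>: "\<sigma> \<in> A_fan (n + 1)" "x \<in> \<sigma>" by blast
      obtain v w where "(v, w) \<in> A_frames (n + 1)" "\<sigma> \<subseteq> convex_cone hull (range v)"
        using A_fan_framed[OF \<sigma>(1)] by blast
      then have "x \<in> low_cone \<or> x \<in> high_cone" using A_frame_in_dual_cone \<sigma>(2) by blast
      then show "x \<in> octant" by (auto simp: low_cone_def high_cone_def)
    qed
    show "octant \<subseteq> \<Union> (A_fan (n + 1))"
    proof
      fix x assume "x \<in> octant"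
      then obtain v w where "(v, w) \<in> A_frames (n + 1)" "x \<in> convex_cone hull (range v)"
        using A_frames_cover[of x "n + 1"] by blast
      then show "x \<in> \<Union> (A_fan (n + 1))" unfolding A_fan_def using frame_fanI by blast
    qed
  qed
qed

lemma minimal_A_fan: "minimal_subdivision (A_fan (n + 1)) (dual_fan (A_poly n))"
  unfolding minimal_subdivision_def rays_A_fan
proof (intro ballI disjI2)
  fix \<rho> assume "\<rho> \<in> ray ` A_gens (n + 1)"
  then obtain g where g: "g \<in> A_gens (n + 1)" "\<rho> = ray g" by blast
  then consider "g = axis 1 1" | "g = axis 2 1" | a b where "a + b \<le> n + 1" "g = lat a b"
    unfolding A_gens_def by blast
  then have "g \<in> indecomposables low_cone \<or> g \<in> indecomposables high_cone"
    by cases (simp_all add: axis_indecomposable_high lat_indecomposable_low)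
  then show "\<exists>\<sigma>\<in>dual_fan (A_poly n). dim \<sigma> = 3 \<and> (\<exists>x\<in>indecomposables \<sigma>. \<rho> = ray x)"
    using low_cone_in_dual_fan high_cone_in_dual_fan dim_low_cone dim_high_cone g(2) by blast
qed

text \<open>In a regular cone a lattice point has integral coordinates, so a generator with nonzero
  coordinate can be subtracted without leaving the cone. Indecomposability in the larger cone then
  forces the point to be that generator.\<close>

lemma regular_subdivision_indecomposable:
  assumes \<Sigma>: "is_fan \<Sigma>" and \<sigma>: "\<sigma> \<in> \<Sigma>" "regular_cone \<sigma>" "\<sigma> \<subseteq> \<tau>"
    and x: "x \<in> \<sigma>" "x \<in> indecomposables \<tau>"
  shows "ray x \<in> rays \<Sigma>"
proof -
  obtain B V where "lattice_basis B" "V \<subseteq> B" and \<sigma>V: "\<sigma> = convex_cone hull V"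
    using \<sigma>(2) by (auto simp: regular_cone_def)
  then obtain v w where fr: "lattice_frame v w" and "V \<subseteq> range v"
    using lattice_basis_frame by metis
  then obtain J where V: "V = v ` J" by (meson subset_imageE)
  have xl: "x \<in> lattice3" and x0: "x \<noteq> 0" using x(2) by (auto simp: indecomposables_def)
  have c: "0 \<le> pairing (w k) x" "k \<notin> J \<Longrightarrow> pairing (w k) x = 0" for k
    using x(1) unfolding \<sigma>V V frame_cone_iff[OF fr] by auto
  obtain k where k: "pairing (w k) x \<noteq> 0"
    using x0 frame_eqI[OF fr, of x 0] by (auto simp: pairing_0)
  then have kJ: "k \<in> J" using c by blast
  have "1 \<le> pairing (w k) x" using pairing_int[OF xl, of "w k"] c(1)[of k] k by (auto elim!: Ints_cases)
  then have "x - v k \<in> \<sigma>"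
    using c kJ unfolding \<sigma>V V frame_cone_iff[OF fr] by (auto simp: pairing_diff frame_pairing[OF fr])
  moreover have "x - v k \<in> lattice3"
    using xl frame_lattice[OF fr, of k] by (auto simp: lattice3_def)
  moreover have vk: "v k \<in> \<sigma>" using kJ unfolding \<sigma>V V by (simp add: hull_inc)
  moreover have "x = v k + (x - v k)" by simp
  ultimately have "v k = 0 \<or> x - v k = 0"
    using x(2) \<sigma>(3) frame_lattice[OF fr, of k] unfolding indecomposables_def by blast
  moreover have "v k \<noteq> 0" using frame_pairing[OF fr, of k k] by (auto simp: pairing_0)
  ultimately have xv: "x = v k" by simp
  have "ray (v k) face_of \<sigma>" unfolding \<sigma>V V using frame_face[OF fr, of "{k}" J] kJ by simp
  moreover have "ray (v k) \<noteq> {}" by (simp add: convex_cone_hull_nonempty)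
  ultimately have "ray (v k) \<in> \<Sigma>" using \<Sigma> \<sigma>(1) unfolding is_fan_def by blast
  then show ?thesis using frame_dim_cone[OF fr, of "{k}"] by (simp add: rays_def xv)
qed

lemma lat_ray_in_resolution:
  assumes \<Sigma>: "regular_subdivision \<Sigma> (dual_fan (A_poly n))" and ab: "a + b \<le> n + 1"
  shows "ray (lat a b) \<in> rays \<Sigma>"
proof -
  have "lat a b \<in> \<Union>\<Sigma>"
    using \<Sigma> lat_in_octant unfolding regular_subdivision_def Union_dual_fan by simp
  then obtain \<sigma> \<tau> where \<sigma>: "\<sigma> \<in> \<Sigma>" "lat a b \<in> \<sigma>" and \<tau>: "\<tau> \<in> dual_fan (A_poly n)" "\<sigma> \<subseteq> \<tau>"
    using \<Sigma> unfolding regular_subdivision_def by blast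
  have fan: "is_fan \<Sigma>" "regular_cone \<sigma>" using \<Sigma> \<sigma> unfolding regular_subdivision_def by auto
  consider "\<sigma> \<subseteq> low_cone" | "\<sigma> \<subseteq> high_cone" using dual_fan_cases[OF \<tau>(1)] \<tau>(2) by blast
  then show ?thesis
  proof cases
    case 1
    then show ?thesis
      using regular_subdivision_indecomposable[OF fan(1) \<sigma>(1) fan(2)] \<sigma>(2) lat_indecomposable_low[OF ab] by blast
  next
    case 2
    then have "real (n + 1) \<le> real a + real b" using \<sigma>(2) by (auto simp: high_cone_def)
    then have "a + b = n + 1" using ab by linarith
    then show ?thesis
      using 2 regular_subdivision_indecomposable[OF fan(1) \<sigma>(1) fan(2)] \<sigma>(2) lat_indecomposable_high by blast
  qed
qed

end

lemma standard_rays_eq: "standard_rays = {ray (axis 1 1), ray (axis 2 1), ray (axis 3 1)}"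
  by (auto simp: standard_rays_def image_iff) (metis exhaust_3)+

lemma ray_lat_eq_iff: "ray (lat a b) = ray (lat c d) \<longleftrightarrow> a = c \<and> b = d"
proof
  assume "ray (lat a b) = ray (lat c d)"
  then have "lat a b \<in> ray (lat c d)" by (metis hull_inc insertI1)
  then obtain t where "lat a b = t *\<^sub>R lat c d" by (auto simp: ray_eq)
  then have "lat a b $ k = t * lat c d $ k" for k by simp
  from this[of 1] this[of 2] this[of 3] show "a = c \<and> b = d" by simp
qed simp

lemma ray_lat_standard_iff: "ray (lat a b) \<in> standard_rays \<longleftrightarrow> a = 0 \<and> b = 0"
proof -
  have "ray (lat a b) \<noteq> ray (axis k 1)" if "k \<noteq> 3" for k
  proof
    assume "ray (lat a b) = ray (axis k 1)"
    then have "lat a b \<in> ray (axis k 1)" by (metis hull_inc insertI1)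
    then obtain t where "lat a b = t *\<^sub>R axis k 1" by (auto simp: ray_eq)
    then have "lat a b $ 3 = t * axis k 1 $ 3" by simp
    then show False using that by (simp add: axis_def)
  qed
  then show ?thesis
    unfolding standard_rays_eq lat_00[symmetric] using ray_lat_eq_iff by auto
qed

lemma rays_A_fan': "rays (A_fan N) = standard_rays \<union> (\<lambda>(a, b). ray (lat a b)) ` {(a, b). a + b \<le> N}"
proof (intro equalityI subsetI)
  fix \<rho> assume "\<rho> \<in> rays (A_fan N)"
  then obtain g where g: "g \<in> A_gens N" "\<rho> = ray g" unfolding rays_A_fan by blast
  then consider "g = axis 1 1" | "g = axis 2 1" | a b where "a + b \<le> N" "g = lat a b"
    unfolding A_gens_def by blast
  then show "\<rho> \<in> standard_rays \<union> (\<lambda>(a, b). ray (lat a b)) ` {(a, b). a + b \<le> N}"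
  proof cases
    case (3 a b)
    then show ?thesis by (intro UnI2 image_eqI[of _ _ "(a, b)"]) (simp_all add: g)
  qed (simp_all add: standard_rays_eq g)
next
  fix \<rho> assume "\<rho> \<in> standard_rays \<union> (\<lambda>(a, b). ray (lat a b)) ` {(a, b). a + b \<le> N}"
  then consider "\<rho> \<in> standard_rays" | a b where "a + b \<le> N" "\<rho> = ray (lat a b)" by auto
  then consider "\<rho> = ray (axis 1 1)" | "\<rho> = ray (axis 2 1)" | a b where "a + b \<le> N" "\<rho> = ray (lat a b)"
  proof cases
    case 1
    then show ?thesis unfolding standard_rays_eq lat_00[symmetric] using that(1,2) that(3)[of 0 0] by auto
  next
    case (2 a b)
    then show ?thesis by (rule that(3))
  qed
  then show "\<rho> \<in> rays (A_fan N)"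
    unfolding rays_A_fan A_gens_def by cases blast+
qed

section \<open>Charts of the toric variety\<close>

lemma fan_cone_hull: "is_fan \<Sigma> \<Longrightarrow> \<sigma> \<in> \<Sigma> \<Longrightarrow> \<exists>V. \<sigma> = convex_cone hull V"
  unfolding is_fan_def strongly_convex_rational_cone_def by metis

text \<open>The exponent of the character \<open>m\<close> in the \<open>k\<close>-th chart
  coordinate. For lattice vectors the pairing is already an integer, so the floor only changes its
  type.\<close>

definition frame_exp :: "(3 \<Rightarrow> real^3) \<Rightarrow> int^3 \<Rightarrow> 3 \<Rightarrow> int" where
  "frame_exp v m k = \<lfloor>pairing m (v k)\<rfloor>"

text \<open>The inverse of \<open>chart_coords\<close>. The orbit is determined by the set of
  vanishing coordinates. As \<open>0 powi e\<close> is 1 for \<open>e = 0\<close> and 0 otherwise,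
  also for negative \<open>e\<close>, the product is automatically zero outside
  \<open>perp_lattice\<close>.\<close>

definition chart_point :: "(3 \<Rightarrow> real^3) \<Rightarrow> complex^3 \<Rightarrow> toric_point" where
  "chart_point v p = (convex_cone hull (v ` {k. p $ k = 0}), \<lambda>m. \<Prod>k\<in>UNIV. (p $ k) powi frame_exp v m k)"

lemma toric_orbit_zero:
  assumes "u \<in> toric_orbit \<tau>"
  shows "u 0 = 1"
proof -
  have "0 \<in> perp_lattice \<tau>" by (simp add: perp_lattice_def pairing_left_0)
  then have "u 0 \<noteq> 0" "u (0 + 0) = u 0 * u 0" using assms unfolding toric_orbit_def by blast+
  then show ?thesis by simp
qed

lemma pairing_scale_left: "pairing (c *s m) x = of_int c * pairing m x"
  by (simp add: pairing_def sum_distrib_left mult.assoc)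

lemma perp_scale: "m \<in> perp_lattice \<tau> \<Longrightarrow> c *s m \<in> perp_lattice \<tau>"
  by (simp add: perp_lattice_def pairing_scale_left)

lemma perp_add: "m \<in> perp_lattice \<tau> \<Longrightarrow> m' \<in> perp_lattice \<tau> \<Longrightarrow> m + m' \<in> perp_lattice \<tau>"
  by (simp add: perp_lattice_def pairing_left_add)

lemma toric_orbit_scale:
  assumes u: "u \<in> toric_orbit \<tau>" and m: "m \<in> perp_lattice \<tau>"
  shows "u (c *s m) = u m powi c"
proof -
  have nz: "u m \<noteq> 0" using u m by (simp add: toric_orbit_def)
  have mult: "u (a + b) = u a * u b" if "a \<in> perp_lattice \<tau>" "b \<in> perp_lattice \<tau>" for a b
    using u that by (simp add: toric_orbit_def)
  have pos: "u (int k *s m) = u m ^ k" for k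
  proof (induct k)
    case 0 then show ?case using toric_orbit_zero[OF u] by simp
  next
    case (Suc k)
    have "int (Suc k) *s m = m + int k *s m" by (simp add: vec_eq_iff algebra_simps)
    then show ?case using mult[OF m perp_scale[OF m]] Suc by simp
  qed
  have neg: "u (- int k *s m) = inverse (u m ^ k)" for k
  proof -
    have "u (int k *s m + (- int k) *s m) = u (int k *s m) * u (- int k *s m)"
      by (intro mult perp_scale m)
    moreover have "int k *s m + (- int k) *s m = 0" by (simp add: vec_eq_iff)
    ultimately show ?thesis using toric_orbit_zero[OF u] pos nz by (simp add: field_simps)
  qed
  show ?thesis
    by (cases c rule: int_cases2) (simp_all add: pos neg power_int_minus)
qed

context
  fixes v :: "3 \<Rightarrow> real^3" and w :: "3 \<Rightarrow> int^3"
  assumes fr: "lattice_frame v w"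
begin

lemma of_int_frame_exp: "of_int (frame_exp v m k) = pairing m (v k)"
  unfolding frame_exp_def using pairing_int[OF frame_lattice[OF fr]] by simp

lemma frame_exp_add: "frame_exp v (m + m') k = frame_exp v m k + frame_exp v m' k"
proof -
  have "real_of_int (frame_exp v (m + m') k) = of_int (frame_exp v m k + frame_exp v m' k)"
    by (simp add: of_int_frame_exp pairing_left_add)
  then show ?thesis by linarith
qed

lemma frame_exp_dual: "frame_exp v (w j) k = (if j = k then 1 else 0)"
  by (simp add: frame_exp_def frame_pairing[OF fr])

lemma frame_exp_eq_0: "frame_exp v m k = 0 \<longleftrightarrow> pairing m (v k) = 0"
  using of_int_frame_exp[of m k] by (metis of_int_0 of_int_eq_iff)

lemma frame_exp_nonneg: "0 \<le> frame_exp v m k \<longleftrightarrow> 0 \<le> pairing m (v k)"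
  using of_int_frame_exp[of m k] by (metis of_int_0_le_iff)

lemma perp_cone_iff: "m \<in> perp_lattice (convex_cone hull (v ` J)) \<longleftrightarrow> (\<forall>k\<in>J. frame_exp v m k = 0)"
proof
  assume "m \<in> perp_lattice (convex_cone hull (v ` J))"
  then show "\<forall>k\<in>J. frame_exp v m k = 0"
    by (auto simp: perp_lattice_def frame_exp_eq_0 hull_inc)
next
  assume a: "\<forall>k\<in>J. frame_exp v m k = 0"
  show "m \<in> perp_lattice (convex_cone hull (v ` J))"
    unfolding perp_lattice_def
  proof safe
    fix x assume x: "x \<in> convex_cone hull (v ` J)"
    have "pairing m (v k) * pairing (w k) x = 0" for k
      using a x by (cases "k \<in> J") (auto simp: frame_exp_eq_0 frame_cone_iff[OF fr])
    then show "pairing m x = 0" by (subst frame_dual_expand[OF fr]) (intro sum.neutral ballI)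
  qed
qed

lemma frame_lattice_expand: "m = (\<Sum>k\<in>UNIV. frame_exp v m k *s w k)"
proof -
  define d where "d = m - (\<Sum>k\<in>UNIV. frame_exp v m k *s w k)"
  have s: "pairing (sum f A) x = (\<Sum>a\<in>A. pairing (f a) x)" for f :: "3 \<Rightarrow> int^3" and A x
    by (induct A rule: infinite_finite_induct) (simp_all add: pairing_left_0 pairing_left_add)
  have "pairing d x = pairing m x - (\<Sum>k\<in>UNIV. pairing m (v k) * pairing (w k) x)" for x
    using pairing_left_add[of m "- (\<Sum>k\<in>UNIV. frame_exp v m k *s w k)" x]
    by (simp add: d_def pairing_minus s pairing_scale_left of_int_frame_exp)
  then have "pairing d x = 0" for x using frame_dual_expand[OF fr, of m x] by simp
  then have "d = 0" by (intro pairing_eq_0_axes)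
  then show ?thesis by (simp add: d_def)
qed

text \<open>For \<open>k \<in> J\<close> the factor is \<open>0 powi 0 = 1\<close>.\<close>

lemma toric_orbit_expand:
  assumes u: "u \<in> toric_orbit (convex_cone hull (v ` J))" and m: "m \<in> perp_lattice (convex_cone hull (v ` J))"
  shows "u m = (\<Prod>k\<in>UNIV. u (w k) powi frame_exp v m k)"
proof -
  let ?L = "perp_lattice (convex_cone hull (v ` J))"
  have e: "frame_exp v m k = 0" if "k \<in> J" for k using m that by (simp add: perp_cone_iff)
  have wp: "w k \<in> ?L" if "k \<notin> J" for k using that by (auto simp: perp_cone_iff frame_exp_dual)
  have tm: "frame_exp v m k *s w k \<in> ?L \<and> u (frame_exp v m k *s w k) = u (w k) powi frame_exp v m k" for k
  proof (cases "k \<in> J")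
    case True
    then show ?thesis using e toric_orbit_zero[OF u] by (simp add: perp_lattice_def pairing_left_0)
  next
    case False
    then show ?thesis using perp_scale[OF wp] toric_orbit_scale[OF u wp] by blast
  qed
  have "(\<Sum>k\<in>K. frame_exp v m k *s w k) \<in> ?L \<and>
      u (\<Sum>k\<in>K. frame_exp v m k *s w k) = (\<Prod>k\<in>K. u (w k) powi frame_exp v m k)" if "finite K" for K
    using that
  proof (induct K)
    case empty
    then show ?case using toric_orbit_zero[OF u] by (simp add: perp_lattice_def pairing_left_0)
  next
    case (insert k K)
    then show ?case using tm[of k] u by (simp add: perp_add toric_orbit_def)
  qed
  from this[of UNIV] show ?thesis using frame_lattice_expand[of m] by simp
qed

lemma snd_chart_point: "snd (chart_point v p) m = (\<Prod>k\<in>UNIV. (p $ k) powi frame_exp v m k)"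
  by (simp add: chart_point_def)

lemma fst_chart_point: "fst (chart_point v p) = convex_cone hull (v ` {k. p $ k = 0})"
  by (simp add: chart_point_def)

lemma chart_point_nonzero:
  "snd (chart_point v p) m \<noteq> 0 \<longleftrightarrow> m \<in> perp_lattice (fst (chart_point v p))"
  unfolding snd_chart_point fst_chart_point perp_cone_iff
  by (auto simp: power_int_eq_0_iff)

lemma chart_point_orbit: "snd (chart_point v p) \<in> toric_orbit (fst (chart_point v p))"
  unfolding toric_orbit_def
proof (intro CollectI conjI allI ballI)
  fix m show "snd (chart_point v p) m \<noteq> 0 \<longleftrightarrow> m \<in> perp_lattice (fst (chart_point v p))"
    by (rule chart_point_nonzero)
next
  fix m m' assume "m \<in> perp_lattice (fst (chart_point v p))" "m' \<in> perp_lattice (fst (chart_point v p))"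
  then have z: "p $ k = 0 \<Longrightarrow> frame_exp v m k = 0 \<and> frame_exp v m' k = 0" for k
    by (simp add: fst_chart_point perp_cone_iff)
  have "(p $ k) powi frame_exp v (m + m') k = (p $ k) powi frame_exp v m k * (p $ k) powi frame_exp v m' k" for k
    using z[of k] by (cases "p $ k = 0") (simp_all add: frame_exp_add power_int_add)
  then show "snd (chart_point v p) (m + m') = snd (chart_point v p) m * snd (chart_point v p) m'"
    by (simp add: snd_chart_point prod.distrib)
qed

lemma chart_coords_chart_point: "chart_coords w (chart_point v p) = p"
proof -
  have "(\<Prod>k\<in>UNIV. (p $ k) powi frame_exp v (w j) k) = (\<Prod>k\<in>UNIV. if k = j then p $ j else 1)" for j
    by (rule prod.cong) (auto simp: frame_exp_dual)
  then show ?thesis by (simp add: chart_coords_def vec_eq_iff snd_chart_point)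
qed

context
  fixes \<Sigma> \<sigma>
  assumes fan: "is_fan \<Sigma>" and sig: "\<sigma> \<in> \<Sigma>" and sigv: "\<sigma> = convex_cone hull (range v)"
begin

lemma frame_face_in_fan: "convex_cone hull (v ` J) \<in> \<Sigma>"
proof -
  have "convex_cone hull (v ` J) face_of \<sigma>" unfolding sigv by (rule frame_face[OF fr]) auto
  then show ?thesis using fan sig convex_cone_hull_nonempty[of "v ` J"] unfolding is_fan_def by blast
qed

text \<open>By the fan axioms the intersection with \<sigma> is a face of \<sigma>, and the faces of
  a simplicial cone are spanned by subsets of its generators.\<close>

lemma fan_subset_face:
  assumes "\<tau> \<in> \<Sigma>" "\<tau> \<subseteq> \<sigma>"
  shows "\<tau> = convex_cone hull (v ` {k. v k \<in> \<tau>})"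
proof -
  have "\<sigma> \<inter> \<tau> face_of \<sigma>" using fan assms(1) sig unfolding is_fan_def by blast
  then have "\<tau> face_of convex_cone hull (range v)" using assms(2) sigv by (simp add: inf.absorb2)
  moreover have "\<tau> \<noteq> {}" using fan_cone_hull[OF fan assms(1)] convex_cone_hull_nonempty by metis
  ultimately show ?thesis by (rule frame_face_eq[OF fr])
qed

lemma chart_point_in_chart: "chart_point v p \<in> toric_chart \<Sigma> \<sigma>"
proof -
  have "chart_point v p \<in> toric_variety \<Sigma>"
    unfolding toric_variety_def mem_Sigma_iff[of "fst (chart_point v p)" "snd (chart_point v p)", simplified]
    using frame_face_in_fan chart_point_orbit by (simp add: fst_chart_point)
  then show ?thesis
    unfolding toric_chart_def sigv by (simp add: fst_chart_point hull_mono[OF image_mono[OF subset_UNIV]])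
qed

lemma chart_point_chart_coords:
  assumes "z \<in> toric_chart \<Sigma> \<sigma>"
  shows "chart_point v (chart_coords w z) = z"
proof -
  obtain \<tau> u where z: "z = (\<tau>, u)" by fastforce
  have \<tau>: "\<tau> \<in> \<Sigma>" "\<tau> \<subseteq> \<sigma>" and u: "u \<in> toric_orbit \<tau>"
    using assms by (auto simp: z toric_chart_def toric_variety_def)
  define J where "J = {k. v k \<in> \<tau>}"
  have \<tau>J: "\<tau> = convex_cone hull (v ` J)" unfolding J_def by (rule fan_subset_face[OF \<tau>])
  have z0: "u (w k) = 0 \<longleftrightarrow> k \<in> J" for k
  proof -
    have "u (w k) = 0 \<longleftrightarrow> w k \<notin> perp_lattice \<tau>" using u by (auto simp: toric_orbit_def)
    then show ?thesis by (auto simp: \<tau>J perp_cone_iff frame_exp_dual)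
  qed
  have "fst (chart_point v (chart_coords w z)) = \<tau>"
    by (simp add: fst_chart_point chart_coords_def z z0 \<tau>J)
  moreover have "snd (chart_point v (chart_coords w z)) m = u m" for m
  proof (cases "m \<in> perp_lattice \<tau>")
    case True
    then show ?thesis using toric_orbit_expand[of u J m] u
      by (simp add: \<tau>J snd_chart_point chart_coords_def z)
  next
    case False
    then have "snd (chart_point v (chart_coords w z)) m = 0"
      using chart_point_nonzero[of "chart_coords w z" m] calculation by simp
    moreover have "u m = 0" using False u by (auto simp: toric_orbit_def)
    ultimately show ?thesis by simp
  qed
  ultimately show ?thesis by (auto simp: z prod_eq_iff)
qed

lemma continuous_chart_point: "continuous_map euclidean (toric_topology \<Sigma>) (chart_point v)"
  unfolding toric_topology_def
proof (rule continuous_on_generated_topo)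
  fix T assume "T \<in> {{z \<in> toric_chart \<Sigma> \<sigma>. snd z m \<in> U} | \<sigma> m U. \<sigma> \<in> \<Sigma> \<and> m \<in> dual_monoid \<sigma> \<and> open U}"
  then obtain \<sigma>' m U where T: "T = {z \<in> toric_chart \<Sigma> \<sigma>'. snd z m \<in> U}"
    and s': "\<sigma>' \<in> \<Sigma>" "m \<in> dual_monoid \<sigma>'" "open U" by blast
  \<comment> \<open>The preimage of the chart of \<sigma>': coordinate \<open>k\<close> may vanish
    only if \<open>v k\<close> lies in \<sigma>'. For such \<open>k\<close> the exponent of
    \<open>m\<close> is nonnegative, and for the others the base is nonzero, so the monomial is
    continuous.\<close>
  define O' where "O' = {p :: complex^3. \<forall>k. v k \<notin> \<sigma>' \<longrightarrow> p $ k \<noteq> 0}"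
  have sub: "convex_cone hull (v ` J) \<subseteq> \<sigma>' \<longleftrightarrow> (\<forall>k\<in>J. v k \<in> \<sigma>')" for J
  proof
    show "convex_cone hull (v ` J) \<subseteq> \<sigma>' \<Longrightarrow> \<forall>k\<in>J. v k \<in> \<sigma>'" by (auto dest: subsetD simp: hull_inc)
    obtain V where "\<sigma>' = convex_cone hull V"
      using fan_cone_hull[OF fan s'(1)] by blast
    then have "convex_cone \<sigma>'" by (simp add: convex_cone_convex_cone_hull)
    then show "\<forall>k\<in>J. v k \<in> \<sigma>' \<Longrightarrow> convex_cone hull (v ` J) \<subseteq> \<sigma>'" by (intro hull_minimal) auto
  qed
  have "chart_point v p \<in> toric_chart \<Sigma> \<sigma>' \<longleftrightarrow> p \<in> O'" for p
    using chart_point_in_chart[of p] sub[of "{k. p $ k = 0}"]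
    by (auto simp: toric_chart_def O'_def fst_chart_point)
  then have "chart_point v -` T \<inter> topspace euclidean = {p \<in> O'. snd (chart_point v p) m \<in> U}"
    by (auto simp: T)
  moreover have "open {p \<in> O'. snd (chart_point v p) m \<in> U}"
  proof -
    have "O' = (\<Inter>k\<in>{k. v k \<notin> \<sigma>'}. {p. p $ k \<noteq> 0})" by (auto simp: O'_def)
    moreover have "open {p :: complex^3. p $ k \<noteq> 0}" for k
      by (intro open_Collect_neq continuous_intros)
    ultimately have "open O'" by (simp add: open_INT)
    moreover have "continuous_on O' (\<lambda>p. (p $ k) powi frame_exp v m k)" for k
    proof (cases "v k \<in> \<sigma>'")
      case True
      then have "0 \<le> frame_exp v m k"
        using s'(2) by (simp add: frame_exp_nonneg dual_monoid_def)
      then have eq: "(\<lambda>p::complex^3. (p $ k) powi frame_exp v m k) = (\<lambda>p. (p $ k) ^ nat (frame_exp v m k))"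
        by (simp add: power_int_def)
      show ?thesis unfolding eq by (intro continuous_intros)
    next
      case False
      then show ?thesis by (intro continuous_intros) (auto simp: O'_def)
    qed
    then have "continuous_on O' (\<lambda>p. snd (chart_point v p) m)"
      unfolding snd_chart_point by (intro continuous_on_prod)
    ultimately have "open (O' \<inter> (\<lambda>p. snd (chart_point v p) m) -` U)"
      using s'(3) by (simp add: continuous_on_open_vimage Int_commute)
    moreover have "O' \<inter> (\<lambda>p. snd (chart_point v p) m) -` U = {p \<in> O'. snd (chart_point v p) m \<in> U}" by auto
    ultimately show ?thesis by simp
  qed
  ultimately show "openin euclidean (chart_point v -` T \<inter> topspace euclidean)" by simp
next
  have "0 \<in> dual_monoid \<sigma>" by (simp add: dual_monoid_def pairing_left_0)
  then have "{z \<in> toric_chart \<Sigma> \<sigma>. snd z 0 \<in> UNIV} \<in>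
     {{z \<in> toric_chart \<Sigma> \<sigma>. snd z m \<in> U} | \<sigma> m U. \<sigma> \<in> \<Sigma> \<and> m \<in> dual_monoid \<sigma> \<and> open U}"
    using sig open_UNIV by blast
  then show "chart_point v ` topspace euclidean \<subseteq>
     \<Union> {{z \<in> toric_chart \<Sigma> \<sigma>. snd z m \<in> U} | \<sigma> m U. \<sigma> \<in> \<Sigma> \<and> m \<in> dual_monoid \<sigma> \<and> open U}"
    using chart_point_in_chart by (intro order_trans[OF _ Union_upper]) auto
qed

end

end

section \<open>The topology of the toric variety and properness\<close>

lemma toric_subbase:
  assumes "\<sigma> \<in> \<Sigma>" "m \<in> dual_monoid \<sigma>" "open U"
  shows "openin (toric_topology \<Sigma>) {z \<in> toric_chart \<Sigma> \<sigma>. snd z m \<in> U}"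
  unfolding toric_topology_def using assms by (intro topology_generated_by_Basis) blast

lemma topspace_toric_topology: "topspace (toric_topology \<Sigma>) = toric_variety \<Sigma>"
proof -
  have "z \<in> topspace (toric_topology \<Sigma>)" if "z \<in> toric_variety \<Sigma>" for z
  proof -
    have f: "fst z \<in> \<Sigma>" using that by (auto simp: toric_variety_def)
    have "0 \<in> dual_monoid (fst z)" by (simp add: dual_monoid_def pairing_left_0)
    from toric_subbase[OF f this open_UNIV] show ?thesis
      using that openin_subset by (fastforce simp: toric_chart_def)
  qed
  then show ?thesis
    by (auto simp: toric_topology_def toric_chart_def)
qed

lemma openin_toric_monomial:
  assumes "\<And>\<sigma>. \<sigma> \<in> \<Sigma> \<Longrightarrow> m \<in> dual_monoid \<sigma>" "open U"
  shows "openin (toric_topology \<Sigma>) {z \<in> toric_variety \<Sigma>. snd z m \<in> U}"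
proof -
  have "{z \<in> toric_variety \<Sigma>. snd z m \<in> U} = (\<Union>\<sigma>\<in>\<Sigma>. {z \<in> toric_chart \<Sigma> \<sigma>. snd z m \<in> U})"
    by (auto simp: toric_chart_def toric_variety_def)
  then show ?thesis using assms by (auto intro!: openin_clauses(3) toric_subbase)
qed

lemma continuous_toric_map:
  assumes oct: "\<And>\<sigma>. \<sigma> \<in> \<Sigma> \<Longrightarrow> \<sigma> \<subseteq> octant"
  shows "continuous_map (toric_topology \<Sigma>) euclidean toric_map"
  unfolding continuous_map_def
proof (intro conjI allI impI)
  show "toric_map \<in> topspace (toric_topology \<Sigma>) \<rightarrow> topspace euclidean" by simp
  fix U :: "(complex^3) set" assume "openin euclidean U"
  then have U: "open U" by simp
  show "openin (toric_topology \<Sigma>) {z \<in> topspace (toric_topology \<Sigma>). toric_map z \<in> U}"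
  proof (subst openin_subopen, intro ballI)
    fix z assume z: "z \<in> {z \<in> topspace (toric_topology \<Sigma>). toric_map z \<in> U}"
    then obtain A where A: "\<And>k. open (A k)" "\<And>k. toric_map z $ k \<in> A k"
      and sub: "\<And>y. (\<forall>k. y $ k \<in> A k) \<Longrightarrow> y \<in> U"
      using U unfolding open_vec_def by (metis (no_types, lifting) mem_Collect_eq)
    define W where "W = (\<Inter>k. {z \<in> toric_variety \<Sigma>. snd z (axis k 1) \<in> A k})"
    have "axis k 1 \<in> dual_monoid \<sigma>" if "\<sigma> \<in> \<Sigma>" for k \<sigma>
      using oct[OF that] by (auto simp: dual_monoid_def pairing_axis octant_def)
    then have "openin (toric_topology \<Sigma>) W"
      unfolding W_def by (intro openin_INT2 openin_toric_monomial A) auto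
    moreover have "z \<in> W" using z A(2) by (auto simp: W_def topspace_toric_topology toric_map_def)
    moreover have "W \<subseteq> {z \<in> topspace (toric_topology \<Sigma>). toric_map z \<in> U}"
      using sub by (auto simp: W_def topspace_toric_topology toric_map_def)
    ultimately show "\<exists>T. openin (toric_topology \<Sigma>) T \<and> z \<in> T \<and> T \<subseteq> {z \<in> topspace (toric_topology \<Sigma>). toric_map z \<in> U}"
      by blast
  qed
qed

lemma standard_frame: "lattice_frame (\<lambda>k. axis k 1) (\<lambda>k. axis k 1)"
  unfolding lattice_frame_def pairing_axis by (auto simp: lattice3_def axis_def)

text \<open>\<open>toric_map\<close> is the coordinate map of the frame of standard axes, so
  \<open>chart_point\<close> of this frame inverts it on the torus.\<close>

lemma toric_map_torus_bij: "bij_betw toric_map ({{0}} \<times> toric_orbit {0}) {p. \<forall>k. p $ k \<noteq> 0}"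
proof (rule bij_betwI[where g = "chart_point (\<lambda>k. axis k 1)"])
  let ?v = "\<lambda>k::3. axis k (1::real)"
  have hull0: "convex_cone hull (?v ` {}) = {0}" by simp
  have perp: "perp_lattice {0} = UNIV" by (auto simp: perp_lattice_def pairing_0)
  have coords: "toric_map z = chart_coords (\<lambda>k. axis k 1) z" for z :: toric_point
    by (simp add: toric_map_def chart_coords_def)
  show "toric_map \<in> {{0}} \<times> toric_orbit {0} \<rightarrow> {p. \<forall>k. p $ k \<noteq> 0}"
    by (auto simp: toric_map_def toric_orbit_def perp)
  show "chart_point ?v \<in> {p. \<forall>k. p $ k \<noteq> 0} \<rightarrow> {{0}} \<times> toric_orbit {0}"
  proof
    fix p :: "complex^3" assume "p \<in> {p. \<forall>k. p $ k \<noteq> 0}"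
    then have "fst (chart_point ?v p) = {0}" by (simp add: fst_chart_point[OF standard_frame])
    then show "chart_point ?v p \<in> {{0}} \<times> toric_orbit {0}"
      using chart_point_orbit[OF standard_frame, of p] by (auto simp: mem_Times_iff)
  qed
  show "toric_map (chart_point ?v p) = p" for p
    unfolding coords by (rule chart_coords_chart_point[OF standard_frame])
  fix z :: toric_point assume z: "z \<in> {{0}} \<times> toric_orbit {0}"
  then obtain u where z: "z = ({0}, u)" and u: "u \<in> toric_orbit {0}" by auto
  have "snd (chart_point ?v (toric_map z)) m = u m" for m
    using toric_orbit_expand[OF standard_frame, of u "{}" m] u
    by (simp add: snd_chart_point[OF standard_frame] perp toric_map_def z)
  moreover have "fst (chart_point ?v (toric_map z)) = {0}"
    using u by (simp add: fst_chart_point[OF standard_frame] toric_map_def z toric_orbit_def perp)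
  ultimately show "chart_point ?v (toric_map z) = z" by (auto simp: z prod_eq_iff)
qed

text \<open>A point of the orbit of \<open>\<tau>\<close> is the limit for \<open>s \<longrightarrow> \<infinity>\<close> of torus points with logarithm \<open>L s\<close>.
  A cone of the fan that contains \<open>L s\<close> for infinitely many \<open>s\<close> gives a chart in which the
  coordinates of the point are bounded.\<close>

lemma toric_point_bounded_chart:
  assumes fan: "is_fan \<Sigma>" and oct: "\<And>\<sigma>. \<sigma> \<in> \<Sigma> \<Longrightarrow> \<sigma> \<subseteq> octant"
    and S3: "finite S3" "\<And>\<sigma>. \<sigma> \<in> S3 \<Longrightarrow> \<sigma> \<in> \<Sigma> \<and> chart_frame \<sigma> (V \<sigma>) (W \<sigma>)"
    and cover: "\<And>x. x \<in> octant \<Longrightarrow> \<exists>\<sigma>\<in>S3. x \<in> \<sigma>"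
    and pure: "\<And>\<tau>. \<tau> \<in> \<Sigma> \<Longrightarrow> \<exists>\<sigma>\<in>S3. \<tau> \<subseteq> \<sigma>"
    and z: "z \<in> toric_variety \<Sigma>" and R: "0 < R" "\<And>k. norm (toric_map z $ k) \<le> R"
  shows "\<exists>\<sigma>\<in>S3. z \<in> toric_chart \<Sigma> \<sigma> \<and> (\<forall>j. norm (snd z (W \<sigma> j)) \<le> R powr pairing (W \<sigma> j) 1)"
proof -
  obtain \<tau> u where zt: "z = (\<tau>, u)" and \<tau>: "\<tau> \<in> \<Sigma>" and u: "u \<in> toric_orbit \<tau>"
    using z by (auto simp: toric_variety_def)
  obtain \<sigma> where \<sigma>3: "\<sigma> \<in> S3" and \<sigma>: "\<sigma> \<in> \<Sigma>" "\<tau> \<subseteq> \<sigma>" using pure[OF \<tau>] S3(2) by blast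
  define v where "v = V \<sigma>"
  define w where "w = W \<sigma>"
  have fr: "lattice_frame v w" and \<sigma>v: "\<sigma> = convex_cone hull (range v)"
    using S3(2)[OF \<sigma>3] unfolding chart_frame_iff v_def w_def by auto
  define J where "J = {k. v k \<in> \<tau>}"
  have \<tau>J: "\<tau> = convex_cone hull (v ` J)" unfolding J_def by (rule fan_subset_face[OF fr fan \<sigma>(1) \<sigma>v \<tau> \<sigma>(2)])
  have unz: "u m \<noteq> 0 \<longleftrightarrow> m \<in> perp_lattice \<tau>" for m using u by (simp add: toric_orbit_def)
  have uw: "u (w k) \<noteq> 0 \<longleftrightarrow> k \<notin> J" for k
    unfolding unz \<tau>J perp_cone_iff[OF fr] by (auto simp: frame_exp_dual[OF fr])
  \<comment> \<open>Minus the logarithm of the absolute values of the point. The entries with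
    \<open>k \<in> J\<close> belong to vanishing coordinates; characters in
    \<open>perp_lattice \<tau>\<close> pair to zero with these \<open>v k\<close>, so they only see
    the others.\<close>
  define L0 where "L0 = (\<Sum>k\<in>UNIV. (- ln (norm (u (w k)))) *\<^sub>R v k)"
  define S where "S = (\<Sum>k\<in>J. v k)"
  \<comment> \<open>Adding \<open>ln R\<close> to all coordinates encodes the bound on the image
    point; \<open>S\<close> is an interior direction of \<tau> and makes the coordinates grow that
    vanish at the image point.\<close>
  define L where "L s = (L0 + ln R *\<^sub>R 1) + s *\<^sub>R S" for s :: real
  have lnu: "ln (norm (u m)) = - pairing m L0" if m: "m \<in> perp_lattice \<tau>" for m
  proof -
    have e: "frame_exp v m k = 0" if "k \<in> J" for k using m that by (simp add: \<tau>J perp_cone_iff[OF fr])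
    have nu: "norm (u m) = (\<Prod>k\<in>UNIV. norm (u (w k)) powi frame_exp v m k)"
      using toric_orbit_expand[OF fr, of u J m] u m by (simp add: \<tau>J norm_power_int flip: prod_norm)
    have nz: "norm (u (w k)) powi frame_exp v m k \<noteq> 0" for k
      using uw[of k] e[of k] by (cases "k \<in> J") auto
    have "ln (norm (u m)) = (\<Sum>k\<in>UNIV. ln (norm (u (w k)) powi frame_exp v m k))"
      unfolding nu by (rule ln_prod[OF finite nz])
    also have "\<dots> = (\<Sum>k\<in>UNIV. pairing m (v k) * ln (norm (u (w k))))"
    proof (rule sum.cong)
      fix k show "ln (norm (u (w k)) powi frame_exp v m k) = pairing m (v k) * ln (norm (u (w k)))"
      proof (cases "k \<in> J")
        case True
        then show ?thesis using e[OF True] of_int_frame_exp[OF fr, of m k] by simp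
      next
        case False
        then show ?thesis using uw[of k] of_int_frame_exp[OF fr, of m k]
          by (simp add: powr_real_of_int' [symmetric] ln_powr)
      qed
    qed simp
    also have "\<dots> = - pairing m L0"
      by (simp add: L0_def pairing_minus_right pairing_sum pairing_scaleR sum_negf mult.commute)
    finally show ?thesis .
  qed
  have Sj: "pairing m S = 0" if "m \<in> perp_lattice \<tau>" for m
    using that unfolding S_def pairing_sum by (intro sum.neutral) (auto simp: \<tau>J perp_lattice_def hull_inc)
  have "\<exists>sj. \<forall>s\<ge>sj. 0 \<le> L s $ j" for j
  proof (cases "axis j 1 \<in> perp_lattice \<tau>")
    case True
    have "norm (u (axis j 1)) \<le> R" using R(2)[of j] by (simp add: toric_map_def zt)
    moreover have "0 < norm (u (axis j 1))" using unz True by simp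
    ultimately have "ln (norm (u (axis j 1))) \<le> ln R" using R(1) by (simp add: ln_le_cancel_iff)
    then have "0 \<le> L0 $ j + ln R" using lnu[OF True] by (simp add: pairing_axis)
    moreover have "S $ j = 0" using Sj[OF True] by (simp add: pairing_axis)
    ultimately show ?thesis by (simp add: L_def)
  next
    case False
    have nn: "0 \<le> v k $ j" for k
    proof -
      have "v k \<in> \<sigma>" unfolding \<sigma>v by (simp add: hull_inc)
      then show ?thesis using oct[OF \<sigma>(1)] by (auto simp: octant_def)
    qed
    obtain k where k: "k \<in> J" "v k $ j \<noteq> 0"
      using False by (auto simp: \<tau>J perp_cone_iff[OF fr] frame_exp_eq_0[OF fr] pairing_axis)
    have pos: "0 < S $ j"
    proof -
      have "0 < (\<Sum>k\<in>J. v k $ j)" using k nn by (intro sum_pos2[of J k]) (auto simp: order_less_le)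
      then show ?thesis by (simp add: S_def)
    qed
    show ?thesis
    proof (intro exI allI impI)
      fix s assume "- (L0 $ j + ln R) / S $ j \<le> s"
      then have "- (L0 $ j + ln R) \<le> s * S $ j" using pos by (simp add: divide_le_eq)
      then show "0 \<le> L s $ j" by (simp add: L_def)
    qed
  qed
  then obtain sj where sj: "\<And>j s. sj j \<le> s \<Longrightarrow> 0 \<le> L s $ j" by metis
  define s0 where "s0 = nat \<lceil>Max (range sj)\<rceil>"
  have Loct: "L (real s) \<in> octant" if "s0 \<le> s" for s
    unfolding octant_def
  proof safe
    fix j
    have "sj j \<le> Max (range sj)" by simp
    also have "\<dots> \<le> real s0" unfolding s0_def by linarith
    finally show "0 \<le> L (real s) $ j" using that by (intro sj) auto
  qed
  have "\<exists>\<sigma>'\<in>S3. infinite {s \<in> {s0..}. L (real s) \<in> \<sigma>'}"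
    using pigeonhole_infinite_rel[of "{s0..}" S3 "\<lambda>s \<sigma>'. L (real s) \<in> \<sigma>'"] cover[OF Loct] S3(1)
    by (auto simp: infinite_Ici)
  then obtain \<sigma>' where \<sigma>'3: "\<sigma>' \<in> S3" and inf: "infinite {s \<in> {s0..}. L (real s) \<in> \<sigma>'}" by blast
  define v' where "v' = V \<sigma>'"
  define w' where "w' = W \<sigma>'"
  have \<sigma>': "\<sigma>' \<in> \<Sigma>" and fr': "lattice_frame v' w'" and \<sigma>v': "\<sigma>' = convex_cone hull (range v')"
    using S3(2)[OF \<sigma>'3] unfolding chart_frame_iff v'_def w'_def by auto
  define A where "A j = pairing (w' j) (L0 + ln R *\<^sub>R 1)" for j
  define B where "B j = pairing (w' j) S" for j
  have many: "\<exists>s\<ge>r. 0 \<le> A j + real s * B j" for r j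
  proof -
    obtain s where "s \<ge> r" "L (real s) \<in> \<sigma>'"
      using inf unfolding infinite_nat_iff_unbounded_le by blast
    then show ?thesis
      unfolding \<sigma>v' frame_full_cone_iff[OF fr'] by (auto simp: L_def pairing_add pairing_scaleR A_def B_def)
  qed
  have B0: "0 \<le> B j" for j
  proof (rule ccontr)
    assume "\<not> 0 \<le> B j"
    then have neg: "B j < 0" by simp
    obtain s where s: "s \<ge> nat \<lceil>A j / - B j\<rceil> + 1" "0 \<le> A j + real s * B j" using many by blast
    have "A j / - B j < real s" using s(1) by linarith
    then have "A j / - B j * - B j < real s * - B j" using neg by (intro mult_strict_right_mono) auto
    then have "A j < real s * - B j" using neg by simp
    then show False using s(2) by simp
  qed
  \<comment> \<open>\<open>S\<close> is the asymptotic direction of \<open>L s\<close>, so it lies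
    in \<sigma>'. Being interior to \<tau>, it lies in no proper face of \<tau>, and therefore the
    face \<tau> \<inter> \<sigma>' is all of \<tau>.\<close>
  have "S \<in> \<sigma>'" unfolding \<sigma>v' frame_full_cone_iff[OF fr'] using B0 by (simp add: B_def)
  moreover have "S \<in> \<tau>"
  proof -
    have "pairing (w k) S = (if k \<in> J then 1 else 0)" for k
      unfolding S_def pairing_sum by (simp add: frame_pairing[OF fr])
    then show ?thesis unfolding \<tau>J frame_cone_iff[OF fr] by simp
  qed
  ultimately have St: "S \<in> \<tau> \<inter> \<sigma>'" by blast
  have face: "(\<tau> \<inter> \<sigma>') face_of convex_cone hull (v ` J)"
    using fan \<tau> \<sigma>' unfolding is_fan_def \<tau>J by blast
  have "v k \<in> \<sigma>'" if "k \<in> J" for k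
  proof -
    have "pairing (w k) S = 1"
      unfolding S_def pairing_sum using that by (simp add: frame_pairing[OF fr])
    then show ?thesis using frame_face_generators[OF fr face St, of k] by simp
  qed
  then have "\<tau> \<subseteq> \<sigma>'"
    unfolding \<tau>J by (intro hull_minimal) (auto simp: \<sigma>v' convex_cone_convex_cone_hull)
  then have "z \<in> toric_chart \<Sigma> \<sigma>'" using z by (simp add: toric_chart_def zt)
  moreover have "norm (snd z (w' j)) \<le> R powr pairing (w' j) 1" for j
  proof (cases "w' j \<in> perp_lattice \<tau>")
    case True
    \<comment> \<open>For characters of the orbit the drift along \<open>S\<close> vanishes, so the
      sign of the constant term \<open>A j\<close> remains, and this is the asserted bound in
      logarithmic form.\<close>
    have "B j = 0" unfolding B_def by (rule Sj[OF True])
    then have "0 \<le> A j" using many[of 0 j] by auto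
    then have "ln (norm (u (w' j))) \<le> pairing (w' j) 1 * ln R"
      using lnu[OF True] by (simp add: A_def pairing_add pairing_scaleR mult.commute)
    moreover have "0 < norm (u (w' j))" using unz True by simp
    ultimately have "norm (u (w' j)) \<le> exp (pairing (w' j) 1 * ln R)" by (metis exp_le_cancel_iff exp_ln)
    then show ?thesis using R(1) by (simp add: zt powr_def)
  next
    case False
    then have "u (w' j) = 0" using unz by blast
    then show ?thesis by (simp add: zt)
  qed
  ultimately show ?thesis using \<sigma>'3 unfolding w'_def by blast
qed

text \<open>By the chart bounds above, the preimage of a compact set is a finite union of images of
  sets \<open>C \<sigma>\<close> that are closed and bounded in affine space, so it is
  compact.\<close>

lemma proper_toric_map:
  assumes fan: "is_fan \<Sigma>" and oct: "\<And>\<sigma>. \<sigma> \<in> \<Sigma> \<Longrightarrow> \<sigma> \<subseteq> octant"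
    and cover: "\<And>x. x \<in> octant \<Longrightarrow> \<exists>\<sigma>\<in>\<Sigma>. x \<in> \<sigma> \<and> (\<exists>v w. chart_frame \<sigma> v w)"
    and pure: "\<And>\<tau>. \<tau> \<in> \<Sigma> \<Longrightarrow> \<exists>\<sigma>\<in>\<Sigma>. \<tau> \<subseteq> \<sigma> \<and> (\<exists>v w. chart_frame \<sigma> v w)"
  shows "proper_map (toric_topology \<Sigma>) euclidean toric_map"
proof (rule compact_imp_proper_map_gen)
  show "toric_map ` topspace (toric_topology \<Sigma>) \<subseteq> topspace euclidean" by simp
  show cont: "continuous_map (toric_topology \<Sigma>) euclidean toric_map \<or> kc_space (toric_topology \<Sigma>)"
    using continuous_toric_map[OF oct] by blast
next
  fix S :: "(complex^3) set" assume S: "\<And>K. compactin euclidean K \<Longrightarrow> compactin euclidean (S \<inter> K)"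
  \<comment> \<open>Closedness can be tested on balls, since a convergent sequence is
    bounded.\<close>
  have "closed S"
    unfolding closed_sequential_limits
  proof (intro allI impI)
    fix x l assume xl: "(\<forall>n. x n \<in> S) \<and> x \<longlonglongrightarrow> l"
    then have "bounded (range x)" by (meson convergentI convergent_imp_bounded)
    then obtain r where r: "\<And>n. norm (x n) \<le> r" by (auto simp: bounded_iff)
    have "closed (S \<inter> cball 0 r)"
      using S[of "cball 0 r"] compact_imp_closed by (auto simp: compactin_euclidean_iff)
    moreover have "x n \<in> S \<inter> cball 0 r" for n using xl r by simp
    ultimately have "l \<in> S \<inter> cball 0 r" using xl by (metis closed_sequentially)
    then show "l \<in> S" by blast
  qed
  then show "closedin euclidean S" by simp
next
  fix K :: "(complex^3) set" assume "compactin euclidean K"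
  then have K: "compact K" by (simp add: compactin_euclidean_iff)
  define S3 where "S3 = {\<sigma> \<in> \<Sigma>. \<exists>v w. chart_frame \<sigma> v w}"
  have "\<forall>\<sigma>\<in>S3. \<exists>v w. chart_frame \<sigma> v w" by (auto simp: S3_def)
  then obtain V W where VW: "\<And>\<sigma>. \<sigma> \<in> S3 \<Longrightarrow> chart_frame \<sigma> (V \<sigma>) (W \<sigma>)" by metis
  have S3: "finite S3" "\<And>\<sigma>. \<sigma> \<in> S3 \<Longrightarrow> \<sigma> \<in> \<Sigma> \<and> chart_frame \<sigma> (V \<sigma>) (W \<sigma>)"
    using fan VW unfolding S3_def is_fan_def by auto
  have cov: "\<And>x. x \<in> octant \<Longrightarrow> \<exists>\<sigma>\<in>S3. x \<in> \<sigma>" and pur: "\<And>\<tau>. \<tau> \<in> \<Sigma> \<Longrightarrow> \<exists>\<sigma>\<in>S3. \<tau> \<subseteq> \<sigma>"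
    using cover pure by (fastforce simp: S3_def)+
  obtain R where R: "0 < R" "\<And>x. x \<in> K \<Longrightarrow> norm x \<le> R"
    using compact_imp_bounded[OF K] by (auto simp: bounded_pos)
  define C where "C \<sigma> = {p :: complex^3. (\<forall>j. norm (p $ j) \<le> R powr pairing (W \<sigma> j) 1) \<and>
     toric_map (chart_point (V \<sigma>) p) \<in> K}" for \<sigma>
  have compC: "compact (C \<sigma>)" if \<sigma>: "\<sigma> \<in> S3" for \<sigma>
  proof -
    have fr: "lattice_frame (V \<sigma>) (W \<sigma>)" "\<sigma> = convex_cone hull (range (V \<sigma>))" "\<sigma> \<in> \<Sigma>"
      using S3(2)[OF \<sigma>] by (auto simp: chart_frame_iff)
    have "continuous_map euclidean euclidean (toric_map \<circ> chart_point (V \<sigma>))"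
      using continuous_map_compose[OF continuous_chart_point[OF fr(1) fan fr(3,2)] continuous_toric_map[OF oct]] by blast
    then have "continuous_on UNIV (\<lambda>p. toric_map (chart_point (V \<sigma>) p))" by (simp add: o_def)
    then have "closed ((\<lambda>p. toric_map (chart_point (V \<sigma>) p)) -` K)"
      using compact_imp_closed[OF K] by (simp add: closed_vimage)
    moreover have "closed {p :: complex^3. norm (p $ j) \<le> R powr pairing (W \<sigma> j) 1}" for j
      by (intro closed_Collect_le continuous_intros)
    then have "closed (\<Inter>j. {p :: complex^3. norm (p $ j) \<le> R powr pairing (W \<sigma> j) 1})" by blast
    moreover have "C \<sigma> = (\<Inter>j. {p :: complex^3. norm (p $ j) \<le> R powr pairing (W \<sigma> j) 1}) \<inter>
        ((\<lambda>p. toric_map (chart_point (V \<sigma>) p)) -` K)" by (auto simp: C_def)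
    ultimately have "closed (C \<sigma>)" by (simp add: closed_Int)
    moreover have "bounded (C \<sigma>)"
      unfolding bounded_iff
    proof (intro exI ballI)
      fix p assume p: "p \<in> C \<sigma>"
      have "norm p \<le> (\<Sum>j\<in>UNIV. norm (p $ j))" unfolding norm_vec_def by (rule L2_set_le_sum) simp
      also have "\<dots> \<le> (\<Sum>j\<in>UNIV. R powr pairing (W \<sigma> j) 1)" using p by (intro sum_mono) (simp add: C_def)
      finally show "norm p \<le> (\<Sum>j\<in>UNIV. R powr pairing (W \<sigma> j) 1)" .
    qed
    ultimately show ?thesis by (simp add: compact_eq_bounded_closed)
  qed
  have "{z \<in> topspace (toric_topology \<Sigma>). toric_map z \<in> K} = (\<Union>\<sigma>\<in>S3. chart_point (V \<sigma>) ` C \<sigma>)"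
  proof (intro equalityI subsetI)
    fix z assume "z \<in> {z \<in> topspace (toric_topology \<Sigma>). toric_map z \<in> K}"
    then have z: "z \<in> toric_variety \<Sigma>" "toric_map z \<in> K" by (auto simp: topspace_toric_topology)
    have "norm (toric_map z $ k) \<le> R" for k
      using order_trans[OF Finite_Cartesian_Product.norm_nth_le R(2)[OF z(2)]] .
    then obtain \<sigma> where \<sigma>: "\<sigma> \<in> S3" "z \<in> toric_chart \<Sigma> \<sigma>"
      "\<And>j. norm (snd z (W \<sigma> j)) \<le> R powr pairing (W \<sigma> j) 1"
      using toric_point_bounded_chart[OF fan oct S3 cov pur z(1) R(1)] by blast
    have "z = chart_point (V \<sigma>) (chart_coords (W \<sigma>) z)"
      using S3(2)[OF \<sigma>(1)] chart_point_chart_coords[OF _ fan _ _ \<sigma>(2)] unfolding chart_frame_iff by metis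
    moreover have "chart_coords (W \<sigma>) z \<in> C \<sigma>"
      using \<sigma>(3) z(2) calculation by (simp add: C_def chart_coords_def)
    ultimately show "z \<in> (\<Union>\<sigma>\<in>S3. chart_point (V \<sigma>) ` C \<sigma>)" using \<sigma>(1) by blast
  next
    fix z assume "z \<in> (\<Union>\<sigma>\<in>S3. chart_point (V \<sigma>) ` C \<sigma>)"
    then obtain \<sigma> p where \<sigma>: "\<sigma> \<in> S3" and p: "p \<in> C \<sigma>" "z = chart_point (V \<sigma>) p" by blast
    have "z \<in> toric_chart \<Sigma> \<sigma>"
      using chart_point_in_chart[OF _ fan] S3(2)[OF \<sigma>] p(2) unfolding chart_frame_iff by blast
    then show "z \<in> {z \<in> topspace (toric_topology \<Sigma>). toric_map z \<in> K}"
      using p by (auto simp: topspace_toric_topology toric_chart_def C_def)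
  qed
  moreover have "compactin (toric_topology \<Sigma>) (chart_point (V \<sigma>) ` C \<sigma>)" if \<sigma>: "\<sigma> \<in> S3" for \<sigma>
  proof (rule image_compactin)
    show "compactin euclidean (C \<sigma>)" using compC[OF \<sigma>] by (simp add: compactin_euclidean_iff)
    show "continuous_map euclidean (toric_topology \<Sigma>) (chart_point (V \<sigma>))"
      using continuous_chart_point[OF _ fan] S3(2)[OF \<sigma>] unfolding chart_frame_iff by blast
  qed
  ultimately show "compactin (toric_topology \<Sigma>) {z \<in> topspace (toric_topology \<Sigma>). toric_map z \<in> K}"
    using S3(1) by (auto intro!: compactin_Union)
qed

section \<open>The strict transform\<close>

lemma eval_poly_single_diff_one:
  assumes "d \<noteq> 0"
  shows "p \<in> zero_set (Poly_Mapping.single d 1 - Poly_Mapping.single 0 1) \<longleftrightarrow> (\<Prod>k\<in>UNIV. (p $ k) ^ (d $ k)) = 1"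
    and "eval_poly (\<lambda>c. c) (Poly_Mapping.single d 1 - Poly_Mapping.single 0 1) p = (\<Prod>k\<in>UNIV. (p $ k) ^ (d $ k)) - 1"
proof -
  show e: "eval_poly (\<lambda>c. c) (Poly_Mapping.single d 1 - Poly_Mapping.single 0 1) p = (\<Prod>k\<in>UNIV. (p $ k) ^ (d $ k)) - 1"
    using assms by (subst eval_poly_binomial) auto
  show "p \<in> zero_set (Poly_Mapping.single d 1 - Poly_Mapping.single 0 1) \<longleftrightarrow> (\<Prod>k\<in>UNIV. (p $ k) ^ (d $ k)) = 1"
    unfolding zero_set_def mem_Collect_eq e by simp
qed

text \<open>If a monomial equals 1, all variables that occur in it are nonzero, and its derivative
  in such a variable is the exponent times the monomial divided by that variable.\<close>

lemma deriv_monomial_nonzero: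
  fixes p :: "complex^3"
  assumes p1: "(\<Prod>k\<in>UNIV. (p $ k) ^ (d $ k)) = 1" and dk: "d $ k \<noteq> 0"
  shows "p $ k \<noteq> 0" "deriv (\<lambda>t. (\<Prod>j\<in>UNIV. ((p + axis k t) $ j) ^ (d $ j)) - 1) 0 \<noteq> 0"
proof -
  have nz: "(p $ j) ^ (d $ j) \<noteq> 0" for j
  proof
    assume "(p $ j) ^ (d $ j) = 0"
    then have "(\<Prod>k\<in>UNIV. (p $ k) ^ (d $ k)) = 0" by (intro prod_zero) auto
    then show False using p1 by simp
  qed
  show pk: "p $ k \<noteq> 0" using nz[of k] dk by auto
  define C where "C = (\<Prod>j\<in>UNIV - {k}. (p $ j) ^ (d $ j))"
  have C: "C \<noteq> 0" unfolding C_def using nz by (auto simp: prod_zero_iff)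
  have eq: "(\<Prod>j\<in>UNIV. ((p + axis k t) $ j) ^ (d $ j)) = (p $ k + t) ^ (d $ k) * C" for t
  proof -
    have "(\<Prod>j\<in>UNIV. ((p + axis k t) $ j) ^ (d $ j)) =
        ((p + axis k t) $ k) ^ (d $ k) * (\<Prod>j\<in>UNIV - {k}. ((p + axis k t) $ j) ^ (d $ j))"
      by (intro prod.remove) auto
    moreover have "(\<Prod>j\<in>UNIV - {k}. ((p + axis k t) $ j) ^ (d $ j)) = C"
      unfolding C_def by (intro prod.cong) (auto simp: axis_def)
    ultimately show ?thesis by (simp add: axis_def)
  qed
  have "((\<lambda>t. (p $ k + t) ^ (d $ k) * C - 1) has_field_derivative
      of_nat (d $ k) * (p $ k + 0) ^ (d $ k - 1) * C) (at 0)"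
    by (auto intro!: derivative_eq_intros)
  then have "deriv (\<lambda>t. (p $ k + t) ^ (d $ k) * C - 1) 0 = of_nat (d $ k) * (p $ k) ^ (d $ k - 1) * C"
    by (simp add: DERIV_imp_deriv)
  then show "deriv (\<lambda>t. (\<Prod>j\<in>UNIV. ((p + axis k t) $ j) ^ (d $ j)) - 1) 0 \<noteq> 0"
    unfolding eq using C pk dk by simp
qed

text \<open>The exponent of xy / z^(n+1): on the torus the surface is the locus where this character
  is 1. Its pairing is nonpositive on \<open>low_cone\<close> and nonnegative on
  \<open>high_cone\<close>.\<close>

definition A_character :: "nat \<Rightarrow> int^3" where
  "A_character n = axis 1 1 + axis 2 1 - axis 3 (int (n + 1))"

lemma pairing_A_character: "pairing (A_character n) x = x $ 1 + x $ 2 - real (n + 1) * x $ 3"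
  by (simp add: A_character_def pairing_def sum_3 algebra_simps)

lemma torus_A_hypersurface:
  assumes u: "u \<in> toric_orbit {0}"
  shows "toric_map ({0}, u) \<in> zero_set (A_poly n) \<longleftrightarrow> u (A_character n) = 1"
proof -
  have perp: "m \<in> perp_lattice {0}" for m by (simp add: perp_lattice_def pairing_0)
  have nz: "u m \<noteq> 0" for m using u perp by (auto simp: toric_orbit_def)
  have mult: "u (a + b) = u a * u b" for a b using u perp by (auto simp: toric_orbit_def)
  have sc: "axis 3 (int (n + 1)) = int (n + 1) *s (axis 3 1 :: int^3)"
    by (simp add: vec_eq_iff axis_def)
  have "u (A_character n) * u (axis 3 (int (n + 1))) = u (axis 1 1 + axis 2 1)"
    using mult[of "A_character n" "axis 3 (int (n + 1))"] by (simp add: A_character_def)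
  then have "u (A_character n) * u (axis 3 1) ^ (n + 1) = u (axis 1 1) * u (axis 2 1)"
    unfolding mult sc toric_orbit_scale[OF u perp] by (simp only: power_int_of_nat)
  then show ?thesis using nz[of "axis 3 1"]
    by (simp only: zero_set_A_poly toric_map_def vec_lambda_beta snd_conv)
      (metis mult_cancel_right1 power_not_zero)
qed

lemma smooth_transversal_A:
  assumes fan: "is_fan \<Sigma>" and cones: "\<And>\<sigma>. \<sigma> \<in> \<Sigma> \<Longrightarrow> \<sigma> \<subseteq> low_cone n \<or> \<sigma> \<subseteq> high_cone n"
  shows "smooth_transversal_strict_transform (A_poly n) \<Sigma>"
  unfolding smooth_transversal_strict_transform_def Let_def
proof (intro ballI allI impI)
  fix \<sigma> v w p
  assume \<sigma>: "\<sigma> \<in> \<Sigma>" and cf: "chart_frame \<sigma> v w"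
    and p: "p \<in> chart_coords w ` (strict_transform (A_poly n) \<Sigma> \<inter> toric_chart \<Sigma> \<sigma>)"
  have fr: "lattice_frame v w" and \<sigma>v: "\<sigma> = convex_cone hull (range v)"
    using cf by (auto simp: chart_frame_iff)
  \<comment> \<open>The sign is chosen so that the monomial is regular on this chart; the torus
    points where it equals 1 are the same for both signs.\<close>
  define m where "m = (if \<sigma> \<subseteq> low_cone n then - A_character n else A_character n)"
  have m_dual: "m \<in> dual_monoid \<sigma>"
    using cones[OF \<sigma>] by (auto simp: m_def dual_monoid_def pairing_minus pairing_A_character low_cone_def high_cone_def)
  have vs: "v k \<in> \<sigma>" for k unfolding \<sigma>v by (simp add: hull_inc)
  define d where "d = (\<chi> k. nat (frame_exp v m k))"
  have e0: "0 \<le> frame_exp v m k" for k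
    using m_dual vs by (simp add: frame_exp_nonneg[OF fr] dual_monoid_def)
  have smon: "snd (chart_point v q) m = (\<Prod>k\<in>UNIV. (q $ k) ^ (d $ k))" for q
    unfolding snd_chart_point[OF fr] using e0 by (simp add: d_def power_int_def)
  obtain k0 where k0: "d $ k0 \<noteq> 0"
  proof -
    have "pairing m (axis 1 1) \<noteq> 0" by (simp add: m_def pairing_minus pairing_A_character)
    then have "(\<Sum>k\<in>UNIV. pairing m (v k) * pairing (w k) (axis 1 1)) \<noteq> 0"
      using frame_dual_expand[OF fr, of m "axis 1 1"] by simp
    then obtain k where "pairing m (v k) * pairing (w k) (axis 1 1) \<noteq> 0"
      by (metis (no_types, lifting) sum.neutral)
    then have "frame_exp v m k \<noteq> 0" by (simp add: frame_exp_eq_0[OF fr])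
    then have "d $ k \<noteq> 0" using e0[of k] by (simp add: d_def)
    then show thesis by (rule that)
  qed
  have torus: "toric_map ({0}, u) \<in> zero_set (A_poly n) \<longleftrightarrow> u m = 1" if u: "u \<in> toric_orbit {0}" for u
  proof -
    have perp: "a \<in> perp_lattice {0}" for a by (simp add: perp_lattice_def pairing_0)
    have "u (- A_character n) = inverse (u (A_character n))"
      using toric_orbit_scale[OF u perp, of "- 1" "A_character n"]
      by (simp add: power_int_minus vector_sneg_minus1[symmetric])
    then show ?thesis using torus_A_hypersurface[OF u] by (simp add: m_def)
  qed
  define B where "B = {z \<in> toric_variety \<Sigma> - exceptional_locus \<Sigma>. toric_map z \<in> zero_set (A_poly n)}"
  have st: "strict_transform (A_poly n) \<Sigma> = toric_topology \<Sigma> closure_of B"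
    by (simp add: strict_transform_def B_def)
  \<comment> \<open>Outside the exceptional locus only the three coordinate divisors can pass
    through a point. On the surface a vanishing coordinate forces z = 0 and xy = 0, so the cone
    would contain the third axis and one of the first two; but the third is not in
    \<open>high_cone\<close> and the others are not in \<open>low_cone\<close>. Hence the point is
    in the torus.\<close>
  have Bm: "snd z m = 1" if z: "z \<in> B" "z \<in> toric_chart \<Sigma> \<sigma>" for z
  proof -
    obtain \<tau> u where zt: "z = (\<tau>, u)" by fastforce
    have \<tau>: "\<tau> \<in> \<Sigma>" "\<tau> \<subseteq> \<sigma>" and u: "u \<in> toric_orbit \<tau>"
      using z(2) by (auto simp: zt toric_chart_def toric_variety_def)
    define J where "J = {k. v k \<in> \<tau>}"
    have \<tau>J: "\<tau> = convex_cone hull (v ` J)" unfolding J_def by (rule fan_subset_face[OF fr fan \<sigma> \<sigma>v \<tau>])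
    have vJ: "v k \<in> \<tau>" if "k \<in> J" for k using that by (simp add: J_def)
    have std: "\<exists>i. ray (v k) = ray (axis i 1)" if "k \<in> J" for k
    proof -
      have "ray (v k) \<in> \<Sigma>" using frame_face_in_fan[OF fr fan \<sigma> \<sigma>v, of "{k}"] by simp
      then have "ray (v k) \<in> rays \<Sigma>" using frame_dim_cone[OF fr, of "{k}"] by (simp add: rays_def)
      moreover have "ray (v k) \<subseteq> \<tau>"
        unfolding \<tau>J using that by (intro hull_mono) auto
      ultimately have "ray (v k) \<in> standard_rays"
        using z(1) by (auto simp: B_def exceptional_locus_def exceptional_rays_def zt)
      then show ?thesis by (auto simp: standard_rays_def)
    qed
    have zero_axis: "axis i 1 \<in> \<sigma>" if "toric_map z $ i = 0" for i
    proof -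
      have "axis i 1 \<notin> perp_lattice \<tau>" using that u by (auto simp: toric_map_def zt toric_orbit_def)
      then obtain k where k: "k \<in> J" "v k $ i \<noteq> 0"
        by (auto simp: \<tau>J perp_cone_iff[OF fr] frame_exp_eq_0[OF fr] pairing_axis)
      obtain i' where i': "ray (v k) = ray (axis i' 1)" using std[OF k(1)] by blast
      then have "v k \<in> ray (axis i' 1)" by (metis hull_inc insertI1)
      then obtain c where "v k = c *\<^sub>R axis i' 1" by (auto simp: ray_eq)
      then have "i' = i" using k(2) by (auto simp: axis_def split: if_splits)
      then have "axis i 1 \<in> ray (v k)" using i' by (simp add: hull_inc)
      moreover have "ray (v k) \<subseteq> \<sigma>" unfolding \<sigma>v by (intro hull_mono) auto
      ultimately show ?thesis by blast
    qed
    have nz: "toric_map z $ i \<noteq> 0" for i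
    proof
      assume i: "toric_map z $ i = 0"
      have eq: "toric_map z $ 1 * toric_map z $ 2 = toric_map z $ 3 ^ (n + 1)"
        using z(1) by (simp add: B_def zero_set_A_poly)
      have "toric_map z $ 3 = 0 \<and> (toric_map z $ 1 = 0 \<or> toric_map z $ 2 = 0)"
        using eq i exhaust_3[of i] by (auto simp: power_0_left)
      then have "axis 3 1 \<in> \<sigma> \<and> (axis 1 1 \<in> \<sigma> \<or> axis 2 1 \<in> \<sigma>)" using zero_axis by blast
      then show False using cones[OF \<sigma>] by (auto simp: low_cone_def high_cone_def)
    qed
    have "J = {}"
    proof (rule ccontr)
      assume "J \<noteq> {}"
      then obtain k where k: "k \<in> J" by blast
      obtain i where i: "v k $ i \<noteq> 0"
      proof -
        have "v k \<noteq> 0" using frame_pairing[OF fr, of k k] by (auto simp: pairing_0)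
        then show thesis using that by (auto simp: vec_eq_iff)
      qed
      then have "axis i 1 \<notin> perp_lattice \<tau>"
        using vJ[OF k] by (auto simp: perp_lattice_def pairing_axis)
      then have "u (axis i 1) = 0" using u by (auto simp: toric_orbit_def)
      then show False using nz[of i] by (simp add: toric_map_def zt)
    qed
    then have \<tau>0: "\<tau> = {0}" by (simp add: \<tau>J)
    then show ?thesis using torus[of u] u z(1) by (simp add: zt B_def)
  qed
  have S_iff: "chart_coords w ` (strict_transform (A_poly n) \<Sigma> \<inter> toric_chart \<Sigma> \<sigma>)
      = {q. (\<Prod>k\<in>UNIV. (q $ k) ^ (d $ k)) = 1}" (is "?S = ?H")
  proof (intro equalityI subsetI)
    fix q assume "q \<in> ?S"
    then obtain z where z: "z \<in> strict_transform (A_poly n) \<Sigma>" "z \<in> toric_chart \<Sigma> \<sigma>" "q = chart_coords w z"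
      by blast
    have zq: "z = chart_point v q" using chart_point_chart_coords[OF fr fan \<sigma> \<sigma>v z(2)] z(3) by simp
    have "snd z m = 1"
    proof (rule ccontr)
      assume "snd z m \<noteq> 1"
      moreover have "openin (toric_topology \<Sigma>) {z \<in> toric_chart \<Sigma> \<sigma>. snd z m \<in> - {1}}"
        by (intro toric_subbase \<sigma> m_dual) auto
      moreover have "z \<in> {z \<in> toric_chart \<Sigma> \<sigma>. snd z m \<in> - {1}}"
        using z(2) calculation(1) by simp
      moreover have "\<forall>T. z \<in> T \<and> openin (toric_topology \<Sigma>) T \<longrightarrow> (\<exists>y. y \<in> B \<and> y \<in> T)"
        using z(1) unfolding st in_closure_of by simp
      ultimately obtain y where "y \<in> B" "y \<in> {z \<in> toric_chart \<Sigma> \<sigma>. snd z m \<in> - {1}}"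
        by meson
      then show False using Bm[of y] by simp
    qed
    then show "q \<in> ?H" unfolding zq smon by simp
  next
    fix q assume q: "q \<in> ?H"
    have "chart_point v q \<in> toric_topology \<Sigma> closure_of B"
      unfolding in_closure_of
    proof (intro conjI allI impI)
      show "chart_point v q \<in> topspace (toric_topology \<Sigma>)"
        using chart_point_in_chart[OF fr fan \<sigma> \<sigma>v] by (auto simp: topspace_toric_topology toric_chart_def)
      fix T assume T: "chart_point v q \<in> T \<and> openin (toric_topology \<Sigma>) T"
      have "openin euclidean {q \<in> topspace euclidean. chart_point v q \<in> T}"
        using continuous_chart_point[OF fr fan \<sigma> \<sigma>v] T by (intro openin_continuous_map_preimage) auto
      then have op: "open {q. chart_point v q \<in> T}" by simp
      \<comment> \<open>Torus points that approach the given point. The replaced coordinates have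
        exponent zero in the monomial, so these points stay on the surface.\<close>
      define q' where "q' e = (\<chi> k. if q $ k = 0 then of_real e else q $ k)" for e :: real
      have "((\<lambda>e. q' e) \<longlongrightarrow> q' 0) (at_right 0)"
        unfolding q'_def by (intro vec_tendstoI) (auto intro!: tendsto_eq_intros)
      moreover have "q' 0 = q" by (simp add: q'_def vec_eq_iff)
      ultimately have "\<forall>\<^sub>F e in at_right 0. q' e \<in> {q. chart_point v q \<in> T}"
        using T by (intro topological_tendstoD[OF _ op]) auto
      then have "\<forall>\<^sub>F e in at_right (0::real). q' e \<in> {q. chart_point v q \<in> T} \<and> 0 < e"
        by (intro eventually_conj eventually_at_right_less)
      then obtain e where e: "chart_point v (q' e) \<in> T" "0 < e"
        using eventually_happens'[OF trivial_limit_at_right_real] by blast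
      have nz: "q' e $ k \<noteq> 0" for k using e(2) by (simp add: q'_def)
      have qd: "d $ k = 0" if "q $ k = 0" for k
      proof (rule ccontr)
        assume "d $ k \<noteq> 0"
        then have "(q $ k) ^ (d $ k) = 0" using that by simp
        then have "(\<Prod>k\<in>UNIV. (q $ k) ^ (d $ k)) = 0" by (intro prod_zero bexI[of _ k]) simp_all
        then show False using q unfolding mem_Collect_eq by (metis zero_neq_one)
      qed
      have "(q' e $ k) ^ (d $ k) = (q $ k) ^ (d $ k)" for k
        using qd[of k] by (simp add: q'_def)
      then have m1: "snd (chart_point v (q' e)) m = 1" using q unfolding smon by simp
      have f0: "fst (chart_point v (q' e)) = {0}" using nz by (simp add: fst_chart_point[OF fr])
      have orb: "snd (chart_point v (q' e)) \<in> toric_orbit {0}" using chart_point_orbit[OF fr, of "q' e"] f0 by simp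
      have "toric_map (chart_point v (q' e)) \<in> zero_set (A_poly n)"
        using torus[OF orb] m1 f0 by (metis prod.collapse)
      moreover have "chart_point v (q' e) \<in> toric_variety \<Sigma>"
        using chart_point_in_chart[OF fr fan \<sigma> \<sigma>v] by (auto simp: toric_chart_def)
      moreover have "chart_point v (q' e) \<notin> exceptional_locus \<Sigma>"
      proof
        assume "chart_point v (q' e) \<in> exceptional_locus \<Sigma>"
        then obtain \<rho> where "\<rho> \<in> rays \<Sigma>" "\<rho> \<subseteq> {0}"
          using f0 by (auto simp: exceptional_locus_def exceptional_rays_def)
        then show False using dim_subset[of \<rho> "{0}"] by (simp add: rays_def)
      qed
      ultimately show "\<exists>y. y \<in> B \<and> y \<in> T"
        using e(1) by (intro exI[of _ "chart_point v (q' e)"]) (simp add: B_def)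
    qed
    then have "chart_point v q \<in> strict_transform (A_poly n) \<Sigma> \<inter> toric_chart \<Sigma> \<sigma>"
      using chart_point_in_chart[OF fr fan \<sigma> \<sigma>v] by (simp add: st)
    then show "q \<in> ?S" using chart_coords_chart_point[OF fr, of q] by (metis imageI)
  qed
  have d0: "d \<noteq> 0" using k0 by auto
  let ?g = "Poly_Mapping.single d 1 - Poly_Mapping.single 0 1 :: poly3"
  have p1: "(\<Prod>k\<in>UNIV. (p $ k) ^ (d $ k)) = 1" using p unfolding S_iff by simp
  show "\<exists>N g k. open N \<and> p \<in> N \<and>
      chart_coords w ` (strict_transform (A_poly n) \<Sigma> \<inter> toric_chart \<Sigma> \<sigma>) \<inter> N = zero_set g \<inter> N \<and>
      \<not> (ray (v k) \<in> exceptional_rays \<Sigma> \<and> p $ k = 0) \<and>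
      deriv (\<lambda>t. eval_poly (\<lambda>c. c) g (p + axis k t)) 0 \<noteq> 0"
  proof (intro exI conjI)
    show "open (UNIV :: (complex^3) set)" "p \<in> UNIV" by auto
    show "?S \<inter> UNIV = zero_set ?g \<inter> UNIV"
      unfolding S_iff using eval_poly_single_diff_one(1)[OF d0] by auto
    \<comment> \<open>As \<open>p $ k0\<close> is nonzero, the direction \<open>k0\<close> is
      tangent to every exceptional component through \<open>p\<close>.\<close>
    show "\<not> (ray (v k0) \<in> exceptional_rays \<Sigma> \<and> p $ k0 = 0)"
      using deriv_monomial_nonzero(1)[OF p1 k0] by simp
    show "deriv (\<lambda>t. eval_poly (\<lambda>c. c) ?g (p + axis k0 t)) 0 \<noteq> 0"
      unfolding eval_poly_single_diff_one(2)[OF d0] by (rule deriv_monomial_nonzero(2)[OF p1 k0])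
  qed
qed

lemma embedded_resolution_A_fan: "embedded_resolution (A_poly n) (A_fan (n + 1))"
  unfolding embedded_resolution_def
proof (intro conjI)
  have rs: "regular_subdivision (A_fan (n + 1)) (dual_fan (A_poly n))" by (rule regular_subdivision_A_fan)
  show fan: "is_fan (A_fan (n + 1))" by (rule is_fan_A_fan)
  show "\<forall>\<sigma>\<in>A_fan (n + 1). regular_cone \<sigma>" using rs by (simp add: regular_subdivision_def)
  show "bij_betw toric_map ({{0}} \<times> toric_orbit {0}) {p. \<forall>k. p $ k \<noteq> 0}" by (rule toric_map_torus_bij)
  have cones: "\<sigma> \<subseteq> low_cone n \<or> \<sigma> \<subseteq> high_cone n" if s: "\<sigma> \<in> A_fan (n + 1)" for \<sigma>
  proof -
    obtain \<tau> where "\<tau> \<in> dual_fan (A_poly n)" "\<sigma> \<subseteq> \<tau>"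
      using rs s unfolding regular_subdivision_def by blast
    then show ?thesis using dual_fan_cases by blast
  qed
  show "smooth_transversal_strict_transform (A_poly n) (A_fan (n + 1))"
    by (rule smooth_transversal_A[OF fan cones])
  have framed: "convex_cone hull (range v) \<in> A_fan (n + 1) \<and> chart_frame (convex_cone hull (range v)) v w"
    if "(v, w) \<in> A_frames (n + 1)" for v w
    using frame_fanI[OF that, of UNIV] A_frames_frame[OF that] by (simp add: A_fan_def chart_frame_iff)
  show "proper_map (toric_topology (A_fan (n + 1))) euclidean toric_map"
  proof (rule proper_toric_map[OF fan])
    show "\<sigma> \<subseteq> octant" if "\<sigma> \<in> A_fan (n + 1)" for \<sigma>
      using cones[OF that] by (auto simp: low_cone_def high_cone_def)
    show "\<exists>\<sigma>\<in>A_fan (n + 1). x \<in> \<sigma> \<and> (\<exists>v w. chart_frame \<sigma> v w)" if x: "x \<in> octant" for x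
    proof -
      obtain v w where "(v, w) \<in> A_frames (n + 1)" "x \<in> convex_cone hull (range v)"
        using A_frames_cover[OF x, of "n + 1"] by blast
      then show ?thesis using framed[of v w] by blast
    qed
    show "\<exists>\<sigma>\<in>A_fan (n + 1). \<tau> \<subseteq> \<sigma> \<and> (\<exists>v w. chart_frame \<sigma> v w)" if t: "\<tau> \<in> A_fan (n + 1)" for \<tau>
    proof -
      obtain v w where "(v, w) \<in> A_frames (n + 1)" "\<tau> \<subseteq> convex_cone hull (range v)"
        using A_fan_framed[OF t] by blast
      then show ?thesis using framed[of v w] by blast
    qed
  qed
qed

section \<open>The Zariski topology on jets\<close>

lemma affine_jets_iff: "\<gamma> \<in> affine_jets m \<longleftrightarrow> (\<forall>k i. m < i \<longrightarrow> fps_nth (\<gamma> $ k) i = 0)"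
proof
  show "\<gamma> \<in> affine_jets m \<Longrightarrow> \<forall>k i. m < i \<longrightarrow> fps_nth (\<gamma> $ k) i = 0"
    by (auto simp: affine_jets_def truncate_arc_def)
  assume "\<forall>k i. m < i \<longrightarrow> fps_nth (\<gamma> $ k) i = 0"
  then have "\<gamma> = truncate_arc m \<gamma>" by (auto simp: truncate_arc_def vec_eq_iff fps_eq_iff)
  then show "\<gamma> \<in> affine_jets m" by (auto simp: affine_jets_def)
qed

lemma truncate_arc_nth: "fps_nth (truncate_arc m \<gamma> $ k) i = (if i \<le> m then fps_nth (\<gamma> $ k) i else 0)"
  by (simp add: truncate_arc_def)

lemma truncate_arc_in: "truncate_arc m \<gamma> \<in> affine_jets m"
  by (simp add: affine_jets_def)

lemma truncate_arc_id: "\<gamma> \<in> affine_jets m \<Longrightarrow> truncate_arc m \<gamma> = \<gamma>"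
  by (auto simp: affine_jets_iff vec_eq_iff fps_eq_iff truncate_arc_nth)

lemma arc_eqI: "(\<And>k i. fps_nth (\<gamma> $ k) i = fps_nth (\<delta> $ k) i) \<Longrightarrow> \<gamma> = (\<delta> :: arc)"
  by (simp add: vec_eq_iff fps_eq_iff)

lemma arc_ring_sum: "(\<And>i. i \<in> A \<Longrightarrow> f i \<in> arc_ring) \<Longrightarrow> (\<lambda>\<gamma>. \<Sum>i\<in>A. f i \<gamma>) \<in> arc_ring"
  by (induct A rule: infinite_finite_induct) (auto intro: arc_ring.intros)

lemma arc_ring_diff:
  assumes "\<phi> \<in> arc_ring" "\<psi> \<in> arc_ring"
  shows "(\<lambda>\<gamma>. \<phi> \<gamma> - \<psi> \<gamma>) \<in> arc_ring"
proof -
  have "(\<lambda>\<gamma>. \<phi> \<gamma> + (- 1) * \<psi> \<gamma>) \<in> arc_ring"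
    by (intro arc_ring.intros(3) arc_ring.intros(4) arc_ring.intros(1) assms)
  then show ?thesis by simp
qed

lemma arc_ring_fps_mult:
  assumes "\<And>j. (\<lambda>\<gamma>. fps_nth (F \<gamma>) j) \<in> arc_ring" "\<And>j. (\<lambda>\<gamma>. fps_nth (G \<gamma>) j) \<in> arc_ring"
  shows "(\<lambda>\<gamma>. fps_nth (F \<gamma> * G \<gamma>) j) \<in> arc_ring"
  unfolding fps_mult_nth by (intro arc_ring_sum arc_ring.intros(4) assms)

lemma arc_ring_fps_power:
  assumes "\<And>j. (\<lambda>\<gamma>. fps_nth (F \<gamma>) j) \<in> arc_ring"
  shows "(\<lambda>\<gamma>. fps_nth (F \<gamma> ^ k) j) \<in> arc_ring"
proof (induct k arbitrary: j)
  case 0 then show ?case using arc_ring.intros(1)[of "if j = 0 then 1 else 0"] by simp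
next
  case (Suc k) then show ?case unfolding power_Suc by (intro arc_ring_fps_mult assms)
qed

lemma arc_ring_A_poly: "(\<lambda>\<gamma>. fps_nth (compose_arc (A_poly n) \<gamma>) j) \<in> arc_ring"
  unfolding compose_A_poly fps_sub_nth
  by (intro arc_ring_diff arc_ring_fps_mult arc_ring_fps_power arc_ring.intros(2))

lemma topspace_zariski [simp]: "topspace (zariski_jets m) = affine_jets m"
proof -
  have "{\<gamma> \<in> affine_jets m. (\<lambda>\<gamma>. 1 :: complex) \<gamma> \<noteq> 0} \<in> (\<lambda>\<phi>. {\<gamma> \<in> affine_jets m. \<phi> \<gamma> \<noteq> 0}) ` arc_ring"
    using arc_ring.intros(1)[of 1] by (intro imageI)
  then show ?thesis by (auto simp: zariski_jets_def)
qed

lemma openin_zariski_basic: "\<phi> \<in> arc_ring \<Longrightarrow> openin (zariski_jets m) {\<gamma> \<in> affine_jets m. \<phi> \<gamma> \<noteq> 0}"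
  unfolding zariski_jets_def by (intro topology_generated_by_Basis imageI)

lemma closedin_zariski_zero:
  assumes "\<phi> \<in> arc_ring"
  shows "closedin (zariski_jets m) {\<gamma> \<in> affine_jets m. \<phi> \<gamma> = 0}"
proof -
  have "affine_jets m - {\<gamma> \<in> affine_jets m. \<phi> \<gamma> = 0} = {\<gamma> \<in> affine_jets m. \<phi> \<gamma> \<noteq> 0}" by auto
  then show ?thesis using openin_zariski_basic[OF assms, of m] by (auto simp: closedin_def)
qed

lemma closedin_zariski_zeros:
  assumes "\<Phi> \<subseteq> arc_ring"
  shows "closedin (zariski_jets m) {\<gamma> \<in> affine_jets m. \<forall>\<phi>\<in>\<Phi>. \<phi> \<gamma> = 0}"
proof -
  have "{\<gamma> \<in> affine_jets m. \<forall>\<phi>\<in>\<Phi>. \<phi> \<gamma> = 0}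
      = \<Inter> (insert (affine_jets m) ((\<lambda>\<phi>. {\<gamma> \<in> affine_jets m. \<phi> \<gamma> = 0}) ` \<Phi>))" by auto
  moreover have "closedin (zariski_jets m) (affine_jets m)" by (metis closedin_topspace topspace_zariski)
  moreover have "closedin (zariski_jets m) (\<Inter> (insert (affine_jets m) ((\<lambda>\<phi>. {\<gamma> \<in> affine_jets m. \<phi> \<gamma> = 0}) ` \<Phi>)))"
    using assms closedin_zariski_zero calculation(2) by (intro closedin_Inter) blast+
  ultimately show ?thesis by simp
qed

lemma openin_zariski_base:
  assumes "openin (zariski_jets m) U" "x \<in> U"
  shows "\<exists>\<phi>\<in>arc_ring. \<phi> x \<noteq> 0 \<and> {\<gamma> \<in> affine_jets m. \<phi> \<gamma> \<noteq> 0} \<subseteq> U"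
proof -
  have "generate_topology_on ((\<lambda>\<phi>. {\<gamma> \<in> affine_jets m. \<phi> \<gamma> \<noteq> 0}) ` arc_ring) U"
    using assms(1) by (simp add: zariski_jets_def openin_topology_generated_by_iff)
  then show ?thesis using assms(2)
  proof (induct arbitrary: x)
    case (Int a b)
    obtain \<phi> \<psi> where "\<phi> \<in> arc_ring" "\<phi> x \<noteq> 0" "{\<gamma> \<in> affine_jets m. \<phi> \<gamma> \<noteq> 0} \<subseteq> a"
      "\<psi> \<in> arc_ring" "\<psi> x \<noteq> 0" "{\<gamma> \<in> affine_jets m. \<psi> \<gamma> \<noteq> 0} \<subseteq> b"
      using Int(2)[of x] Int(4)[of x] Int(5) by blast
    then show ?case by (intro bexI[of _ "\<lambda>\<gamma>. \<phi> \<gamma> * \<psi> \<gamma>"]) (auto intro: arc_ring.intros(4))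
  next
    case (UN K)
    then obtain k where k: "k \<in> K" "x \<in> k" by blast
    from UN(2)[OF this] show ?case using k(1) by blast
  qed auto
qed

lemma closedin_zariski_separate:
  assumes "closedin (zariski_jets m) C" "x \<in> affine_jets m" "x \<notin> C"
  shows "\<exists>\<phi>\<in>arc_ring. \<phi> x \<noteq> 0 \<and> (\<forall>\<gamma>\<in>C. \<phi> \<gamma> = 0)"
proof -
  have "openin (zariski_jets m) (affine_jets m - C)" "x \<in> affine_jets m - C" "C \<subseteq> affine_jets m"
    using assms by (auto simp: closedin_def)
  from openin_zariski_base[OF this(1,2)] this(3) show ?thesis by blast
qed

lemma zariski_closure_zero:
  assumes "x \<in> zariski_jets m closure_of S" "\<phi> \<in> arc_ring" "\<And>\<gamma>. \<gamma> \<in> S \<Longrightarrow> \<phi> \<gamma> = 0" "S \<subseteq> affine_jets m"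
  shows "\<phi> x = 0"
proof -
  have "zariski_jets m closure_of S \<subseteq> {\<gamma> \<in> affine_jets m. \<phi> \<gamma> = 0}"
    using assms(3,4) closedin_zariski_zero[OF assms(2)] by (intro closure_of_minimal) auto
  then show ?thesis using assms(1) by auto
qed

text \<open>Primality of the vanishing ideal. Points outside a closed set are separated from it by a
  function, so two closed sets that cover \<open>S\<close>, neither of them alone, yield two
  functions with product zero on \<open>S\<close>.\<close>

lemma irreducible_in_zariski:
  "irreducible_in (zariski_jets m) S \<longleftrightarrow> S \<subseteq> affine_jets m \<and> S \<noteq> {} \<and>
     (\<forall>\<phi>\<in>arc_ring. \<forall>\<psi>\<in>arc_ring. (\<forall>\<gamma>\<in>S. \<phi> \<gamma> * \<psi> \<gamma> = 0) \<longrightarrow> (\<forall>\<gamma>\<in>S. \<phi> \<gamma> = 0) \<or> (\<forall>\<gamma>\<in>S. \<psi> \<gamma> = 0))"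
  (is "?L \<longleftrightarrow> ?R")
proof
  assume L: ?L
  then have S: "S \<subseteq> affine_jets m" "S \<noteq> {}" by (auto simp: irreducible_in_def)
  have "(\<forall>\<gamma>\<in>S. \<phi> \<gamma> = 0) \<or> (\<forall>\<gamma>\<in>S. \<psi> \<gamma> = 0)"
    if "\<phi> \<in> arc_ring" "\<psi> \<in> arc_ring" "\<forall>\<gamma>\<in>S. \<phi> \<gamma> * \<psi> \<gamma> = 0" for \<phi> \<psi>
  proof -
    have "S \<subseteq> {\<gamma> \<in> affine_jets m. \<phi> \<gamma> = 0} \<union> {\<gamma> \<in> affine_jets m. \<psi> \<gamma> = 0}"
      using that(3) S(1) by auto
    then have "S \<subseteq> {\<gamma> \<in> affine_jets m. \<phi> \<gamma> = 0} \<or> S \<subseteq> {\<gamma> \<in> affine_jets m. \<psi> \<gamma> = 0}"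
      using L closedin_zariski_zero[OF that(1), of m] closedin_zariski_zero[OF that(2), of m]
      unfolding irreducible_in_def by meson
    then show ?thesis by blast
  qed
  then show ?R using S by blast
next
  assume R: ?R
  have "S \<subseteq> A \<or> S \<subseteq> B"
    if A: "closedin (zariski_jets m) A" and B: "closedin (zariski_jets m) B" and AB: "S \<subseteq> A \<union> B" for A B
  proof (rule ccontr)
    assume "\<not> (S \<subseteq> A \<or> S \<subseteq> B)"
    then obtain a b where ab: "a \<in> S" "a \<notin> A" "b \<in> S" "b \<notin> B" by blast
    obtain \<phi> where \<phi>: "\<phi> \<in> arc_ring" "\<phi> a \<noteq> 0" "\<forall>\<gamma>\<in>A. \<phi> \<gamma> = 0"
      using closedin_zariski_separate[OF A _ ab(2)] ab(1) R by blast
    obtain \<psi> where \<psi>: "\<psi> \<in> arc_ring" "\<psi> b \<noteq> 0" "\<forall>\<gamma>\<in>B. \<psi> \<gamma> = 0"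
      using closedin_zariski_separate[OF B _ ab(4)] ab(3) R by blast
    have "\<forall>\<gamma>\<in>S. \<phi> \<gamma> * \<psi> \<gamma> = 0" using AB \<phi>(3) \<psi>(3) by auto
    then have "(\<forall>\<gamma>\<in>S. \<phi> \<gamma> = 0) \<or> (\<forall>\<gamma>\<in>S. \<psi> \<gamma> = 0)" using R \<phi>(1) \<psi>(1) by simp
    then show False using \<phi>(2) \<psi>(2) ab by blast
  qed
  then show ?L using R by (auto simp: irreducible_in_def)
qed

lemma irreducible_in_finite_cover:
  assumes D: "irreducible_in T D" and "finite I" and "\<And>i. i \<in> I \<Longrightarrow> closedin T (Z i)" and "D \<subseteq> (\<Union>i\<in>I. Z i)"
  shows "\<exists>i\<in>I. D \<subseteq> Z i"
  using assms(2-4)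
proof (induct I)
  case empty
  then show ?case using D by (auto simp: irreducible_in_def)
next
  case (insert i I)
  have "closedin T (\<Union>i\<in>I. Z i)" using insert by (intro closedin_Union) auto
  then have "D \<subseteq> Z i \<or> D \<subseteq> (\<Union>i\<in>I. Z i)"
    using D insert.prems unfolding irreducible_in_def by (metis UN_insert insertI1)
  then show ?case using insert by blast
qed

text \<open>An irreducible subset of a finite union of closed sets lies in one of them, so the
  maximal ones are among the \<open>Z i\<close>; incomparability makes each of these
  maximal.\<close>

lemma irreducible_components_cover:
  assumes fin: "finite I" and cl: "\<And>i. i \<in> I \<Longrightarrow> closedin T (Z i)" and irr: "\<And>i. i \<in> I \<Longrightarrow> irreducible_in T (Z i)"
    and Y: "Y = (\<Union>i\<in>I. Z i)" and inc: "\<And>i j. i \<in> I \<Longrightarrow> j \<in> I \<Longrightarrow> Z i \<subseteq> Z j \<Longrightarrow> i = j"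
  shows "irreducible_component T Y C \<longleftrightarrow> (\<exists>i\<in>I. C = Z i)"
proof
  assume C: "irreducible_component T Y C"
  then have "irreducible_in T C" "C \<subseteq> (\<Union>i\<in>I. Z i)" by (auto simp: irreducible_component_def Y)
  then obtain i where i: "i \<in> I" "C \<subseteq> Z i" using irreducible_in_finite_cover[where Z = Z, OF _ fin cl] by blast
  then have "Z i = C" using C irr[OF i(1)] unfolding irreducible_component_def Y by blast
  then show "\<exists>i\<in>I. C = Z i" using i(1) by blast
next
  assume "\<exists>i\<in>I. C = Z i"
  then obtain i where i: "i \<in> I" "C = Z i" by blast
  have "D = Z i" if D: "irreducible_in T D" "Z i \<subseteq> D" "D \<subseteq> Y" for D
  proof -
    obtain j where j: "j \<in> I" "D \<subseteq> Z j" using irreducible_in_finite_cover[where Z = Z, OF D(1) fin cl] D(3) Y by blast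
    then have "i = j" using inc[OF i(1) j(1)] D(2) by blast
    then show ?thesis using j D(2) by blast
  qed
  then show "irreducible_component T Y C"
    using i irr[OF i(1)] by (auto simp: irreducible_component_def Y)
qed

section \<open>Classical limits and dense subsets\<close>

lemma arc_ring_tendsto:
  assumes "\<phi> \<in> arc_ring" and "\<And>k i. ((\<lambda>t. fps_nth (c t $ k) i) \<longlongrightarrow> fps_nth (\<gamma> $ k) i) F"
  shows "((\<lambda>t. \<phi> (c t)) \<longlongrightarrow> \<phi> \<gamma>) F"
  using assms(1) by induct (auto intro!: tendsto_intros assms(2))

text \<open>Functions of \<open>arc_ring\<close> are polynomials in finitely many coefficients, so
  they are continuous for coefficientwise convergence. This admits analytic deformations as a means
  to compute Zariski closures.\<close>

lemma zariski_closed_limit: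
  assumes "closedin (zariski_jets m) C" and "\<And>t :: nat. c t \<in> C" and "\<gamma> \<in> affine_jets m"
    and "\<And>k i. (\<lambda>t. fps_nth (c t $ k) i) \<longlonglongrightarrow> fps_nth (\<gamma> $ k) i"
  shows "\<gamma> \<in> C"
proof (rule ccontr)
  assume "\<gamma> \<notin> C"
  then obtain \<phi> where \<phi>: "\<phi> \<in> arc_ring" "\<phi> \<gamma> \<noteq> 0" "\<forall>\<gamma>\<in>C. \<phi> \<gamma> = 0"
    using closedin_zariski_separate[OF assms(1,3)] by blast
  have "(\<lambda>t. \<phi> (c t)) \<longlonglongrightarrow> \<phi> \<gamma>" by (rule arc_ring_tendsto[OF \<phi>(1) assms(4)])
  moreover have "(\<lambda>t. \<phi> (c t)) = (\<lambda>t. 0)" using \<phi>(3) assms(2) by auto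
  ultimately show False using \<phi>(2) by (simp add: LIMSEQ_const_iff)
qed

lemma irreducible_in_dense:
  assumes "irreducible_in (zariski_jets m) U" "U \<subseteq> Z" "Z \<subseteq> affine_jets m"
    and "\<And>C. closedin (zariski_jets m) C \<Longrightarrow> U \<subseteq> C \<Longrightarrow> Z \<subseteq> C"
  shows "irreducible_in (zariski_jets m) Z"
proof -
  have "Z \<noteq> {}" using assms(1,2) by (auto simp: irreducible_in_def)
  moreover have "Z \<subseteq> A \<or> Z \<subseteq> B" if "closedin (zariski_jets m) A" "closedin (zariski_jets m) B" "Z \<subseteq> A \<union> B" for A B
  proof -
    have "U \<subseteq> A \<or> U \<subseteq> B" using assms(1,2) that unfolding irreducible_in_def by (meson order_trans)
    then show ?thesis using assms(4) that by blast
  qed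
  ultimately show ?thesis using assms(3) by (auto simp: irreducible_in_def)
qed

subsection \<open>Rational curves\<close>

text \<open>Regularity of \<open>g\<close> where \<open>d\<close> is nonzero, as a fraction with a
  power of \<open>d\<close> as denominator. Values at the zeros of \<open>d\<close> are left free,
  since division by zero returns a default there.\<close>

definition rational_with :: "complex poly \<Rightarrow> (complex \<Rightarrow> complex) \<Rightarrow> bool" where
  "rational_with d g \<longleftrightarrow> (\<exists>P k. \<forall>t. poly d t \<noteq> 0 \<longrightarrow> g t * poly d t ^ k = poly P t)"

lemma rational_withI: "(\<And>t. poly d t \<noteq> 0 \<Longrightarrow> g t * poly d t ^ k = poly P t) \<Longrightarrow> rational_with d g"
  unfolding rational_with_def by blast

lemma rational_with_const: "rational_with d (\<lambda>t. c)"
  by (rule rational_withI[of _ _ 0 "[:c:]"]) simp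

lemma rational_with_affine: "rational_with d (\<lambda>t. (1 - t) * a + t * b)"
  by (rule rational_withI[of _ _ 0 "[:a, b - a:]"]) (simp add: algebra_simps)

lemma rational_with_add:
  assumes "rational_with d f" "rational_with d g"
  shows "rational_with d (\<lambda>t. f t + g t)"
proof -
  obtain P k Q l where *: "\<And>t. poly d t \<noteq> 0 \<Longrightarrow> f t * poly d t ^ k = poly P t"
    "\<And>t. poly d t \<noteq> 0 \<Longrightarrow> g t * poly d t ^ l = poly Q t"
    using assms unfolding rational_with_def by blast
  show ?thesis
  proof (rule rational_withI[of _ _ "k + l" "P * d ^ l + Q * d ^ k"])
    fix t assume "poly d t \<noteq> 0"
    have "(f t + g t) * poly d t ^ (k + l) = (f t * poly d t ^ k) * poly d t ^ l + (g t * poly d t ^ l) * poly d t ^ k"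
      by (simp add: algebra_simps power_add)
    then show "(f t + g t) * poly d t ^ (k + l) = poly (P * d ^ l + Q * d ^ k) t"
      using * \<open>poly d t \<noteq> 0\<close> by simp
  qed
qed

lemma rational_with_mult:
  assumes "rational_with d f" "rational_with d g"
  shows "rational_with d (\<lambda>t. f t * g t)"
proof -
  obtain P k Q l where *: "\<And>t. poly d t \<noteq> 0 \<Longrightarrow> f t * poly d t ^ k = poly P t"
    "\<And>t. poly d t \<noteq> 0 \<Longrightarrow> g t * poly d t ^ l = poly Q t"
    using assms unfolding rational_with_def by blast
  show ?thesis
  proof (rule rational_withI[of _ _ "k + l" "P * Q"])
    fix t assume "poly d t \<noteq> 0"
    have "(f t * g t) * poly d t ^ (k + l) = (f t * poly d t ^ k) * (g t * poly d t ^ l)"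
      by (simp add: algebra_simps power_add)
    then show "(f t * g t) * poly d t ^ (k + l) = poly (P * Q) t"
      using * \<open>poly d t \<noteq> 0\<close> by simp
  qed
qed

lemma rational_with_sum: "(\<And>i. i \<in> A \<Longrightarrow> rational_with d (f i)) \<Longrightarrow> rational_with d (\<lambda>t. \<Sum>i\<in>A. f i t)"
  by (induct A rule: infinite_finite_induct) (auto intro: rational_with_add rational_with_const)

lemma rational_with_inverse: "rational_with d (\<lambda>t. inverse (poly d t))"
  by (rule rational_withI[of _ _ 1 1]) simp

lemma rational_with_fps_mult:
  assumes "\<And>j. rational_with d (\<lambda>t. fps_nth (F t) j)" "\<And>j. rational_with d (\<lambda>t. fps_nth (G t) j)"
  shows "rational_with d (\<lambda>t. fps_nth (F t * G t) j)"
  unfolding fps_mult_nth by (intro rational_with_sum rational_with_mult assms)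

lemma rational_with_fps_power:
  assumes "\<And>j. rational_with d (\<lambda>t. fps_nth (F t) j)"
  shows "rational_with d (\<lambda>t. fps_nth (F t ^ k) j)"
proof (induct k arbitrary: j)
  case 0 then show ?case by (simp add: rational_with_const)
next
  case (Suc k) then show ?case unfolding power_Suc by (intro rational_with_fps_mult assms)
qed

text \<open>The recursion for the coefficients of the inverse divides by the constant term
  only.\<close>

lemma rational_with_fps_inverse:
  assumes F: "\<And>j. rational_with d (\<lambda>t. fps_nth (F t) j)" and F0: "\<And>t. fps_nth (F t) 0 = poly d t"
  shows "rational_with d (\<lambda>t. fps_nth (inverse (F t)) j)"
proof (induct j rule: less_induct)
  case (less j)
  show ?case
  proof (cases "j = 0")
    case True then show ?thesis by (simp add: F0 rational_with_inverse)
  next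
    case False
    define h where "h t = (- inverse (poly d t)) * (\<Sum>i=1..j. fps_nth (F t) i * fps_nth (inverse (F t)) (j - i))" for t
    have "rational_with d (\<lambda>t. (- 1 * inverse (poly d t)) * (\<Sum>i=1..j. fps_nth (F t) i * fps_nth (inverse (F t)) (j - i)))"
      by (intro rational_with_mult rational_with_sum rational_with_const rational_with_inverse F less) auto
    then obtain P k where P: "\<And>t. poly d t \<noteq> 0 \<Longrightarrow> h t * poly d t ^ k = poly P t"
      unfolding rational_with_def h_def by auto
    have "fps_nth (inverse (F t)) j = h t" if t: "poly d t \<noteq> 0" for t
    proof -
      have "0 = fps_nth (F t * inverse (F t)) j"
        using t False F0[of t] by (simp add: inverse_mult_eq_1')
      also have "\<dots> = fps_nth (F t) 0 * fps_nth (inverse (F t)) j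
          + (\<Sum>i=1..j. fps_nth (F t) i * fps_nth (inverse (F t)) (j - i))"
        unfolding fps_mult_nth
        using sum.atLeast_Suc_atMost[of 0 j "\<lambda>i. fps_nth (F t) i * fps_nth (inverse (F t)) (j - i)"] by simp
      finally have "poly d t * fps_nth (inverse (F t)) j
          = - (\<Sum>i=1..j. fps_nth (F t) i * fps_nth (inverse (F t)) (j - i))"
        by (simp add: F0 eq_neg_iff_add_eq_0 add.commute)
      then show ?thesis using t unfolding h_def by (simp add: field_simps)
    qed
    then show ?thesis using P by (intro rational_withI[of d _ k P]) simp
  qed
qed

lemma rational_with_arc_ring:
  assumes "\<phi> \<in> arc_ring" "\<And>k i. rational_with d (\<lambda>t. fps_nth (c t $ k) i)"
  shows "rational_with d (\<lambda>t. \<phi> (c t))"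
  using assms(1)
  by induct (auto intro: rational_with_const rational_with_add rational_with_mult assms(2))

text \<open>A line without finitely many points is irreducible. If neither function vanished on
  \<open>S\<close>, a curve through a witness for each would turn them into nonzero polynomials
  whose product with \<open>d\<close> has finitely many roots; at any other parameter the product of
  the functions is nonzero.\<close>

lemma irreducible_in_rational_curves:
  assumes S: "S \<subseteq> affine_jets m" "S \<noteq> {}"
    and curve: "\<And>\<gamma> \<delta>. \<gamma> \<in> S \<Longrightarrow> \<delta> \<in> S \<Longrightarrow> \<exists>d c. poly d 0 \<noteq> 0 \<and> poly d 1 \<noteq> 0 \<and> c 0 = \<gamma> \<and> c 1 = \<delta> \<and>
      (\<forall>t. poly d t \<noteq> 0 \<longrightarrow> c t \<in> S) \<and> (\<forall>k i. rational_with d (\<lambda>t. fps_nth (c t $ k) i))"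
  shows "irreducible_in (zariski_jets m) S"
  unfolding irreducible_in_zariski
proof (intro conjI S ballI impI)
  fix \<phi> \<psi> assume \<phi>: "\<phi> \<in> arc_ring" and \<psi>: "\<psi> \<in> arc_ring" and prod: "\<forall>\<gamma>\<in>S. \<phi> \<gamma> * \<psi> \<gamma> = 0"
  show "(\<forall>\<gamma>\<in>S. \<phi> \<gamma> = 0) \<or> (\<forall>\<gamma>\<in>S. \<psi> \<gamma> = 0)"
  proof (rule ccontr)
    assume "\<not> ?thesis"
    then obtain \<gamma> \<delta> where gd: "\<gamma> \<in> S" "\<phi> \<gamma> \<noteq> 0" "\<delta> \<in> S" "\<psi> \<delta> \<noteq> 0" by blast
    obtain d c where d: "poly d 0 \<noteq> 0" "poly d 1 \<noteq> 0" and c: "c 0 = \<gamma>" "c 1 = \<delta>"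
      "\<And>t. poly d t \<noteq> 0 \<Longrightarrow> c t \<in> S" and r: "\<And>k i. rational_with d (\<lambda>t. fps_nth (c t $ k) i)"
      using curve[OF gd(1,3)] by blast
    obtain P k where P: "\<And>t. poly d t \<noteq> 0 \<Longrightarrow> \<phi> (c t) * poly d t ^ k = poly P t"
      using rational_with_arc_ring[OF \<phi> r] unfolding rational_with_def by blast
    obtain Q l where Q: "\<And>t. poly d t \<noteq> 0 \<Longrightarrow> \<psi> (c t) * poly d t ^ l = poly Q t"
      using rational_with_arc_ring[OF \<psi> r] unfolding rational_with_def by blast
    have "poly P 0 \<noteq> 0" using P[of 0] d c gd by auto
    moreover have "poly Q 1 \<noteq> 0" using Q[of 1] d c gd by auto
    ultimately have "P * Q * d \<noteq> 0" using d by auto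
    then have "finite {t. poly (P * Q * d) t = 0}" by (rule poly_roots_finite)
    then obtain t where t: "poly (P * Q * d) t \<noteq> 0"
      using ex_new_if_finite[OF infinite_UNIV_char_0] by blast
    then have dt: "poly d t \<noteq> 0" by auto
    have "(\<phi> (c t) * \<psi> (c t)) * poly d t ^ (k + l) = poly P t * poly Q t"
      using P[OF dt] Q[OF dt] by (simp add: power_add algebra_simps)
    then show False using prod c(3)[OF dt] t by auto
  qed
qed

section \<open>Deformation of jets\<close>

text \<open>For a monic polynomial, |p(c)| is the product of the distances from c to the roots, and
  the nearest root contributes the least factor.\<close>

lemma exists_near_root:
  fixes p :: "complex poly"
  assumes "lead_coeff p = 1" "degree p = Suc m"
  shows "\<exists>r. poly p r = 0 \<and> norm (c - r) ^ Suc m \<le> norm (poly p c)"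
  using assms
proof (induct m arbitrary: p)
  case 0
  then have "coeff p i = coeff [:coeff p 0, 1:] i" for i
    by (cases i) (auto simp: coeff_eq_0 coeff_pCons split: nat.split)
  then obtain a where a: "p = [:a, 1:]" by (metis poly_eqI)
  show ?case by (rule exI[of _ "- a"]) (simp add: a add.commute)
next
  case (Suc m)
  have "\<not> constant (poly p)" using Suc.prems(2) by (simp add: constant_degree)
  then obtain a where a: "poly p a = 0" using fundamental_theorem_of_algebra by blast
  then obtain q where q: "p = [:- a, 1:] * q" by (metis poly_eq_0_iff_dvd dvdE)
  have q0: "q \<noteq> 0" using Suc.prems(2) q by auto
  have lq: "lead_coeff q = 1" using Suc.prems(1) unfolding q lead_coeff_mult by simp
  have "degree p = 1 + degree q" unfolding q using q0 by (subst degree_mult_eq) auto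
  then have "degree q = Suc m" using Suc.prems(2) by simp
  from Suc.hyps[OF lq this] obtain r where r: "poly q r = 0" "norm (c - r) ^ Suc m \<le> norm (poly q c)" by blast
  have pc: "norm (poly p c) = norm (c - a) * norm (poly q c)" by (simp add: q norm_mult[symmetric] algebra_simps)
  show ?case
  proof (cases "norm (c - a) \<le> norm (c - r)")
    case True
    have "norm (c - a) ^ Suc (Suc m) \<le> norm (c - a) * norm (c - r) ^ Suc m"
      unfolding power_Suc[of _ "Suc m"] using True by (intro mult_left_mono power_mono) auto
    also have "\<dots> \<le> norm (poly p c)" unfolding pc using r(2) by (intro mult_left_mono) auto
    finally show ?thesis using a by blast
  next
    case False
    have "norm (c - r) ^ Suc (Suc m) \<le> norm (c - a) * norm (c - r) ^ Suc m"
      unfolding power_Suc[of _ "Suc m"] using False by (intro mult_right_mono) auto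
    also have "\<dots> \<le> norm (poly p c)" unfolding pc using r(2) by (intro mult_left_mono) auto
    finally show ?thesis using r(1) q by (intro exI[of _ r]) simp
  qed
qed

lemma poly_tendsto:
  fixes P :: "nat \<Rightarrow> complex poly"
  assumes "\<And>i. (\<lambda>k. coeff (P k) i) \<longlonglongrightarrow> coeff p i" and "\<And>k. degree (P k) \<le> D" and "degree p \<le> D"
  shows "(\<lambda>k. poly (P k) c) \<longlonglongrightarrow> poly p c"
proof -
  have eq: "poly q c = (\<Sum>i\<le>D. coeff q i * c ^ i)" if "degree q \<le> D" for q :: "complex poly"
    unfolding poly_altdef using that
    by (intro sum.mono_neutral_left) (auto simp: coeff_eq_0)
  show ?thesis unfolding eq[OF assms(2)] eq[OF assms(3)] by (intro tendsto_intros assms(1))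
qed

text \<open>Roots are split off one at a time, each time the root nearest to the limit root.\<close>

lemma monic_factor_limit:
  fixes p q :: "complex poly"
  assumes "lead_coeff p = 1" "lead_coeff q = 1"
    and "\<And>k. lead_coeff (P k) = 1" "\<And>k. degree (P k) = degree p + degree q"
    and "\<And>i. (\<lambda>k. coeff (P k) i) \<longlonglongrightarrow> coeff (p * q) i"
  shows "\<exists>X Y. (\<forall>k. P k = X k * Y k) \<and> (\<forall>i. (\<lambda>k. coeff (X k) i) \<longlonglongrightarrow> coeff p i) \<and>
    (\<forall>i. (\<lambda>k. coeff (Y k) i) \<longlonglongrightarrow> coeff q i)"
  using assms
proof (induct "degree p" arbitrary: p P)
  case 0
  then have "p = 1" using "0.prems"(1) by (metis degree_eq_zeroE coeff_pCons_0 one_pCons)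
  then show ?case using "0.prems"(5) by (intro exI[of _ "\<lambda>k. 1"] exI[of _ P]) auto
next
  case (Suc n)
  have "\<not> constant (poly p)" using Suc.hyps(2) by (simp add: constant_degree)
  then obtain c where c: "poly p c = 0" using fundamental_theorem_of_algebra by blast
  then obtain p' where p': "p = [:- c, 1:] * p'" by (metis poly_eq_0_iff_dvd dvdE)
  have p'0: "p' \<noteq> 0" using Suc.hyps(2) p' by auto
  have lp': "lead_coeff p' = 1" using Suc.prems(1) unfolding p' lead_coeff_mult by simp
  have "degree p = 1 + degree p'" unfolding p' using p'0 by (subst degree_mult_eq) auto
  then have dp': "degree p' = n" using Suc.hyps(2) by simp
  define D where "D = n + degree q"
  have degP: "degree (P k) = Suc D" for k using Suc.prems(4)[of k] Suc.hyps(2) by (simp add: D_def)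
  have q0: "q \<noteq> 0" using Suc.prems(2) by auto
  have "p \<noteq> 0" using Suc.prems(1) by auto
  then have degpq: "degree (p * q) = Suc D" using q0 Suc.hyps(2) by (simp add: degree_mult_eq D_def)
  have "\<exists>r. poly (P k) r = 0 \<and> norm (c - r) ^ Suc D \<le> norm (poly (P k) c)" for k
    using exists_near_root[OF Suc.prems(3) degP] .
  then obtain r where r: "\<And>k. poly (P k) (r k) = 0" "\<And>k. norm (c - r k) ^ Suc D \<le> norm (poly (P k) c)"
    by metis
  have "(\<lambda>k. poly (P k) c) \<longlonglongrightarrow> poly (p * q) c"
    by (rule poly_tendsto[OF Suc.prems(5), of "Suc D"]) (simp_all add: degP degpq)
  then have "(\<lambda>k. norm (poly (P k) c)) \<longlonglongrightarrow> 0" using c by (simp add: tendsto_norm_zero)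
  then have "(\<lambda>k. norm (c - r k) ^ Suc D) \<longlonglongrightarrow> 0"
    by (rule Lim_null_comparison[rotated]) (use r(2) in auto)
  then have "(\<lambda>k. root (Suc D) (norm (c - r k) ^ Suc D)) \<longlonglongrightarrow> root (Suc D) 0"
    by (intro tendsto_intros)
  then have "(\<lambda>k. norm (c - r k)) \<longlonglongrightarrow> 0" by (simp add: real_root_power_cancel del: power_Suc)
  then have "(\<lambda>k. c - r k) \<longlonglongrightarrow> 0" by (simp add: tendsto_norm_zero_iff)
  from tendsto_diff[OF tendsto_const[of c] this] have rc: "r \<longlonglongrightarrow> c" by simp
  have "\<exists>Q. P k = [:- r k, 1:] * Q" for k using r(1)[of k] by (metis poly_eq_0_iff_dvd dvdE)
  then obtain Q where Q: "\<And>k. P k = [:- r k, 1:] * Q k" by metis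
  have Q0: "Q k \<noteq> 0" for k using Suc.prems(3)[of k] Q[of k] by auto
  have lQ: "lead_coeff (Q k) = 1" for k using Suc.prems(3)[of k] unfolding Q lead_coeff_mult by simp
  have dQ: "degree (Q k) = D" for k
  proof -
    have "degree (P k) = 1 + degree (Q k)" unfolding Q[of k] using Q0 by (subst degree_mult_eq) auto
    then show ?thesis using degP[of k] by simp
  qed
  have dpq': "degree (p' * q) = D"
    using p'0 q0 dp' by (simp add: degree_mult_eq D_def)
  \<comment> \<open>Dividing by a linear factor is Horner's recursion from the leading coefficient
    downwards. So the coefficients of the quotient converge by descending induction, which starts
    above the degree, where they are zero.\<close>
  have cQ: "coeff (Q k) i = coeff (P k) (Suc i) + r k * coeff (Q k) (Suc i)" for k i
    unfolding Q by simp
  have cpq: "coeff (p' * q) i = coeff (p * q) (Suc i) + c * coeff (p' * q) (Suc i)" for i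
    unfolding p' mult.assoc by simp
  note Plim = Suc.prems(5)
  have lim: "(\<lambda>k. coeff (Q k) i) \<longlonglongrightarrow> coeff (p' * q) i" for i
  proof (induct "Suc D - i" arbitrary: i)
    case 0
    then have "coeff (Q k) i = 0" "coeff (p' * q) i = 0" for k
      by (auto intro!: coeff_eq_0 simp: dQ dpq')
    then show ?case by simp
  next
    case (Suc d)
    then have "(\<lambda>k. coeff (Q k) (Suc i)) \<longlonglongrightarrow> coeff (p' * q) (Suc i)" by (intro Suc.hyps(1)) simp
    then show ?case unfolding cQ[of _ i] cpq[of i] by (intro tendsto_intros rc Plim)
  qed
  obtain X Y where XY: "\<And>k. Q k = X k * Y k" "\<And>i. (\<lambda>k. coeff (X k) i) \<longlonglongrightarrow> coeff p' i"
    "\<And>i. (\<lambda>k. coeff (Y k) i) \<longlonglongrightarrow> coeff q i"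
    using Suc.hyps(1)[OF dp'[symmetric] lp' Suc.prems(2) lQ _ lim] dQ dp' unfolding D_def by blast
  have "(\<lambda>k. coeff ([:- r k, 1:] * X k) i) \<longlonglongrightarrow> coeff p i" for i
  proof (cases i)
    case 0
    have "(\<lambda>k. - r k * coeff (X k) 0) \<longlonglongrightarrow> - c * coeff p' 0" by (intro tendsto_intros rc XY(2))
    then show ?thesis by (simp add: 0 p' coeff_mult)
  next
    case (Suc j)
    have "(\<lambda>k. coeff (X k) j - r k * coeff (X k) (Suc j)) \<longlonglongrightarrow> coeff p' j - c * coeff p' (Suc j)"
      by (intro tendsto_intros rc XY(2))
    then show ?thesis by (simp add: Suc p')
  qed
  moreover have "P k = ([:- r k, 1:] * X k) * Y k" for k
    unfolding Q[of k] XY(1)[of k] by (simp only: mult.assoc)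
  ultimately have "(\<forall>k. P k = ([:- r k, 1:] * X k) * Y k) \<and>
      (\<forall>i. (\<lambda>k. coeff ([:- r k, 1:] * X k) i) \<longlonglongrightarrow> coeff p i) \<and> (\<forall>i. (\<lambda>k. coeff (Y k) i) \<longlonglongrightarrow> coeff q i)"
    using XY(3) by blast
  then show ?case by - (rule exI[where x = "\<lambda>k. [:- r k, 1:] * X k"], rule exI[where x = Y])
qed

text \<open>Adding t^L fixes the degree, so no root escapes to infinity when a product of lifts is
  perturbed, and the coefficients below \<open>L\<close> stay as they are.\<close>

definition monic_lift :: "nat \<Rightarrow> complex fps \<Rightarrow> complex poly" where
  "monic_lift L f = (\<Sum>i<L. monom (fps_nth f i) i) + monom 1 L"

lemma coeff_monic_lift: "coeff (monic_lift L f) i = (if i < L then fps_nth f i else if i = L then 1 else 0)"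
  by (simp add: monic_lift_def coeff_sum)

lemma degree_monic_lift: "degree (monic_lift L f) = L"
proof (rule antisym)
  show "degree (monic_lift L f) \<le> L" by (intro degree_le) (simp add: coeff_monic_lift)
  show "L \<le> degree (monic_lift L f)" by (intro le_degree) (simp add: coeff_monic_lift)
qed

lemma monic_monic_lift: "lead_coeff (monic_lift L f) = 1"
  by (simp add: degree_monic_lift coeff_monic_lift)

lemma fps_mult_nth_cong:
  assumes "\<And>i. i \<le> j \<Longrightarrow> fps_nth f i = fps_nth f' i" "\<And>i. i \<le> j \<Longrightarrow> fps_nth g i = fps_nth g' i"
  shows "fps_nth (f * g) j = fps_nth (f' * g') j"
  unfolding fps_mult_nth using assms by (intro sum.cong) auto

lemma fps_power_nth_cong:
  assumes "\<And>i. i \<le> j \<Longrightarrow> fps_nth f i = fps_nth f' i"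
  shows "fps_nth (f ^ N) j = fps_nth (f' ^ N) j"
  using assms
proof (induct N arbitrary: j)
  case (Suc N) then show ?case unfolding power_Suc by (intro fps_mult_nth_cong) auto
qed simp

text \<open>A perturbation of \<open>z\<close> moves the product \<open>x y\<close>, and the factors, lifted to monic polynomials,
  follow by continuity of roots.\<close>

lemma jet_unit_approximation:
  fixes x y z :: "complex fps"
  assumes N: "N \<ge> 1" and L: "K \<le> L" and eq: "\<And>j. j < K \<Longrightarrow> fps_nth (x * y) j = fps_nth (z ^ N) j"
  shows "\<exists>X Y Z. (\<forall>k. fps_nth (X k) 0 \<noteq> 0) \<and> (\<forall>k. \<forall>j<K. fps_nth (X k * Y k) j = fps_nth (Z k ^ N) j) \<and>
    (\<forall>i<L. (\<lambda>k. fps_nth (X k) i) \<longlonglongrightarrow> fps_nth x i) \<and> (\<forall>i<L. (\<lambda>k. fps_nth (Y k) i) \<longlonglongrightarrow> fps_nth y i) \<and>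
    (\<forall>i. (\<lambda>k. fps_nth (Z k) i) \<longlonglongrightarrow> fps_nth z i)"
proof -
  \<comment> \<open>A sequence of nonzero numbers tending to \<open>c\<close>: 1/(k + 1) if
    \<open>c\<close> is zero, c (1 + 1/(k + 1)) otherwise.\<close>
  define nz where "nz c k = c + (if c = 0 then 1 else c) * inverse (of_nat (Suc k))" for c :: complex and k :: nat
  have nz: "nz c k \<noteq> 0" for c k
  proof (cases "c = 0")
    case True then show ?thesis by (simp add: nz_def del: of_nat_Suc)
  next
    case False
    have "(1 :: complex) + inverse (of_nat (Suc k)) = of_nat (Suc (Suc k)) / of_nat (Suc k)"
      by (simp add: field_simps del: of_nat_Suc) (simp add: algebra_simps)
    moreover have "nz c k = c * (1 + inverse (of_nat (Suc k)))"
      using False by (simp add: nz_def distrib_left del: of_nat_Suc)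
    ultimately have "nz c k = c * (of_nat (Suc (Suc k)) / of_nat (Suc k))" by simp
    then show ?thesis using False by (simp del: of_nat_Suc)
  qed
  have inv: "(\<lambda>k. inverse (of_nat (Suc k)) :: complex) \<longlonglongrightarrow> 0" by (rule LIMSEQ_Suc[OF lim_inverse_n])
  have "(\<lambda>k. nz c k) \<longlonglongrightarrow> c + (if c = 0 then 1 else c) * 0" for c
    unfolding nz_def by (intro tendsto_intros inv)
  then have nzlim: "(\<lambda>k. nz c k) \<longlonglongrightarrow> c" for c by simp
  define bump where "bump f k = f + fps_const (nz (fps_nth f 0) k - fps_nth f 0)" for f :: "complex fps" and k
  have bump0: "fps_nth (bump f k) 0 = nz (fps_nth f 0) k" for f k by (simp add: bump_def)
  have bumplim: "(\<lambda>k. fps_nth (bump f k) i) \<longlonglongrightarrow> fps_nth f i" for f i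
  proof (cases "i = 0")
    case True then show ?thesis using nzlim by (simp add: bump0)
  next
    case False then show ?thesis by (simp add: bump_def)
  qed
  show ?thesis
  \<comment> \<open>Without an equation \<open>x\<close> can be perturbed alone; the degree bound
    for \<open>R\<close> and the argument for the unit need a positive \<open>K\<close>.\<close>
  proof (cases "K = 0")
    case True
    then show ?thesis using nz bumplim
      by (intro exI[of _ "bump x"] exI[of _ "\<lambda>k. y"] exI[of _ "\<lambda>k. z"]) (simp add: bump0)
  next
    case False
    define Z where "Z = bump z"
    define p where "p = monic_lift L x"
    define q where "q = monic_lift L y"
    \<comment> \<open>The correction turns the coefficients of the product below \<open>K\<close>
      into those of the perturbed power. Its degree is less than 2L, so the product stays monic of
      the same degree.\<close>
    define R where "R k = (\<Sum>j<K. monom (fps_nth (Z k ^ N) j - fps_nth (z ^ N) j) j)" for k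
    define P where "P k = p * q + R k" for k
    have cR: "coeff (R k) i = (if i < K then fps_nth (Z k ^ N) i - fps_nth (z ^ N) i else 0)" for k i
      by (simp add: R_def coeff_sum)
    have monic: "lead_coeff p = 1" "lead_coeff q = 1" by (simp_all only: p_def q_def monic_monic_lift)
    have deg: "degree p = L" "degree q = L" by (simp_all add: p_def q_def degree_monic_lift)
    have "p \<noteq> 0" "q \<noteq> 0" using monic by auto
    then have dpq: "degree (p * q) = L + L" by (simp add: degree_mult_eq deg)
    have "degree (R k) < L + L" for k
    proof -
      have "degree (R k) \<le> K - 1" using False by (intro degree_le) (auto simp: cR)
      then show ?thesis using False L by linarith
    qed
    then have dP: "degree (P k) = L + L" and cP: "coeff (P k) (L + L) = 1" for k
    proof -
      assume lt: "degree (R k) < L + L" for k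
      show "degree (P k) = L + L" unfolding P_def using dpq lt[of k] by (simp add: degree_add_eq_left)
      have "coeff (p * q) (L + L) = 1" using monic dpq by (metis lead_coeff_mult mult_1)
      then show "coeff (P k) (L + L) = 1" unfolding P_def using lt[of k] by (simp add: coeff_eq_0)
    qed
    have Zlim: "(\<lambda>k. fps_nth (Z k) i) \<longlonglongrightarrow> fps_nth z i" for i unfolding Z_def by (rule bumplim)
    have powlim: "(\<lambda>k. fps_nth (Z k ^ N') i) \<longlonglongrightarrow> fps_nth (z ^ N') i" for N' i
    proof (induct N' arbitrary: i)
      case (Suc N')
      then show ?case unfolding power_Suc fps_mult_nth by (intro tendsto_intros Zlim)
    qed simp
    have "(\<lambda>k. coeff (P k) i) \<longlonglongrightarrow> coeff (p * q) i" for i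
    proof -
      have "(\<lambda>k. coeff (R k) i) \<longlonglongrightarrow> 0"
        unfolding cR using tendsto_diff[OF powlim tendsto_const, of N i "fps_nth (z ^ N) i"]
        by (cases "i < K") simp_all
      then show ?thesis unfolding P_def coeff_add using tendsto_add[OF tendsto_const, of "\<lambda>k. coeff (R k) i" 0 sequentially] by simp
    qed
    then obtain X Y where XY: "\<And>k. P k = X k * Y k" "\<And>i. (\<lambda>k. coeff (X k) i) \<longlonglongrightarrow> coeff p i"
      "\<And>i. (\<lambda>k. coeff (Y k) i) \<longlonglongrightarrow> coeff q i"
      using monic_factor_limit[OF monic, of P] cP dP deg by auto
    have PZ: "coeff (P k) j = fps_nth (Z k ^ N) j" if "j < K" for j k
    proof -
      have "coeff (p * q) j = fps_nth (x * y) j"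
        unfolding coeff_mult fps_mult_nth using that L
        by (intro sum.cong) (auto simp: p_def q_def coeff_monic_lift)
      then show ?thesis using that eq[OF that] by (simp add: P_def cR)
    qed
    have fm: "fps_nth (fps_of_poly (X k) * fps_of_poly (Y k)) j = coeff (P k) j" for k j
      by (simp add: XY(1) coeff_mult fps_mult_nth atMost_atLeast0)
    \<comment> \<open>This is what the perturbation of \<open>z\<close> achieves: the constant term
      of the product is a power of a nonzero number, so that of the first factor cannot
      vanish.\<close>
    have "fps_nth (fps_of_poly (X k)) 0 \<noteq> 0" for k
    proof
      assume "fps_nth (fps_of_poly (X k)) 0 = 0"
      then have "coeff (P k) 0 = 0" unfolding XY(1) by (simp add: coeff_mult)
      then have "fps_nth (Z k ^ N) 0 = 0" using PZ[of 0 k] False by simp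
      then show False using nz by (simp add: fps_power_zeroth Z_def bump0)
    qed
    moreover have "(\<lambda>k. fps_nth (fps_of_poly (X k)) i) \<longlonglongrightarrow> fps_nth x i"
      "(\<lambda>k. fps_nth (fps_of_poly (Y k)) i) \<longlonglongrightarrow> fps_nth y i" if "i < L" for i
      using XY(2,3)[of i] that by (simp_all add: p_def q_def coeff_monic_lift)
    ultimately show ?thesis using PZ Zlim
      by (intro exI[of _ "\<lambda>k. fps_of_poly (X k)"] exI[of _ "\<lambda>k. fps_of_poly (Y k)"] exI[of _ Z]) (auto simp: fm)
  qed
qed

section \<open>Irreducible components over the origin\<close>

definition ord_jets :: "nat \<Rightarrow> nat \<Rightarrow> nat \<Rightarrow> nat \<Rightarrow> arc set" where
  "ord_jets n m a b = {\<gamma> \<in> jets (A_poly n) m. (\<forall>i<a. fps_nth (\<gamma> $ 1) i = 0) \<and>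
     (\<forall>i<b. fps_nth (\<gamma> $ 2) i = 0) \<and> fps_nth (\<gamma> $ 3) 0 = 0}"

lemma closedin_ord_jets: "closedin (zariski_jets m) (ord_jets n m a b)"
proof -
  define \<Phi> where "\<Phi> = (\<lambda>j \<gamma>. fps_nth (compose_arc (A_poly n) \<gamma>) j) ` {..m} \<union> (\<lambda>i \<gamma>. fps_nth (\<gamma> $ 1) i) ` {..<a}
      \<union> (\<lambda>i \<gamma>. fps_nth (\<gamma> $ 2) i) ` {..<b} \<union> {\<lambda>\<gamma>. fps_nth (\<gamma> $ 3) 0}"
  have "\<Phi> \<subseteq> arc_ring" by (auto simp: \<Phi>_def intro: arc_ring_A_poly arc_ring.intros(2))
  moreover have "ord_jets n m a b = {\<gamma> \<in> affine_jets m. \<forall>\<phi>\<in>\<Phi>. \<phi> \<gamma> = 0}"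
  proof (intro set_eqI)
    fix \<gamma>
    have "(\<forall>\<phi>\<in>\<Phi>. \<phi> \<gamma> = 0) \<longleftrightarrow> (\<forall>j\<le>m. fps_nth (compose_arc (A_poly n) \<gamma>) j = 0) \<and> (\<forall>i<a. fps_nth (\<gamma> $ 1) i = 0) \<and>
     (\<forall>i<b. fps_nth (\<gamma> $ 2) i = 0) \<and> fps_nth (\<gamma> $ 3) 0 = 0"
      unfolding \<Phi>_def ball_Un ball_simps by (simp add: Ball_def conj_assoc)
    then show "\<gamma> \<in> ord_jets n m a b \<longleftrightarrow> \<gamma> \<in> {\<gamma> \<in> affine_jets m. \<forall>\<phi>\<in>\<Phi>. \<phi> \<gamma> = 0}"
      unfolding ord_jets_def jets_def mem_Collect_eq by blast
  qed
  ultimately show ?thesis using closedin_zariski_zeros[of \<Phi> m] by simp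
qed

lemma ord_jets_affine: "ord_jets n m a b \<subseteq> affine_jets m"
  by (auto simp: ord_jets_def jets_def)

definition shifted_arc :: "nat \<Rightarrow> nat \<Rightarrow> complex fps \<Rightarrow> complex fps \<Rightarrow> complex fps \<Rightarrow> arc" where
  "shifted_arc a b x y z = vector [fps_X ^ a * x, fps_X ^ b * y, fps_X * z]"

lemma shifted_arc_nth:
  "shifted_arc a b x y z $ 1 = fps_X ^ a * x" "shifted_arc a b x y z $ 2 = fps_X ^ b * y"
  "shifted_arc a b x y z $ 3 = fps_X * z"
  by (simp_all add: shifted_arc_def vector_3)

lemma compose_truncate_arc:
  assumes "j \<le> m"
  shows "fps_nth (compose_arc (A_poly n) (truncate_arc m \<gamma>)) j = fps_nth (compose_arc (A_poly n) \<gamma>) j"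
  unfolding compose_A_poly fps_sub_nth
  using assms by (intro arg_cong2[of _ _ _ _ "(-)"] fps_mult_nth_cong fps_power_nth_cong) (simp_all add: truncate_arc_nth)

lemma compose_shifted_arc: "compose_arc (A_poly n) (shifted_arc a b x y z) = fps_X ^ (a + b) * (x * y) - fps_X ^ (n + 1) * z ^ (n + 1)"
  unfolding compose_A_poly shifted_arc_nth by (simp add: power_mult_distrib power_add algebra_simps)

text \<open>With a + b = n + 1 both monomials are divisible by t^(n+1), and dividing turns the
  conditions at t^(n+1), ..., t^m into m - n conditions on the shifted series. For m \<le> n there
  are none, in agreement with truncated subtraction.\<close>

lemma shifted_arc_jets:
  assumes ab: "a + b = min (m + 1) (n + 1)"
  shows "truncate_arc m (shifted_arc a b x y z) \<in> jets (A_poly n) m \<longleftrightarrow>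
    (\<forall>j<m - n. fps_nth (x * y) j = fps_nth (z ^ (n + 1)) j)"
proof -
  have "truncate_arc m (shifted_arc a b x y z) \<in> jets (A_poly n) m \<longleftrightarrow>
      (\<forall>j\<le>m. fps_nth (fps_X ^ (a + b) * (x * y)) j = fps_nth (fps_X ^ (n + 1) * z ^ (n + 1)) j)"
    unfolding jets_def using truncate_arc_in
    by (simp add: compose_truncate_arc compose_shifted_arc del: power_Suc)
  also have "\<dots> \<longleftrightarrow> (\<forall>j<m - n. fps_nth (x * y) j = fps_nth (z ^ (n + 1)) j)"
  proof (cases "m \<le> n")
    case True
    then show ?thesis using ab by (auto simp: fps_X_power_mult_nth simp del: power_Suc)
  next
    case False
    then have ab': "a + b = n + 1" using ab by simp
    show ?thesis
    proof (intro iffI allI impI)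
      fix j assume h: "\<forall>j\<le>m. fps_nth (fps_X ^ (a + b) * (x * y)) j = fps_nth (fps_X ^ (n + 1) * z ^ (n + 1)) j"
        and j: "j < m - n"
      have "j + (n + 1) \<le> m" using j by simp
      with h have "fps_nth (fps_X ^ (n + 1) * (x * y)) (j + (n + 1)) = fps_nth (fps_X ^ (n + 1) * z ^ (n + 1)) (j + (n + 1))"
        unfolding ab' by blast
      then show "fps_nth (x * y) j = fps_nth (z ^ (n + 1)) j"
        unfolding fps_X_power_mult_nth by simp
    next
      fix j assume h: "\<forall>j<m - n. fps_nth (x * y) j = fps_nth (z ^ (n + 1)) j" and j: "j \<le> m"
      show "fps_nth (fps_X ^ (a + b) * (x * y)) j = fps_nth (fps_X ^ (n + 1) * z ^ (n + 1)) j"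
      proof (cases "j < n + 1")
        case False
        then have "j - (n + 1) < m - n" using j by simp
        then show ?thesis unfolding ab' fps_X_power_mult_nth using h by simp
      qed (simp add: ab' fps_X_power_mult_nth del: power_Suc)
    qed
  qed
  finally show ?thesis .
qed

lemma truncate_shifted_nth:
  "fps_nth (truncate_arc m (shifted_arc a b x y z) $ 1) i = (if i \<le> m \<and> a \<le> i then fps_nth x (i - a) else 0)"
  "fps_nth (truncate_arc m (shifted_arc a b x y z) $ 2) i = (if i \<le> m \<and> b \<le> i then fps_nth y (i - b) else 0)"
  "fps_nth (truncate_arc m (shifted_arc a b x y z) $ 3) i = (if i \<le> m \<and> 1 \<le> i then fps_nth z (i - 1) else 0)"
  by (auto simp: truncate_arc_nth shifted_arc_nth fps_X_power_mult_nth)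

lemma shifted_arc_ord_jets:
  assumes "a + b = min (m + 1) (n + 1)"
  shows "truncate_arc m (shifted_arc a b x y z) \<in> ord_jets n m a b \<longleftrightarrow>
    (\<forall>j<m - n. fps_nth (x * y) j = fps_nth (z ^ (n + 1)) j)"
  using shifted_arc_jets[OF assms, of x y z] by (auto simp: ord_jets_def truncate_shifted_nth)

lemma ord_jets_shifted:
  assumes "\<gamma> \<in> ord_jets n m a b"
  shows "\<gamma> = truncate_arc m (shifted_arc a b (fps_shift a (\<gamma> $ 1)) (fps_shift b (\<gamma> $ 2)) (fps_shift 1 (\<gamma> $ 3)))"
proof (rule arc_eqI)
  fix k i
  have "\<gamma> \<in> affine_jets m" using assms ord_jets_affine by blast
  then have hi: "m < i \<Longrightarrow> fps_nth (\<gamma> $ k) i = 0" for k i by (simp add: affine_jets_iff)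
  have low: "i < a \<Longrightarrow> fps_nth (\<gamma> $ 1) i = 0" "i < b \<Longrightarrow> fps_nth (\<gamma> $ 2) i = 0" "i < 1 \<Longrightarrow> fps_nth (\<gamma> $ 3) i = 0"
    using assms by (auto simp: ord_jets_def)
  show "fps_nth (\<gamma> $ k) i = fps_nth (truncate_arc m (shifted_arc a b (fps_shift a (\<gamma> $ 1)) (fps_shift b (\<gamma> $ 2)) (fps_shift 1 (\<gamma> $ 3))) $ k) i"
    using exhaust_3[of k] hi[of i k] low
    by (auto simp: truncate_shifted_nth not_le not_less)
qed

definition ord_jets_open :: "nat \<Rightarrow> nat \<Rightarrow> nat \<Rightarrow> nat \<Rightarrow> arc set" where
  "ord_jets_open n m a b = {\<gamma> \<in> ord_jets n m a b. fps_nth (\<gamma> $ 1) a \<noteq> 0}"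

context
  fixes n m a b :: nat
  assumes ab: "a + b = min (m + 1) (n + 1)" and b1: "1 \<le> b"
begin

text \<open>Since \<open>b\<close> is positive, the first coefficient of the shifted
  \<open>x\<close> is still visible in the \<open>m\<close>-jet.\<close>

lemma a_le_m: "a \<le> m"
  using ab b1 by auto

lemma ord_jets_open_nonempty: "truncate_arc m (shifted_arc a b 1 1 1) \<in> ord_jets_open n m a b"
  using a_le_m by (simp add: ord_jets_open_def shifted_arc_ord_jets[OF ab] truncate_shifted_nth)

lemma irreducible_ord_jets_open: "irreducible_in (zariski_jets m) (ord_jets_open n m a b)"
proof (rule irreducible_in_rational_curves)
  show "ord_jets_open n m a b \<subseteq> affine_jets m" using ord_jets_affine[of n m a b] by (auto simp: ord_jets_open_def)
  show "ord_jets_open n m a b \<noteq> {}" using ord_jets_open_nonempty by blast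
next
  fix \<gamma> \<delta> assume g: "\<gamma> \<in> ord_jets_open n m a b" and d: "\<delta> \<in> ord_jets_open n m a b"
  define x0 where "x0 = fps_shift a (\<gamma> $ 1)"
  define y0 where "y0 = fps_shift b (\<gamma> $ 2)"
  define z0 where "z0 = fps_shift 1 (\<gamma> $ 3)"
  define x1 where "x1 = fps_shift a (\<delta> $ 1)"
  define y1 where "y1 = fps_shift b (\<delta> $ 2)"
  define z1 where "z1 = fps_shift 1 (\<delta> $ 3)"
  have \<gamma>: "\<gamma> = truncate_arc m (shifted_arc a b x0 y0 z0)"
    unfolding x0_def y0_def z0_def by (rule ord_jets_shifted[of _ n]) (use g in \<open>simp add: ord_jets_open_def\<close>)
  have \<delta>: "\<delta> = truncate_arc m (shifted_arc a b x1 y1 z1)"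
    unfolding x1_def y1_def z1_def by (rule ord_jets_shifted[of _ n]) (use d in \<open>simp add: ord_jets_open_def\<close>)
  have e0: "\<And>j. j < m - n \<Longrightarrow> fps_nth (x0 * y0) j = fps_nth (z0 ^ (n + 1)) j"
    using g shifted_arc_ord_jets[OF ab, of x0 y0 z0] unfolding ord_jets_open_def \<gamma>[symmetric] by simp
  have e1: "\<And>j. j < m - n \<Longrightarrow> fps_nth (x1 * y1) j = fps_nth (z1 ^ (n + 1)) j"
    using d shifted_arc_ord_jets[OF ab, of x1 y1 z1] unfolding ord_jets_open_def \<delta>[symmetric] by simp
  have u0: "fps_nth x0 0 \<noteq> 0" and u1: "fps_nth x1 0 \<noteq> 0"
    using g d by (auto simp: ord_jets_open_def x0_def x1_def)
  \<comment> \<open>The constant term of \<open>X t\<close>: wherever \<open>D\<close> is nonzero,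
    the interpolated \<open>X t\<close> is a unit.\<close>
  define D where "D = [:fps_nth x0 0, fps_nth x1 0 - fps_nth x0 0:]"
  define lin where "lin f g t = fps_const (1 - t) * f + fps_const t * g" for f g :: "complex fps" and t
  have lin_nth: "fps_nth (lin f g t) i = (1 - t) * fps_nth f i + t * fps_nth g i" for f g t i
    by (simp add: lin_def)
  define X where "X = lin x0 x1"
  define Z where "Z = lin z0 z1"
  \<comment> \<open>The equation determines the coefficients of \<open>y\<close> below m - n from
    \<open>x\<close> and \<open>z\<close>; the others are free and are interpolated.\<close>
  define Y where "Y t = Abs_fps (\<lambda>j. if j < m - n then fps_nth (inverse (X t) * Z t ^ (n + 1)) j else fps_nth (lin y0 y1 t) j)" for t
  define c where "c t = truncate_arc m (shifted_arc a b (X t) (Y t) (Z t))" for t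
  have XD: "fps_nth (X t) 0 = poly D t" for t by (simp add: X_def lin_nth D_def algebra_simps)
  have ends: "lin f g 0 = f" "lin f g 1 = g" for f g by (simp_all add: lin_def)
  have cancel: "fps_nth (inverse x * z ^ (n + 1)) j = fps_nth y j"
    if "fps_nth x 0 \<noteq> 0" "\<And>i. i < m - n \<Longrightarrow> fps_nth (x * y) i = fps_nth (z ^ (n + 1)) i" "j < m - n" for x y z :: "complex fps" and j
  proof -
    have "fps_nth (inverse x * z ^ (n + 1)) j = fps_nth (inverse x * (x * y)) j"
      by (rule fps_mult_nth_cong) (use that in auto)
    also have "inverse x * (x * y) = y" using inverse_mult_eq_1[OF that(1)] by (metis mult.assoc mult_1)
    finally show ?thesis .
  qed
  have Y0: "Y 0 = y0" using cancel[OF u0 e0] by (auto simp: fps_eq_iff Y_def X_def Z_def ends)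
  have Y1: "Y 1 = y1" using cancel[OF u1 e1] by (auto simp: fps_eq_iff Y_def X_def Z_def ends)
  have "c t \<in> ord_jets_open n m a b" if t: "poly D t \<noteq> 0" for t
  proof -
    have "fps_nth (X t * Y t) j = fps_nth (Z t ^ (n + 1)) j" if "j < m - n" for j
    proof -
      have "fps_nth (X t * Y t) j = fps_nth (X t * (inverse (X t) * Z t ^ (n + 1))) j"
        by (rule fps_mult_nth_cong) (use that in \<open>auto simp: Y_def\<close>)
      also have "X t * (inverse (X t) * Z t ^ (n + 1)) = Z t ^ (n + 1)"
        using t by (simp add: mult.assoc[symmetric] inverse_mult_eq_1' XD)
      finally show ?thesis .
    qed
    then show ?thesis
      using a_le_m t by (simp add: c_def ord_jets_open_def shifted_arc_ord_jets[OF ab] truncate_shifted_nth XD)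
  qed
  moreover have "rational_with D (\<lambda>t. fps_nth (c t $ k) i)" for k i
  proof -
    have rl: "rational_with D (\<lambda>t. fps_nth (lin f g t) j)" for f g j
      unfolding lin_nth by (rule rational_with_affine)
    have rY: "rational_with D (\<lambda>t. fps_nth (Y t) j)" for j
    proof (cases "j < m - n")
      case True
      have "rational_with D (\<lambda>t. fps_nth (inverse (X t) * Z t ^ (n + 1)) j)"
        by (intro rational_with_fps_mult rational_with_fps_inverse rational_with_fps_power)
           (auto simp: X_def Z_def rl XD[unfolded X_def])
      then show ?thesis using True by (simp add: Y_def)
    next
      case False then show ?thesis using rl by (simp add: Y_def)
    qed
    consider "k = 1" | "k = 2" | "k = 3" using exhaust_3 by blast
    then show ?thesis
    proof cases
      case 1 show ?thesis unfolding 1 c_def truncate_shifted_nth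
        by (cases "i \<le> m"; cases "a \<le> i") (simp_all add: X_def rl rational_with_const)
    next
      case 2 show ?thesis unfolding 2 c_def truncate_shifted_nth
        by (cases "i \<le> m"; cases "b \<le> i") (simp_all add: rY rational_with_const)
    next
      case 3 show ?thesis unfolding 3 c_def truncate_shifted_nth
        by (cases "i \<le> m"; cases "1 \<le> i") (simp_all add: Z_def rl rational_with_const)
    qed
  qed
  moreover have "c 0 = \<gamma>" "c 1 = \<delta>"
    unfolding c_def Y0 Y1 unfolding X_def Z_def ends \<gamma> \<delta> by simp_all
  moreover have "poly D 0 \<noteq> 0" "poly D 1 \<noteq> 0" using u0 u1 by (simp_all add: D_def)
  ultimately show "\<exists>d c. poly d 0 \<noteq> 0 \<and> poly d 1 \<noteq> 0 \<and> c 0 = \<gamma> \<and> c 1 = \<delta> \<and>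
      (\<forall>t. poly d t \<noteq> 0 \<longrightarrow> c t \<in> ord_jets_open n m a b) \<and> (\<forall>k i. rational_with d (\<lambda>t. fps_nth (c t $ k) i))"
    by (intro exI[of _ D] exI[of _ c]) simp
qed

lemma ord_jets_open_dense:
  assumes C: "closedin (zariski_jets m) C" "ord_jets_open n m a b \<subseteq> C"
  shows "ord_jets n m a b \<subseteq> C"
proof
  fix \<gamma> assume g: "\<gamma> \<in> ord_jets n m a b"
  define x where "x = fps_shift a (\<gamma> $ 1)"
  define y where "y = fps_shift b (\<gamma> $ 2)"
  define z where "z = fps_shift 1 (\<gamma> $ 3)"
  have \<gamma>: "\<gamma> = truncate_arc m (shifted_arc a b x y z)"
    unfolding x_def y_def z_def by (rule ord_jets_shifted[OF g])
  have e: "\<And>j. j < m - n \<Longrightarrow> fps_nth (x * y) j = fps_nth (z ^ (n + 1)) j"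
    using g shifted_arc_ord_jets[OF ab, of x y z] unfolding \<gamma>[symmetric] by simp
  \<comment> \<open>The bound m + 1 for the approximated coefficients covers all that an
    \<open>m\<close>-jet sees.\<close>
  have le: "1 \<le> n + 1" "m - n \<le> m + 1" by simp_all
  obtain X Y Z where XYZ: "\<forall>k. fps_nth (X k) 0 \<noteq> 0" "\<forall>k. \<forall>j<m - n. fps_nth (X k * Y k) j = fps_nth (Z k ^ (n + 1)) j"
    "\<forall>i<m + 1. (\<lambda>k. fps_nth (X k) i) \<longlonglongrightarrow> fps_nth x i"
    "\<forall>i<m + 1. (\<lambda>k. fps_nth (Y k) i) \<longlonglongrightarrow> fps_nth y i"
    "\<forall>i. (\<lambda>k. fps_nth (Z k) i) \<longlonglongrightarrow> fps_nth z i"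
    using jet_unit_approximation[OF le e] by blast
  define c where "c k = truncate_arc m (shifted_arc a b (X k) (Y k) (Z k))" for k
  show "\<gamma> \<in> C"
  proof (rule zariski_closed_limit[OF C(1), of c])
    fix t
    have "c t \<in> ord_jets n m a b" unfolding c_def shifted_arc_ord_jets[OF ab] using XYZ(2) by blast
    moreover have "fps_nth (c t $ 1) a \<noteq> 0" using XYZ(1) a_le_m by (simp add: c_def truncate_shifted_nth)
    ultimately show "c t \<in> C" using C(2) by (auto simp: ord_jets_open_def)
  next
    show "\<gamma> \<in> affine_jets m" unfolding \<gamma> by (rule truncate_arc_in)
    fix k i
    show "(\<lambda>t. fps_nth (c t $ k) i) \<longlonglongrightarrow> fps_nth (\<gamma> $ k) i"
    proof -
      consider "k = 1" | "k = 2" | "k = 3" using exhaust_3 by blast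
      then show ?thesis
      proof cases
        case 1 then show ?thesis unfolding c_def \<gamma> 1 truncate_shifted_nth
          using XYZ(3) by (cases "i \<le> m \<and> a \<le> i") auto
      next
        case 2 then show ?thesis unfolding c_def \<gamma> 2 truncate_shifted_nth
          using XYZ(4) by (cases "i \<le> m \<and> b \<le> i") auto
      next
        case 3 then show ?thesis unfolding c_def \<gamma> 3 truncate_shifted_nth
          using XYZ(5) by (cases "i \<le> m \<and> 1 \<le> i") auto
      qed
    qed
  qed
qed

lemma irreducible_ord_jets: "irreducible_in (zariski_jets m) (ord_jets n m a b)"
proof (rule irreducible_in_dense[OF irreducible_ord_jets_open _ ord_jets_affine])
  show "ord_jets_open n m a b \<subseteq> ord_jets n m a b" by (auto simp: ord_jets_open_def)
qed (rule ord_jets_open_dense)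

end

definition jet_orders :: "nat \<Rightarrow> nat \<Rightarrow> (nat \<times> nat) set" where
  "jet_orders n m = {(a, b). 1 \<le> a \<and> 1 \<le> b \<and> a + b = min (m + 1) (n + 1)}"

lemma jets_at_origin_eq:
  assumes "1 \<le> m" "1 \<le> n"
  shows "jets_at_origin (A_poly n) m = (\<Union>(a, b)\<in>jet_orders n m. ord_jets n m a b)"
proof (intro equalityI subsetI)
  fix \<gamma> assume "\<gamma> \<in> (\<Union>(a, b)\<in>jet_orders n m. ord_jets n m a b)"
  then obtain a b where "1 \<le> a" "1 \<le> b" "\<gamma> \<in> ord_jets n m a b" by (auto simp: jet_orders_def)
  then show "\<gamma> \<in> jets_at_origin (A_poly n) m"
    by (auto simp: ord_jets_def jets_at_origin_def arc_center_def vec_eq_iff forall_3)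
next
  fix \<gamma> assume "\<gamma> \<in> jets_at_origin (A_poly n) m"
  then have j: "\<gamma> \<in> jets (A_poly n) m" and "arc_center \<gamma> = 0" by (auto simp: jets_at_origin_def)
  then have c: "fps_nth (\<gamma> $ 1) 0 = 0" "fps_nth (\<gamma> $ 2) 0 = 0" "fps_nth (\<gamma> $ 3) 0 = 0"
    by (auto simp: arc_center_def vec_eq_iff)
  define x where "x = \<gamma> $ 1"
  define y where "y = \<gamma> $ 2"
  define E where "E = min (m + 1) (n + 1)"
  have E2: "2 \<le> E" using assms by (simp add: E_def)
  have "\<gamma> $ 3 = fps_X * fps_shift 1 (\<gamma> $ 3)" using c(3) by (simp add: fps_eq_iff)
  then have z: "(\<gamma> $ 3) ^ (n + 1) = fps_X ^ (n + 1) * (fps_shift 1 (\<gamma> $ 3)) ^ (n + 1)"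
    by (metis power_mult_distrib)
  have xy: "fps_nth (x * y) j = 0" if "j < E" for j
  proof -
    have "fps_nth (compose_arc (A_poly n) \<gamma>) j = 0" using j that by (simp add: jets_def E_def)
    then have "fps_nth (x * y) j = fps_nth ((\<gamma> $ 3) ^ (n + 1)) j" by (simp add: compose_A_poly x_def y_def)
    also have "\<dots> = 0" unfolding z fps_X_power_mult_nth using that by (simp add: E_def)
    finally show ?thesis .
  qed
  \<comment> \<open>The cap E - 1 keeps \<open>b\<close> positive. It also serves for
    \<open>x = 0\<close>, whose subdegree would be 0 by convention.\<close>
  define a where "a = (if x = 0 then E - 1 else min (subdegree x) (E - 1))"
  define b where "b = E - a"
  have a: "1 \<le> a" "a \<le> E - 1"
  proof -
    have "x \<noteq> 0 \<Longrightarrow> subdegree x \<noteq> 0" by (metis c(1) nth_subdegree_nonzero x_def)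
    then show "1 \<le> a" "a \<le> E - 1" using E2 by (auto simp: a_def)
  qed
  then have ab: "(a, b) \<in> jet_orders n m" using E2 unfolding jet_orders_def b_def E_def by auto
  have "fps_nth x i = 0" if "i < a" for i
    using that by (cases "x = 0") (auto simp: a_def intro: nth_less_subdegree_zero)
  moreover have "fps_nth y i = 0" if i: "i < b" for i
  \<comment> \<open>If the cap is active, b = 1 and the condition on the centre suffices; otherwise
    \<open>a\<close> is the exact order of \<open>x\<close>, and the order of xy bounds that of
    \<open>y\<close>.\<close>
  proof (cases "x = 0 \<or> E - 1 < subdegree x")
    case True
    then have "b = 1" using E2 by (auto simp: b_def a_def)
    then show ?thesis using i c(2) by (simp add: y_def)
  next
    case False
    then have ax: "x \<noteq> 0" "a = subdegree x" by (auto simp: a_def)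
    show ?thesis
    proof (rule ccontr)
      assume "fps_nth y i \<noteq> 0"
      then have y: "y \<noteq> 0" "subdegree y \<le> i" by (auto intro: subdegree_leI)
      then have "subdegree (x * y) < E" using ax i a by (simp add: b_def)
      moreover have "x * y \<noteq> 0" using ax y by simp
      ultimately show False using xy nth_subdegree_nonzero by blast
    qed
  qed
  ultimately have "\<gamma> \<in> ord_jets n m a b" using j c(3) by (simp add: ord_jets_def x_def y_def)
  then show "\<gamma> \<in> (\<Union>(a, b)\<in>jet_orders n m. ord_jets n m a b)" using ab by blast
qed

lemma jet_component_iff:
  assumes "1 \<le> m" "1 \<le> n"
  shows "jet_component (A_poly n) m C \<longleftrightarrow> (\<exists>(a, b)\<in>jet_orders n m. C = ord_jets n m a b)"
proof -
  have "finite (jet_orders n m)"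
    by (rule finite_subset[of _ "{..n + 1} \<times> {..n + 1}"]) (auto simp: jet_orders_def)
  moreover have "i = j" if ij: "i \<in> jet_orders n m" "j \<in> jet_orders n m"
    "(case i of (a, b) \<Rightarrow> ord_jets n m a b) \<subseteq> (case j of (a, b) \<Rightarrow> ord_jets n m a b)" for i j
  proof -
    obtain a b a' b' where e: "i = (a, b)" "j = (a', b')" by fastforce
    have ab: "a + b = min (m + 1) (n + 1)" "1 \<le> a" "1 \<le> b" and ab': "a' + b' = min (m + 1) (n + 1)"
      using ij by (auto simp: e jet_orders_def)
    \<comment> \<open>The jet (t^a, t^b, t) has exactly these orders, so it tells the sets apart: an
      inclusion gives a' \<le> a and b' \<le> b, and the sums are equal.\<close>
    define \<gamma> where "\<gamma> = truncate_arc m (shifted_arc a b 1 1 1)"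
    have "\<gamma> \<in> ord_jets n m a b" unfolding \<gamma>_def by (subst shifted_arc_ord_jets[OF ab(1)]) simp
    then have g: "\<gamma> \<in> ord_jets n m a' b'" using ij by (auto simp: e)
    have "fps_nth (\<gamma> $ 1) a \<noteq> 0" "fps_nth (\<gamma> $ 2) b \<noteq> 0"
      using ab by (auto simp: \<gamma>_def truncate_shifted_nth)
    then have "a' \<le> a" "b' \<le> b" using g by (auto simp: ord_jets_def not_less[symmetric])
    then show ?thesis using ab ab' by (auto simp: e)
  qed
  moreover have "closedin (zariski_jets m) (case i of (a, b) \<Rightarrow> ord_jets n m a b)" for i
    by (cases i) (simp add: closedin_ord_jets)
  moreover have "irreducible_in (zariski_jets m) (case i of (a, b) \<Rightarrow> ord_jets n m a b)"
    if "i \<in> jet_orders n m" for i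
    using that by (cases i) (simp add: jet_orders_def irreducible_ord_jets)
  ultimately have "jet_component (A_poly n) m C \<longleftrightarrow>
      (\<exists>i\<in>jet_orders n m. C = (case i of (a, b) \<Rightarrow> ord_jets n m a b))"
    by (intro irreducible_components_cover jets_at_origin_eq assms) blast+
  moreover have "(\<exists>i\<in>jet_orders n m. C = (case i of (a, b) \<Rightarrow> ord_jets n m a b)) \<longleftrightarrow>
      (\<exists>(a, b)\<in>jet_orders n m. C = ord_jets n m a b)"
    by (rule bex_cong[OF refl]) (simp add: split_beta)
  ultimately show ?thesis by simp
qed

section \<open>Codimension\<close>

text \<open>Elimination: an equation with a nonzero coefficient removes one unknown, so the surplus
  of unknowns is preserved.\<close>

lemma homogeneous_system_solution:
  fixes c :: "'e \<Rightarrow> 'b \<Rightarrow> complex"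
  assumes "finite B" "finite E" "card B < card E"
  shows "\<exists>a. (\<exists>e\<in>E. a e \<noteq> 0) \<and> (\<forall>b\<in>B. (\<Sum>e\<in>E. a e * c e b) = 0)"
  using assms
proof (induct B arbitrary: E c)
  case empty
  then obtain e where "e \<in> E" by fastforce
  then show ?case by (intro exI[of _ "\<lambda>_. 1"]) auto
next
  case (insert b B)
  show ?case
  proof (cases "\<forall>e\<in>E. c e b = 0")
    case True
    have "card B < card E" using insert by simp
    then obtain a where "\<exists>e\<in>E. a e \<noteq> 0" "\<forall>b\<in>B. (\<Sum>e\<in>E. a e * c e b) = 0"
      using insert(3)[of E c] insert.prems(1) by blast
    then show ?thesis using True by (intro exI[of _ a]) simp
  next
    case False
    then obtain e0 where e0: "e0 \<in> E" "c e0 b \<noteq> 0" by blast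
    have "card B < card (E - {e0})" using insert e0 by simp
    then obtain a where a: "\<exists>e\<in>E - {e0}. a e \<noteq> 0"
      "\<And>b'. b' \<in> B \<Longrightarrow> (\<Sum>e\<in>E - {e0}. a e * (c e b' - c e b / c e0 b * c e0 b')) = 0"
      using insert(3)[of "E - {e0}" "\<lambda>e b'. c e b' - c e b / c e0 b * c e0 b'"] insert.prems(1) by blast
    \<comment> \<open>Up to sign, the value that the equation \<open>b\<close> prescribes for the
      eliminated unknown.\<close>
    define s where "s = (\<Sum>e\<in>E - {e0}. a e * c e b) / c e0 b"
    define a' where "a' e = (if e = e0 then - s else a e)" for e
    have split: "(\<Sum>e\<in>E. a' e * g e) = - s * g e0 + (\<Sum>e\<in>E - {e0}. a e * g e)" for g
    proof -
      have "(\<Sum>e\<in>E. a' e * g e) = a' e0 * g e0 + (\<Sum>e\<in>E - {e0}. a' e * g e)"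
        using e0 insert.prems(1) by (intro sum.remove) auto
      moreover have "(\<Sum>e\<in>E - {e0}. a' e * g e) = (\<Sum>e\<in>E - {e0}. a e * g e)"
        by (intro sum.cong) (auto simp: a'_def)
      ultimately show ?thesis by (simp add: a'_def)
    qed
    have "(\<Sum>e\<in>E. a' e * c e b') = 0" if "b' \<in> insert b B" for b'
    proof (cases "b' = b")
      case True then show ?thesis using e0 by (simp add: split s_def)
    next
      case False
      then have "(\<Sum>e\<in>E - {e0}. a e * c e b') - (\<Sum>e\<in>E - {e0}. a e * (c e b / c e0 b * c e0 b')) = 0"
        using a(2)[of b'] that by (simp add: sum_subtractf right_diff_distrib)
      moreover have "(\<Sum>e\<in>E - {e0}. a e * (c e b / c e0 b * c e0 b')) = s * c e0 b'"
        by (simp add: s_def sum_divide_distrib sum_distrib_right) (simp add: field_simps)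
      ultimately show ?thesis by (simp add: split)
    qed
    moreover have "\<exists>e\<in>E. a' e \<noteq> 0" using a(1) by (auto simp: a'_def)
    ultimately show ?thesis by blast
  qed
qed

section \<open>Degrees of functions on the space of jets\<close>

definition jet_vars :: "nat \<Rightarrow> (3 \<times> nat) set" where
  "jet_vars m = UNIV \<times> {..m}"

definition jet_monomial :: "nat \<Rightarrow> (3 \<times> nat \<Rightarrow> nat) \<Rightarrow> arc \<Rightarrow> complex" where
  "jet_monomial m \<mu> \<gamma> = (\<Prod>v\<in>jet_vars m. fps_nth (\<gamma> $ fst v) (snd v) ^ \<mu> v)"

text \<open>Degrees are bounded in each variable separately, so the number of monomials is a pure
  power of \<open>D + 1\<close>.\<close>

definition exponents :: "nat \<Rightarrow> nat \<Rightarrow> (3 \<times> nat \<Rightarrow> nat) set" where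
  "exponents m D = jet_vars m \<rightarrow>\<^sub>E {..D}"

definition degree_at_most :: "nat \<Rightarrow> nat \<Rightarrow> (arc \<Rightarrow> complex) \<Rightarrow> bool" where
  "degree_at_most m D \<phi> \<longleftrightarrow> (\<exists>a. \<forall>\<gamma>\<in>affine_jets m. \<phi> \<gamma> = (\<Sum>\<mu>\<in>exponents m D. a \<mu> * jet_monomial m \<mu> \<gamma>))"

lemma finite_jet_vars: "finite (jet_vars m)"
  by (simp add: jet_vars_def)

lemma finite_exponents: "finite (exponents m D)"
  by (simp add: exponents_def finite_PiE finite_jet_vars)

lemma card_exponents: "card (exponents m D) = (D + 1) ^ (3 * (m + 1))"
  by (simp add: exponents_def card_PiE finite_jet_vars) (simp add: jet_vars_def card_cartesian_product)

lemma degree_at_mostI: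
  assumes "finite S" "\<And>s. s \<in> S \<Longrightarrow> g s \<in> exponents m D"
    and eq: "\<And>\<gamma>. \<gamma> \<in> affine_jets m \<Longrightarrow> \<phi> \<gamma> = (\<Sum>s\<in>S. a s * jet_monomial m (g s) \<gamma>)"
  shows "degree_at_most m D \<phi>"
  unfolding degree_at_most_def
proof (intro exI ballI)
  fix \<gamma> assume "\<gamma> \<in> affine_jets m"
  then have "\<phi> \<gamma> = (\<Sum>s\<in>S. a s * jet_monomial m (g s) \<gamma>)" by (rule eq)
  also have "\<dots> = (\<Sum>\<mu>\<in>exponents m D. \<Sum>s\<in>{s \<in> S. g s = \<mu>}. a s * jet_monomial m (g s) \<gamma>)"
    using assms(1,2) finite_exponents by (intro sum.group[symmetric]) auto
  also have "\<dots> = (\<Sum>\<mu>\<in>exponents m D. (\<Sum>s\<in>{s \<in> S. g s = \<mu>}. a s) * jet_monomial m \<mu> \<gamma>)"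
    by (intro sum.cong refl) (simp add: sum_distrib_right)
  finally show "\<phi> \<gamma> = (\<Sum>\<mu>\<in>exponents m D. (\<Sum>s\<in>{s \<in> S. g s = \<mu>}. a s) * jet_monomial m \<mu> \<gamma>)" .
qed

lemma degree_at_most_mono:
  assumes "degree_at_most m D \<phi>" "D \<le> D'"
  shows "degree_at_most m D' \<phi>"
proof -
  obtain a where "\<And>\<gamma>. \<gamma> \<in> affine_jets m \<Longrightarrow> \<phi> \<gamma> = (\<Sum>\<mu>\<in>exponents m D. a \<mu> * jet_monomial m \<mu> \<gamma>)"
    using assms(1) by (auto simp: degree_at_most_def)
  moreover have "exponents m D \<subseteq> exponents m D'"
    unfolding exponents_def using assms(2) by (intro PiE_mono) auto
  ultimately show ?thesis
    by (intro degree_at_mostI[OF finite_exponents, where g = "\<lambda>\<mu>. \<mu>" and a = a]) auto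
qed

lemma degree_at_most_const: "degree_at_most m D (\<lambda>\<gamma>. c)"
  by (rule degree_at_mostI[of "{()}" "\<lambda>_. restrict (\<lambda>_. 0) (jet_vars m)" _ _ _ "\<lambda>_. c"])
     (auto simp: exponents_def jet_monomial_def)

lemma degree_at_most_coord: "degree_at_most m 1 (\<lambda>\<gamma>. fps_nth (\<gamma> $ k) i)"
proof (cases "i \<le> m")
  case True
  have "jet_monomial m (restrict (\<lambda>v. if v = (k, i) then 1 else 0) (jet_vars m)) \<gamma> = fps_nth (\<gamma> $ k) i" for \<gamma>
  proof -
    have "jet_monomial m (restrict (\<lambda>v. if v = (k, i) then 1 else 0) (jet_vars m)) \<gamma>
        = (\<Prod>v\<in>jet_vars m. if v = (k, i) then fps_nth (\<gamma> $ k) i else 1)"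
      unfolding jet_monomial_def by (intro prod.cong) auto
    then show ?thesis using True by (simp add: finite_jet_vars) (simp add: jet_vars_def)
  qed
  then show ?thesis
    by (intro degree_at_mostI[of "{()}" "\<lambda>_. restrict (\<lambda>v. if v = (k, i) then 1 else 0) (jet_vars m)" _ _ _ "\<lambda>_. 1"])
       (auto simp: exponents_def)
next
  case False
  then have "fps_nth (\<gamma> $ k) i = 0" if "\<gamma> \<in> affine_jets m" for \<gamma>
    using that by (simp add: affine_jets_iff)
  then show ?thesis using degree_at_most_const[of m 1 0] by (simp add: degree_at_most_def)
qed

lemma degree_at_most_add:
  assumes "degree_at_most m D \<phi>" "degree_at_most m D \<psi>"
  shows "degree_at_most m D (\<lambda>\<gamma>. \<phi> \<gamma> + \<psi> \<gamma>)"
proof -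
  obtain a b where "\<And>\<gamma>. \<gamma> \<in> affine_jets m \<Longrightarrow> \<phi> \<gamma> = (\<Sum>\<mu>\<in>exponents m D. a \<mu> * jet_monomial m \<mu> \<gamma>)"
    "\<And>\<gamma>. \<gamma> \<in> affine_jets m \<Longrightarrow> \<psi> \<gamma> = (\<Sum>\<mu>\<in>exponents m D. b \<mu> * jet_monomial m \<mu> \<gamma>)"
    using assms by (auto simp: degree_at_most_def)
  then show ?thesis
    by (intro degree_at_mostI[OF finite_exponents, where g = "\<lambda>\<mu>. \<mu>" and a = "\<lambda>\<mu>. a \<mu> + b \<mu>"])
       (auto simp: sum.distrib distrib_right)
qed

lemma degree_at_most_mult:
  assumes "degree_at_most m D \<phi>" "degree_at_most m D' \<psi>"
  shows "degree_at_most m (D + D') (\<lambda>\<gamma>. \<phi> \<gamma> * \<psi> \<gamma>)"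
proof -
  obtain a b where ab: "\<And>\<gamma>. \<gamma> \<in> affine_jets m \<Longrightarrow> \<phi> \<gamma> = (\<Sum>\<mu>\<in>exponents m D. a \<mu> * jet_monomial m \<mu> \<gamma>)"
    "\<And>\<gamma>. \<gamma> \<in> affine_jets m \<Longrightarrow> \<psi> \<gamma> = (\<Sum>\<mu>\<in>exponents m D'. b \<mu> * jet_monomial m \<mu> \<gamma>)"
    using assms by (auto simp: degree_at_most_def)
  define g where "g s = restrict (\<lambda>v. fst s v + snd s v) (jet_vars m)" for s :: "(3 \<times> nat \<Rightarrow> nat) \<times> (3 \<times> nat \<Rightarrow> nat)"
  show ?thesis
  proof (rule degree_at_mostI[where S = "exponents m D \<times> exponents m D'" and g = g and a = "\<lambda>s. a (fst s) * b (snd s)"])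
    show "finite (exponents m D \<times> exponents m D')" by (simp add: finite_exponents)
    fix s assume "s \<in> exponents m D \<times> exponents m D'"
    then show "g s \<in> exponents m (D + D')"
      by (auto simp: exponents_def g_def PiE_iff mem_Times_iff intro!: add_mono)
  next
    fix \<gamma> assume g: "\<gamma> \<in> affine_jets m"
    have m: "jet_monomial m (g s) \<gamma> = jet_monomial m (fst s) \<gamma> * jet_monomial m (snd s) \<gamma>" for s
      unfolding jet_monomial_def g_def prod.distrib[symmetric] by (intro prod.cong) (auto simp: power_add)
    show "\<phi> \<gamma> * \<psi> \<gamma> = (\<Sum>s\<in>exponents m D \<times> exponents m D'. a (fst s) * b (snd s) * jet_monomial m (g s) \<gamma>)"
      unfolding ab(1)[OF g] ab(2)[OF g] sum_product sum.cartesian_product m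
      by (intro sum.cong) (auto simp: algebra_simps)
  qed
qed

lemma degree_at_most_power: "degree_at_most m D \<phi> \<Longrightarrow> degree_at_most m (r * D) (\<lambda>\<gamma>. \<phi> \<gamma> ^ r)"
proof (induct r)
  case 0 then show ?case by (simp add: degree_at_most_const)
next
  case (Suc r)
  then show ?case using degree_at_most_mult[of m D \<phi> "r * D" "\<lambda>\<gamma>. \<phi> \<gamma> ^ r"] by simp
qed

lemma arc_ring_degree: "\<phi> \<in> arc_ring \<Longrightarrow> \<exists>D. degree_at_most m D \<phi>"
proof (induct rule: arc_ring.induct)
  case (3 \<phi> \<psi>)
  then obtain D D' where "degree_at_most m D \<phi>" "degree_at_most m D' \<psi>" by blast
  then have "degree_at_most m (max D D') \<phi>" "degree_at_most m (max D D') \<psi>"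
    by (auto intro: degree_at_most_mono)
  then show ?case using degree_at_most_add by blast
qed (use degree_at_most_const degree_at_most_coord degree_at_most_mult in blast)+

section \<open>Lengths of chains of irreducible closed sets\<close>

lemma arc_ring_power: "\<phi> \<in> arc_ring \<Longrightarrow> (\<lambda>\<gamma>. \<phi> \<gamma> ^ r) \<in> arc_ring"
  by (induct r) (auto intro: arc_ring.intros)

text \<open>The list is indexed from its end: the head is the exponent of the function with the
  highest index, so that removing it goes one step down the chain.\<close>

fun chain_monomial :: "(nat \<Rightarrow> arc \<Rightarrow> complex) \<Rightarrow> nat list \<Rightarrow> arc \<Rightarrow> complex" where
  "chain_monomial f [] \<gamma> = 1"
| "chain_monomial f (r # rs) \<gamma> = f (length rs) \<gamma> ^ r * chain_monomial f rs \<gamma>"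

definition bounded_lists :: "nat \<Rightarrow> nat \<Rightarrow> nat list set" where
  "bounded_lists T j = {xs. set xs \<subseteq> {..T} \<and> length xs = j}"

lemma finite_bounded_lists: "finite (bounded_lists T j)"
  unfolding bounded_lists_def by (rule finite_lists_length_eq) simp

lemma card_bounded_lists: "card (bounded_lists T j) = (T + 1) ^ j"
  unfolding bounded_lists_def by (subst card_lists_length_eq) auto

lemma sum_bounded_lists_Suc:
  "(\<Sum>xs\<in>bounded_lists T (Suc j). h xs) = (\<Sum>r\<le>T. \<Sum>rs\<in>bounded_lists T j. h (r # rs))"
proof -
  let ?g = "\<lambda>p :: nat \<times> nat list. fst p # snd p"
  have eq: "bounded_lists T (Suc j) = ?g ` ({..T} \<times> bounded_lists T j)"
    by (auto simp: bounded_lists_def length_Suc_conv image_iff)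
  have inj: "inj_on ?g ({..T} \<times> bounded_lists T j)" by (auto simp: inj_on_def prod_eq_iff)
  show ?thesis
    unfolding eq sum.reindex[OF inj] sum.cartesian_product by (simp add: split_beta)
qed

lemma arc_ring_chain_monomial: "(\<And>i. f i \<in> arc_ring) \<Longrightarrow> (\<lambda>\<gamma>. chain_monomial f xs \<gamma>) \<in> arc_ring"
proof (induct xs)
  case Nil then show ?case using arc_ring.intros(1)[of 1] by simp
next
  case (Cons r rs)
  then show ?case unfolding chain_monomial.simps by (intro arc_ring.intros(4) arc_ring_power) simp_all
qed

lemma degree_chain_monomial:
  assumes "\<And>i. i < length xs \<Longrightarrow> degree_at_most m D (f i)" "set xs \<subseteq> {..T}"
  shows "degree_at_most m (length xs * (T * D)) (chain_monomial f xs)"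
  using assms
proof (induct xs)
  case Nil then show ?case by (simp add: degree_at_most_const)
next
  case (Cons r rs)
  have "degree_at_most m (r * D) (\<lambda>\<gamma>. f (length rs) \<gamma> ^ r)" using Cons.prems(1) by (intro degree_at_most_power) simp
  then have "degree_at_most m (T * D) (\<lambda>\<gamma>. f (length rs) \<gamma> ^ r)"
    by (rule degree_at_most_mono) (use Cons.prems(2) in simp)
  moreover have "degree_at_most m (length rs * (T * D)) (chain_monomial f rs)" using Cons by simp
  ultimately show ?case using degree_at_most_mult by fastforce
qed

text \<open>If \<open>f i\<close> vanishes on the \<open>i\<close>-th member of a chain but not on the next one, then
  \<open>f 0, \<dots>, f (j - 1)\<close> are algebraically independent on the \<open>j\<close>-th member.\<close>

lemma chain_monomials_independent:
  assumes irr: "\<And>i. i \<le> k \<Longrightarrow> irreducible_in (zariski_jets m) (c i)"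
    and sub: "\<And>i. i < k \<Longrightarrow> c i \<subseteq> c (Suc i)"
    and f: "\<And>i. f i \<in> arc_ring" "\<And>i \<gamma>. i < k \<Longrightarrow> \<gamma> \<in> c i \<Longrightarrow> f i \<gamma> = 0"
      "\<And>i. i < k \<Longrightarrow> \<exists>\<gamma>\<in>c (Suc i). f i \<gamma> \<noteq> 0"
    and jk: "j \<le> k" and rel: "\<And>\<gamma>. \<gamma> \<in> c j \<Longrightarrow> (\<Sum>xs\<in>bounded_lists T j. a xs * chain_monomial f xs \<gamma>) = 0"
    and xs: "xs \<in> bounded_lists T j"
  shows "a xs = 0"
  using jk rel xs
proof (induct j arbitrary: a xs)
  case 0
  obtain \<gamma> where "\<gamma> \<in> c 0" using irr[of 0] by (auto simp: irreducible_in_def)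
  moreover have "bounded_lists T 0 = {[]}" by (auto simp: bounded_lists_def)
  ultimately show ?case using "0.prems"(2)[of \<gamma>] "0.prems"(3) by simp
next
  case (Suc j)
  have jk: "j < k" "j \<le> k" using Suc.prems(1) by auto
  define G where "G r \<gamma> = (\<Sum>rs\<in>bounded_lists T j. a (r # rs) * chain_monomial f rs \<gamma>)" for r \<gamma>
  have len: "rs \<in> bounded_lists T j \<Longrightarrow> length rs = j" for rs by (simp add: bounded_lists_def)
  have Gring: "G r \<in> arc_ring" for r
    unfolding G_def by (intro arc_ring_sum arc_ring.intros(4) arc_ring.intros(1) arc_ring_chain_monomial f(1))
  have rel: "(\<Sum>r\<le>T. f j \<gamma> ^ r * G r \<gamma>) = 0" if "\<gamma> \<in> c (Suc j)" for \<gamma>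
  proof -
    have "(\<Sum>r\<le>T. f j \<gamma> ^ r * G r \<gamma>) = (\<Sum>xs\<in>bounded_lists T (Suc j). a xs * chain_monomial f xs \<gamma>)"
      unfolding sum_bounded_lists_Suc G_def sum_distrib_left
      by (intro sum.cong refl) (simp add: len algebra_simps)
    then show ?thesis using Suc.prems(2)[OF that] by simp
  qed
  have zero: "a (r # rs) = 0" if "r \<le> T" "rs \<in> bounded_lists T j" for r rs
    using that
  proof (induct r arbitrary: rs rule: less_induct)
    case (less r)
    \<comment> \<open>The relation divided by the \<open>r\<close>-th power of \<open>f j\<close>;
      the lower terms are already zero. The vanishing ideal of the larger set is prime and does not
      contain \<open>f j\<close>, so \<open>H\<close> vanishes there; on the smaller set
      \<open>f j\<close> is zero, so only the term \<open>G r\<close> remains.\<close>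
    define H where "H \<gamma> = (\<Sum>s\<in>{r..T}. f j \<gamma> ^ (s - r) * G s \<gamma>)" for \<gamma>
    have Hring: "H \<in> arc_ring"
      unfolding H_def by (intro arc_ring_sum arc_ring.intros(4) arc_ring_power f(1)) (use Gring in \<open>simp add: eta_contract_eq\<close>)
    have G0: "G s \<gamma> = 0" if "s < r" for s \<gamma>
      unfolding G_def using less(1)[OF that] that less.prems(1) by (intro sum.neutral) auto
    have "f j \<gamma> ^ r * H \<gamma> = 0" if "\<gamma> \<in> c (Suc j)" for \<gamma>
    proof -
      have "f j \<gamma> ^ r * H \<gamma> = (\<Sum>s\<in>{r..T}. f j \<gamma> ^ s * G s \<gamma>)"
        unfolding H_def sum_distrib_left by (intro sum.cong refl) (simp add: power_add[symmetric] mult.assoc[symmetric])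
      also have "\<dots> = (\<Sum>s\<le>T. f j \<gamma> ^ s * G s \<gamma>)"
        by (intro sum.mono_neutral_left) (auto simp: G0)
      finally show ?thesis using rel[OF that] by simp
    qed
    then have pr: "\<forall>\<gamma>\<in>c (Suc j). f j \<gamma> ^ r * H \<gamma> = 0" by blast
    have dom: "\<forall>\<phi>\<in>arc_ring. \<forall>\<psi>\<in>arc_ring. (\<forall>\<gamma>\<in>c (Suc j). \<phi> \<gamma> * \<psi> \<gamma> = 0) \<longrightarrow>
        (\<forall>\<gamma>\<in>c (Suc j). \<phi> \<gamma> = 0) \<or> (\<forall>\<gamma>\<in>c (Suc j). \<psi> \<gamma> = 0)"
      using irr[OF Suc.prems(1)] unfolding irreducible_in_zariski by blast
    have "(\<forall>\<gamma>\<in>c (Suc j). f j \<gamma> ^ r = 0) \<or> (\<forall>\<gamma>\<in>c (Suc j). H \<gamma> = 0)"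
      using dom[rule_format, OF arc_ring_power[OF f(1)[of j], of r] Hring] pr by blast
    then have H0: "H \<gamma> = 0" if "\<gamma> \<in> c (Suc j)" for \<gamma>
      using f(3)[OF jk(1)] that by fastforce
    have "G r \<gamma> = 0" if g: "\<gamma> \<in> c j" for \<gamma>
    proof -
      have "H \<gamma> = (\<Sum>s\<in>{r..T}. if s = r then G r \<gamma> else 0)"
        unfolding H_def using f(2)[OF jk(1) g] by (intro sum.cong refl) (auto simp: power_0_left)
      then have "H \<gamma> = G r \<gamma>" using less.prems(1) by simp
      then show ?thesis using H0 sub[OF jk(1)] g by auto
    qed
    then show ?case using Suc.hyps[OF jk(2), of "\<lambda>rs. a (r # rs)" rs] less.prems(2) by (simp add: G_def)
  qed
  obtain r rs where "xs = r # rs" "r \<le> T" "rs \<in> bounded_lists T j"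
    using Suc.prems(3) by (auto simp: bounded_lists_def length_Suc_conv)
  then show ?case using zero by simp
qed

text \<open>The dimension bound by counting, with M = 3 (m + 1) variables. M + 1 algebraically
  independent functions have (T + 1)^(M + 1) products with exponents at most T, but these lie in the
  span of (B + 1)^M monomials with B linear in T; for large T this enforces a linear
  relation.\<close>

lemma irreducible_chain_length:
  assumes irr: "\<And>i. i \<le> k \<Longrightarrow> closedin (zariski_jets m) (c i) \<and> irreducible_in (zariski_jets m) (c i)"
    and sub: "\<And>i. i < k \<Longrightarrow> c i \<subset> c (Suc i)"
  shows "k \<le> 3 * (m + 1)"
proof (rule ccontr)
  assume "\<not> k \<le> 3 * (m + 1)"
  define M where "M = 3 * (m + 1)"
  have Mk: "Suc M \<le> k" using \<open>\<not> k \<le> 3 * (m + 1)\<close> by (simp add: M_def)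
  have aff: "c i \<subseteq> affine_jets m" if "i \<le> k" for i using irr[OF that] by (auto simp: irreducible_in_def)
  have "\<exists>\<phi>\<in>arc_ring. (\<forall>\<gamma>\<in>c i. \<phi> \<gamma> = 0) \<and> (\<exists>\<gamma>\<in>c (Suc i). \<phi> \<gamma> \<noteq> 0)" if i: "i < k" for i
  proof -
    obtain x where x: "x \<in> c (Suc i)" "x \<notin> c i" using sub[OF i] by blast
    then have "x \<in> affine_jets m" using aff[of "Suc i"] i by auto
    then show ?thesis using closedin_zariski_separate[of m "c i" x] irr[of i] i x by auto
  qed
  then have "\<exists>\<phi>\<in>arc_ring. i < k \<longrightarrow> (\<forall>\<gamma>\<in>c i. \<phi> \<gamma> = 0) \<and> (\<exists>\<gamma>\<in>c (Suc i). \<phi> \<gamma> \<noteq> 0)" for i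
    using arc_ring.intros(1) by (cases "i < k") blast+
  then obtain f where f: "\<And>i. f i \<in> arc_ring"
    "\<And>i. i < k \<Longrightarrow> (\<forall>\<gamma>\<in>c i. f i \<gamma> = 0) \<and> (\<exists>\<gamma>\<in>c (Suc i). f i \<gamma> \<noteq> 0)" by metis
  obtain D where D: "\<And>i. degree_at_most m (D i) (f i)" using arc_ring_degree[OF f(1)] by metis
  define d where "d = (\<Sum>i<Suc M. D i)"
  have deg: "degree_at_most m d (f i)" if "i < Suc M" for i
    using D[of i] by (rule degree_at_most_mono) (unfold d_def, rule member_le_sum, use that in auto)
  \<comment> \<open>Since B + 1 \<le> q (T + 1), the choice T = q^M absorbs the constant factor
    q^M.\<close>
  define q where "q = Suc M * d + 1"
  define T where "T = q ^ M"
  define B where "B = Suc M * (T * d)"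
  have "(B + 1) ^ M < (T + 1) ^ Suc M"
  proof -
    have "B + 1 \<le> q * (T + 1)" by (simp add: B_def q_def algebra_simps)
    then have "(B + 1) ^ M \<le> (q * (T + 1)) ^ M" by (rule power_mono) simp
    also have "\<dots> = T * (T + 1) ^ M" unfolding T_def by (rule power_mult_distrib)
    also have "\<dots> < (T + 1) ^ Suc M" by simp
    finally show ?thesis .
  qed
  then have card: "card (exponents m B) < card (bounded_lists T (Suc M))"
    by (simp only: card_exponents card_bounded_lists M_def)
  have "\<exists>b. \<forall>\<gamma>\<in>affine_jets m. chain_monomial f xs \<gamma> = (\<Sum>\<mu>\<in>exponents m B. b \<mu> * jet_monomial m \<mu> \<gamma>)"
    if "xs \<in> bounded_lists T (Suc M)" for xs
    using degree_chain_monomial[of xs m d f T] that deg by (auto simp: bounded_lists_def degree_at_most_def B_def)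
  then obtain b where b: "\<And>xs \<gamma>. xs \<in> bounded_lists T (Suc M) \<Longrightarrow> \<gamma> \<in> affine_jets m \<Longrightarrow>
      chain_monomial f xs \<gamma> = (\<Sum>\<mu>\<in>exponents m B. b xs \<mu> * jet_monomial m \<mu> \<gamma>)" by metis
  obtain a where a: "\<exists>xs\<in>bounded_lists T (Suc M). a xs \<noteq> 0"
    "\<And>\<mu>. \<mu> \<in> exponents m B \<Longrightarrow> (\<Sum>xs\<in>bounded_lists T (Suc M). a xs * b xs \<mu>) = 0"
    using homogeneous_system_solution[OF finite_exponents finite_bounded_lists card, of b] by blast
  have rel: "(\<Sum>xs\<in>bounded_lists T (Suc M). a xs * chain_monomial f xs \<gamma>) = 0" if "\<gamma> \<in> affine_jets m" for \<gamma>
  proof -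
    have "(\<Sum>xs\<in>bounded_lists T (Suc M). a xs * chain_monomial f xs \<gamma>) =
        (\<Sum>xs\<in>bounded_lists T (Suc M). \<Sum>\<mu>\<in>exponents m B. a xs * b xs \<mu> * jet_monomial m \<mu> \<gamma>)"
      by (intro sum.cong refl) (simp add: b[OF _ that] sum_distrib_left mult.assoc)
    also have "\<dots> = (\<Sum>\<mu>\<in>exponents m B. \<Sum>xs\<in>bounded_lists T (Suc M). a xs * b xs \<mu> * jet_monomial m \<mu> \<gamma>)"
      by (rule sum.swap)
    also have "\<dots> = (\<Sum>\<mu>\<in>exponents m B. (\<Sum>xs\<in>bounded_lists T (Suc M). a xs * b xs \<mu>) * jet_monomial m \<mu> \<gamma>)"
      by (simp add: sum_distrib_right)
    also have "\<dots> = 0" using a(2) by (intro sum.neutral) simp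
    finally show ?thesis .
  qed
  have "a xs = 0" if "xs \<in> bounded_lists T (Suc M)" for xs
  proof (rule chain_monomials_independent[where k = k and m = m and c = c and f = f and j = "Suc M" and T = T])
    show "irreducible_in (zariski_jets m) (c i)" if "i \<le> k" for i using irr that by blast
    show "c i \<subseteq> c (Suc i)" if "i < k" for i using sub that by blast
    show "f i \<in> arc_ring" for i by (rule f(1))
    show "f i \<gamma> = 0" if "i < k" "\<gamma> \<in> c i" for i \<gamma> using f(2) that by blast
    show "\<exists>\<gamma>\<in>c (Suc i). f i \<gamma> \<noteq> 0" if "i < k" for i using f(2) that by blast
    show "(\<Sum>xs\<in>bounded_lists T (Suc M). a xs * chain_monomial f xs \<gamma>) = 0" if "\<gamma> \<in> c (Suc M)" for \<gamma>
      using rel aff[OF Mk] that by blast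
  qed (use Mk that in auto)
  then show False using a(1) by blast
qed

subsection \<open>Codimension and truncation\<close>

definition jet_preimage :: "nat \<Rightarrow> arc set \<Rightarrow> arc set" where
  "jet_preimage m S = {\<gamma> \<in> affine_jets (Suc m). truncate_arc m \<gamma> \<in> S}"

lemma arc_ring_substitute:
  assumes "\<phi> \<in> arc_ring" "\<And>k i. (\<lambda>\<gamma>. fps_nth (s \<gamma> $ k) i) \<in> arc_ring"
  shows "(\<lambda>\<gamma>. \<phi> (s \<gamma>)) \<in> arc_ring"
  using assms(1) by induct (auto intro: arc_ring.intros assms(2))

lemma closedin_jet_preimage:
  assumes "closedin (zariski_jets m) S"
  shows "closedin (zariski_jets (Suc m)) (jet_preimage m S)"
proof -
  define \<Phi> where "\<Phi> = (\<lambda>\<phi> \<gamma>. \<phi> (truncate_arc m \<gamma>)) ` {\<phi> \<in> arc_ring. \<forall>\<gamma>\<in>S. \<phi> \<gamma> = 0}"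
  have "(\<lambda>\<gamma>. fps_nth (truncate_arc m \<gamma> $ k) i) \<in> arc_ring" for k i
    unfolding truncate_arc_nth by (cases "i \<le> m") (auto intro: arc_ring.intros)
  then have "\<Phi> \<subseteq> arc_ring" unfolding \<Phi>_def by (auto intro: arc_ring_substitute)
  moreover have "jet_preimage m S = {\<gamma> \<in> affine_jets (Suc m). \<forall>\<phi>\<in>\<Phi>. \<phi> \<gamma> = 0}"
  proof (intro equalityI subsetI)
    fix \<gamma> assume "\<gamma> \<in> {\<gamma> \<in> affine_jets (Suc m). \<forall>\<phi>\<in>\<Phi>. \<phi> \<gamma> = 0}"
    then have g: "\<gamma> \<in> affine_jets (Suc m)" "\<And>\<phi>. \<phi> \<in> arc_ring \<Longrightarrow> \<forall>\<gamma>\<in>S. \<phi> \<gamma> = 0 \<Longrightarrow> \<phi> (truncate_arc m \<gamma>) = 0"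
      by (auto simp: \<Phi>_def)
    have "truncate_arc m \<gamma> \<in> S"
      using closedin_zariski_separate[OF assms truncate_arc_in] g(2) by blast
    then show "\<gamma> \<in> jet_preimage m S" using g(1) by (simp add: jet_preimage_def)
  qed (auto simp: jet_preimage_def \<Phi>_def)
  ultimately show ?thesis using closedin_zariski_zeros[of \<Phi> "Suc m"] by simp
qed

lemma irreducible_jet_fibre:
  assumes "s \<in> affine_jets m"
  shows "irreducible_in (zariski_jets (Suc m)) (jet_preimage m {s})"
proof (rule irreducible_in_rational_curves)
  show "jet_preimage m {s} \<subseteq> affine_jets (Suc m)" by (auto simp: jet_preimage_def)
  have "s \<in> affine_jets (Suc m)" using assms by (auto simp: affine_jets_iff)
  then show "jet_preimage m {s} \<noteq> {}" using truncate_arc_id[OF assms] by (auto simp: jet_preimage_def)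
next
  fix \<gamma> \<delta> assume g: "\<gamma> \<in> jet_preimage m {s}" and d: "\<delta> \<in> jet_preimage m {s}"
  define c :: "complex \<Rightarrow> arc" where "c t = (\<chi> k. fps_const (1 - t) * \<gamma> $ k + fps_const t * \<delta> $ k)" for t
  have cn: "fps_nth (c t $ k) i = (1 - t) * fps_nth (\<gamma> $ k) i + t * fps_nth (\<delta> $ k) i" for t k i
    by (simp add: c_def)
  have eq: "fps_nth (\<gamma> $ k) i = fps_nth (s $ k) i" "fps_nth (\<delta> $ k) i = fps_nth (s $ k) i" if "i \<le> m" for k i
    using g d that truncate_arc_nth[of m \<gamma> k i] truncate_arc_nth[of m \<delta> k i] by (auto simp: jet_preimage_def)
  have "truncate_arc m (c t) = s" for t
  proof (rule arc_eqI)
    fix k i show "fps_nth (truncate_arc m (c t) $ k) i = fps_nth (s $ k) i"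
      using assms eq[of i k] by (auto simp: truncate_arc_nth cn affine_jets_iff algebra_simps)
  qed
  then have "c t \<in> jet_preimage m {s}" for t
    using g d by (auto simp: jet_preimage_def affine_jets_iff cn)
  moreover have "c 0 = \<gamma>" "c 1 = \<delta>" by (auto intro!: arc_eqI simp: cn)
  moreover have "rational_with 1 (\<lambda>t. fps_nth (c t $ k) i)" for k i
    unfolding cn by (rule rational_with_affine)
  ultimately show "\<exists>d c. poly d 0 \<noteq> 0 \<and> poly d 1 \<noteq> 0 \<and> c 0 = \<gamma> \<and> c 1 = \<delta> \<and>
      (\<forall>t. poly d t \<noteq> 0 \<longrightarrow> c t \<in> jet_preimage m {s}) \<and> (\<forall>k i. rational_with d (\<lambda>t. fps_nth (c t $ k) i))"
    by (intro exI[of _ 1] exI[of _ c]) simp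
qed

text \<open>Two points of the preimage may have different base points. Keeping their top
  coefficients and varying the base point gives two functions on \<open>S\<close>, neither of them
  zero. Irreducibility of \<open>S\<close> yields a common base point where both are nonzero, and
  the fibre over it is irreducible.\<close>

lemma irreducible_jet_preimage:
  assumes S: "irreducible_in (zariski_jets m) S"
  shows "irreducible_in (zariski_jets (Suc m)) (jet_preimage m S)"
  unfolding irreducible_in_zariski
proof (intro conjI ballI impI)
  have aff: "S \<subseteq> affine_jets m" "S \<noteq> {}" using S by (auto simp: irreducible_in_def)
  then obtain s where s: "s \<in> S" by blast
  then have "s \<in> affine_jets (Suc m)" "truncate_arc m s = s"
    using aff truncate_arc_id by (auto simp: affine_jets_iff)
  then show "jet_preimage m S \<noteq> {}" using s by (auto simp: jet_preimage_def)
  show "jet_preimage m S \<subseteq> affine_jets (Suc m)" by (auto simp: jet_preimage_def)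
  fix \<phi> \<psi> assume \<phi>: "\<phi> \<in> arc_ring" and \<psi>: "\<psi> \<in> arc_ring" and prod: "\<forall>\<gamma>\<in>jet_preimage m S. \<phi> \<gamma> * \<psi> \<gamma> = 0"
  define lift :: "arc \<Rightarrow> arc \<Rightarrow> arc" where "lift \<gamma> s = s + (\<gamma> - truncate_arc m \<gamma>)" for \<gamma> s
  have lift_ring: "(\<lambda>s. fps_nth (lift \<gamma> s $ k) i) \<in> arc_ring" for \<gamma> k i
    unfolding lift_def vector_add_component fps_add_nth by (intro arc_ring.intros)
  have lift_in: "lift \<gamma> s \<in> jet_preimage m {s}" if "\<gamma> \<in> affine_jets (Suc m)" "s \<in> affine_jets m" for \<gamma> s
  proof -
    have "truncate_arc m (lift \<gamma> s) = s"
      using that by (intro arc_eqI) (auto simp: lift_def truncate_arc_nth affine_jets_iff)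
    then show ?thesis using that by (auto simp: jet_preimage_def lift_def truncate_arc_nth affine_jets_iff)
  qed
  show "(\<forall>\<gamma>\<in>jet_preimage m S. \<phi> \<gamma> = 0) \<or> (\<forall>\<gamma>\<in>jet_preimage m S. \<psi> \<gamma> = 0)"
  proof (rule ccontr)
    assume "\<not> ?thesis"
    then obtain \<gamma> \<delta> where g: "\<gamma> \<in> jet_preimage m S" "\<phi> \<gamma> \<noteq> 0" and d: "\<delta> \<in> jet_preimage m S" "\<psi> \<delta> \<noteq> 0" by blast
    have "lift \<gamma> (truncate_arc m \<gamma>) = \<gamma>" for \<gamma> by (simp add: lift_def)
    then have nz: "\<phi> (lift \<gamma> (truncate_arc m \<gamma>)) \<noteq> 0" "\<psi> (lift \<delta> (truncate_arc m \<delta>)) \<noteq> 0" using g d by auto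
    have "(\<lambda>s. \<phi> (lift \<gamma> s)) \<in> arc_ring" "(\<lambda>s. \<psi> (lift \<delta> s)) \<in> arc_ring"
      by (rule arc_ring_substitute[OF \<phi> lift_ring], rule arc_ring_substitute[OF \<psi> lift_ring])
    then have "\<exists>s\<in>S. \<phi> (lift \<gamma> s) * \<psi> (lift \<delta> s) \<noteq> 0"
      using S nz g(1) d(1) unfolding irreducible_in_zariski jet_preimage_def by fast
    then obtain s where s: "s \<in> S" "\<phi> (lift \<gamma> s) \<noteq> 0" "\<psi> (lift \<delta> s) \<noteq> 0" by auto
    have sa: "s \<in> affine_jets m" using s aff by blast
    have "jet_preimage m {s} \<subseteq> jet_preimage m S" using s by (auto simp: jet_preimage_def)
    then have "\<forall>\<gamma>\<in>jet_preimage m {s}. \<phi> \<gamma> * \<psi> \<gamma> = 0" using prod by blast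
    then have "(\<forall>\<gamma>\<in>jet_preimage m {s}. \<phi> \<gamma> = 0) \<or> (\<forall>\<gamma>\<in>jet_preimage m {s}. \<psi> \<gamma> = 0)"
      using irreducible_jet_fibre[OF sa] \<phi> \<psi> unfolding irreducible_in_zariski by simp
    moreover have "lift \<gamma> s \<in> jet_preimage m {s}" "lift \<delta> s \<in> jet_preimage m {s}"
      using lift_in sa g(1) d(1) by (auto simp: jet_preimage_def)
    ultimately show False using s by blast
  qed
qed

text \<open>A longest chain above \<open>C\<close>, pulled back to level m + 1, consists of closed
  irreducible sets, and \<open>D\<close> can be put below it: \<delta> shows that \<open>D\<close>
  is smaller than the preimage of \<open>C\<close>. The bound on chain lengths makes the codimension
  of \<open>C\<close> a maximum, which gives strictness.\<close>

lemma jet_codim_strict: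
  assumes C: "closedin (zariski_jets m) C" "irreducible_in (zariski_jets m) C"
    and D: "closedin (zariski_jets (Suc m)) D" "irreducible_in (zariski_jets (Suc m)) D"
    and sub: "truncate_arc m ` D \<subseteq> C" and \<delta>: "\<delta> \<in> affine_jets (Suc m)" "truncate_arc m \<delta> \<in> C" "\<delta> \<notin> D"
  shows "jet_codim m C < jet_codim (Suc m) D"
proof -
  define chain where "chain m Z k c \<longleftrightarrow> c 0 = Z
       \<and> (\<forall>i\<le>k. closedin (zariski_jets m) (c i) \<and> irreducible_in (zariski_jets m) (c i))
       \<and> (\<forall>i<k. c i \<subset> c (Suc i))" for m Z and k :: nat and c
  define S where "S m Z = {k. \<exists>c. chain m Z k c}" for m Z
  have codim: "jet_codim m Z = (SUP k\<in>S m Z. enat k)" for m Z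
    by (simp add: codim_in_def S_def chain_def)
  have bound: "k \<le> 3 * (m + 1)" if "k \<in> S m C" for k
    using that irreducible_chain_length unfolding S_def chain_def by blast
  have "chain m C 0 (\<lambda>_. C)" using C by (simp add: chain_def)
  then have "0 \<in> S m C" by (auto simp: S_def)
  moreover have "S m C \<subseteq> {..3 * (m + 1)}" using bound by blast
  then have fin: "finite (S m C)" by (rule finite_subset) simp
  ultimately have K: "Max (S m C) \<in> S m C" by (intro Max_in) auto
  define K where "K = Max (S m C)"
  obtain c where c: "chain m C K c" using K by (auto simp: S_def K_def)
  define c' where "c' i = (case i of 0 \<Rightarrow> D | Suc j \<Rightarrow> jet_preimage m (c j))" for i
  have strict: "jet_preimage m A \<subset> jet_preimage m B" if AB: "A \<subset> B" "B \<subseteq> affine_jets m" for A B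
  proof -
    obtain s where s: "s \<in> B" "s \<notin> A" using AB by blast
    then have "s \<in> affine_jets (Suc m)" "truncate_arc m s = s"
      using AB truncate_arc_id by (auto simp: affine_jets_iff subset_iff)
    then have "s \<in> jet_preimage m B" "s \<notin> jet_preimage m A" using s by (simp_all add: jet_preimage_def)
    moreover have "jet_preimage m A \<subseteq> jet_preimage m B" using AB(1) by (auto simp: jet_preimage_def)
    ultimately show ?thesis by blast
  qed
  have "D \<subset> jet_preimage m C"
    using D(2) sub \<delta> by (auto simp: jet_preimage_def irreducible_in_def)
  then have "c' i \<subset> c' (Suc i)" if "i < Suc K" for i
    using that c strict by (cases i) (auto simp: c'_def chain_def irreducible_in_def)
  moreover have "closedin (zariski_jets (Suc m)) (c' i) \<and> irreducible_in (zariski_jets (Suc m)) (c' i)" if "i \<le> Suc K" for i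
    using that c D closedin_jet_preimage irreducible_jet_preimage by (cases i) (auto simp: c'_def chain_def)
  ultimately have "chain (Suc m) D (Suc K) c'" by (simp add: chain_def c'_def)
  then have "enat (Suc K) \<le> jet_codim (Suc m) D"
    unfolding codim by (intro SUP_upper) (auto simp: S_def)
  moreover have "jet_codim m C \<le> enat K"
    unfolding codim K_def using fin by (intro SUP_least) auto
  ultimately show ?thesis by (metis enat_ord_simps(2) lessI order_le_less_trans order_less_le_trans)
qed

section \<open>Essential components\<close>

definition weight :: "nat \<Rightarrow> nat \<Rightarrow> nat^3" where
  "weight a b = vector [a, b, 1]"

lemma weight_eq_iff: "weight a b = weight c d \<longleftrightarrow> a = c \<and> b = d"
  by (auto simp: weight_def vec_eq_iff forall_3 vector_3)

lemma weight_ray_weight: "weight_ray (weight a b) = ray (lat a b)"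
proof -
  have "(\<chi> k. real (weight a b $ k)) = lat a b"
    by (simp add: weight_def vec_eq_iff forall_3 vector_3)
  then show ?thesis by (simp add: weight_ray_def)
qed

text \<open>A coefficient is zero at the generic point iff it vanishes on all of \<open>W\<close>,
  so the generic order is the least order that occurs in \<open>W\<close>.\<close>

lemma order_at_generic_point:
  assumes "\<And>\<gamma> j. \<gamma> \<in> W \<Longrightarrow> j < d \<Longrightarrow> fps_nth (\<gamma> $ k) j = 0" and "\<exists>\<gamma>\<in>W. fps_nth (\<gamma> $ k) d \<noteq> 0"
  shows "order_at_point (generic_point W) (coord_var k) = d"
proof -
  have mem: "(\<lambda>\<gamma>. fps_nth (compose_arc (coord_var k) \<gamma>) j) \<notin> generic_point W \<longleftrightarrow> (\<exists>\<gamma>\<in>W. fps_nth (\<gamma> $ k) j \<noteq> 0)" for j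
    using arc_ring.intros(2)[of k j] by (auto simp: generic_point_def compose_coord_var)
  show ?thesis
    unfolding order_at_point_def mem using assms by (intro Least_equality) (auto simp: not_less[symmetric])
qed

text \<open>An arc of exact orders a, b and 1 whose contact order with the surface is m + 1 when a +
  b = min(m + 1, n + 1). For m < n the term xy = t^(m+1) alone has the least order; for m \<ge> n
  the extra factor is what subtracting z^(n+1) = t^(n+1) leaves, namely t^(m+1).\<close>

definition contact_arc :: "nat \<Rightarrow> nat \<Rightarrow> nat \<Rightarrow> nat \<Rightarrow> arc" where
  "contact_arc n m a b = shifted_arc a b 1 (if n \<le> m then 1 + fps_X ^ (m - n) else 1) 1"

context
  fixes n m a b :: nat
  assumes ab: "a + b = min (m + 1) (n + 1)"
begin

lemma contact_arc_locus: "contact_arc n m a b \<in> contact_locus (m + 1) (A_poly n)"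
proof -
  have "compose_arc (A_poly n) (contact_arc n m a b) = fps_X ^ (m + 1) - (if n \<le> m then 0 else fps_X ^ (n + 1))"
  proof (cases "n \<le> m")
    case True
    then have "fps_X ^ (n + 1) * fps_X ^ (m - n) = (fps_X ^ (m + 1) :: complex fps)"
      by (simp only: power_add[symmetric]) simp
    then show ?thesis using True ab by (simp add: contact_arc_def compose_shifted_arc algebra_simps)
  next
    case False
    then show ?thesis using ab by (simp add: contact_arc_def compose_shifted_arc)
  qed
  then have "fps_nth (compose_arc (A_poly n) (contact_arc n m a b)) i = (if i = m + 1 then 1 else 0)" if "i \<le> m + 1" for i
    using that by (auto simp: fps_X_power_nth simp del: power_Suc)
  then have nz: "fps_nth (compose_arc (A_poly n) (contact_arc n m a b)) (m + 1) \<noteq> 0"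
    and "\<And>i. i < m + 1 \<Longrightarrow> fps_nth (compose_arc (A_poly n) (contact_arc n m a b)) i = 0" by auto
  then have "subdegree (compose_arc (A_poly n) (contact_arc n m a b)) = m + 1" by (intro subdegreeI) auto
  then show ?thesis using nz by (auto simp: contact_locus_def)
qed

lemma contact_arc_orders:
  "fps_nth (contact_arc n m a b $ 1) a \<noteq> 0" "fps_nth (contact_arc n m a b $ 2) b \<noteq> 0"
  "fps_nth (contact_arc n m a b $ 3) 1 \<noteq> 0"
  by (auto simp: contact_arc_def shifted_arc_nth fps_X_power_mult_nth fps_X_power_nth)

lemma truncate_contact_arc: "truncate_arc m (contact_arc n m a b) \<in> ord_jets n m a b"
  unfolding contact_arc_def shifted_arc_ord_jets[OF ab] by (auto simp: fps_X_power_nth)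

text \<open>Every arc of the cylinder has at least these orders, and \<open>contact_arc\<close>
  attains all three at once.\<close>

lemma weight_vectorI:
  assumes C: "\<And>\<gamma>. \<gamma> \<in> C \<Longrightarrow> (\<forall>i<a. fps_nth (\<gamma> $ 1) i = 0) \<and> (\<forall>i<b. fps_nth (\<gamma> $ 2) i = 0) \<and> fps_nth (\<gamma> $ 3) 0 = 0"
    and c: "truncate_arc m (contact_arc n m a b) \<in> C"
  shows "weight_vector (A_poly n) m C = weight a b" "contact_cylinder (A_poly n) m C \<noteq> {}"
proof -
  let ?W = "contact_cylinder (A_poly n) m C"
  have in_W: "contact_arc n m a b \<in> ?W" using c contact_arc_locus by (simp add: contact_cylinder_def)
  then show "?W \<noteq> {}" by blast
  have low: "(i < a \<longrightarrow> fps_nth (\<gamma> $ 1) i = 0) \<and> (i < b \<longrightarrow> fps_nth (\<gamma> $ 2) i = 0) \<and> (i < 1 \<longrightarrow> fps_nth (\<gamma> $ 3) i = 0)"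
    if "\<gamma> \<in> ?W" for \<gamma> i
  proof -
    have t: "truncate_arc m \<gamma> \<in> C" using that by (simp add: contact_cylinder_def)
    \<comment> \<open>These indices survive the truncation, so the bounds on the jet are bounds on
      the arc.\<close>
    have im: "i < a \<or> i < b \<or> i < 1 \<Longrightarrow> i \<le> m" using ab by auto
    then have "i < a \<or> i < b \<or> i < 1 \<Longrightarrow> fps_nth (\<gamma> $ k) i = fps_nth (truncate_arc m \<gamma> $ k) i" for k
      by (simp add: truncate_arc_nth)
    then show ?thesis using C[OF t] by auto
  qed
  have "order_at_point (generic_point ?W) (coord_var 1) = a"
    "order_at_point (generic_point ?W) (coord_var 2) = b"
    "order_at_point (generic_point ?W) (coord_var 3) = 1"
    using low in_W contact_arc_orders by (intro order_at_generic_point; blast)+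
  then show "weight_vector (A_poly n) m C = weight a b"
    by (simp add: weight_vector_def weight_def vec_eq_iff forall_3 vector_3)
qed

lemma weight_ord_jets:
  "weight_vector (A_poly n) m (ord_jets n m a b) = weight a b" "contact_cylinder (A_poly n) m (ord_jets n m a b) \<noteq> {}"
  using weight_vectorI[OF _ truncate_contact_arc] by (auto simp: ord_jets_def)

end

lemma truncate_truncate_arc: "truncate_arc m (truncate_arc (Suc m) \<gamma>) = truncate_arc m \<gamma>"
  by (rule arc_eqI) (simp add: truncate_arc_nth)

lemma truncate_ord_jets: "truncate_arc m ` ord_jets n (Suc m) a b \<subseteq> ord_jets n m a b"
proof
  fix \<gamma> assume "\<gamma> \<in> truncate_arc m ` ord_jets n (Suc m) a b"
  then obtain \<delta> where d: "\<delta> \<in> ord_jets n (Suc m) a b" "\<gamma> = truncate_arc m \<delta>" by blast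
  then show "\<gamma> \<in> ord_jets n m a b"
    by (auto simp: ord_jets_def jets_def truncate_arc_in compose_truncate_arc truncate_arc_nth)
qed

text \<open>A component one level up satisfies the equation at t^(m+1), whereas the truncated
  \<open>contact_arc\<close> lies over the given set and violates it. So no component is the full
  preimage, and its codimension is larger.\<close>

lemma star_ord_jets:
  assumes n: "1 \<le> n" and ab: "(a, b) \<in> jet_orders n m"
  shows "star_property (A_poly n) m (ord_jets n m a b)"
  unfolding star_property_def
proof (intro allI impI)
  fix D assume D: "jet_component (A_poly n) (Suc m) D \<and> truncate_arc m ` D \<subseteq> ord_jets n m a b"
  obtain a' b' where ab': "(a', b') \<in> jet_orders n (Suc m)" and DZ: "D = ord_jets n (Suc m) a' b'"
    using D jet_component_iff[of "Suc m" n D] n by auto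
  have sum: "a + b = min (m + 1) (n + 1)" "1 \<le> b" and sum': "a' + b' = min (Suc m + 1) (n + 1)" "1 \<le> b'"
    using ab ab' by (auto simp: jet_orders_def)
  define \<delta> where "\<delta> = truncate_arc (Suc m) (contact_arc n m a b)"
  show "jet_codim m (ord_jets n m a b) < jet_codim (Suc m) D"
  proof (rule jet_codim_strict)
    show "closedin (zariski_jets m) (ord_jets n m a b)" by (rule closedin_ord_jets)
    show "irreducible_in (zariski_jets m) (ord_jets n m a b)" by (rule irreducible_ord_jets[OF sum])
    show "closedin (zariski_jets (Suc m)) D" unfolding DZ by (rule closedin_ord_jets)
    show "irreducible_in (zariski_jets (Suc m)) D" unfolding DZ by (rule irreducible_ord_jets[OF sum'])
    show "truncate_arc m ` D \<subseteq> ord_jets n m a b" using D by blast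
    show "\<delta> \<in> affine_jets (Suc m)" by (simp add: \<delta>_def truncate_arc_in)
    show "truncate_arc m \<delta> \<in> ord_jets n m a b"
      unfolding \<delta>_def truncate_truncate_arc by (rule truncate_contact_arc[OF sum(1)])
    show "\<delta> \<notin> D"
    proof
      assume "\<delta> \<in> D"
      then have "fps_nth (compose_arc (A_poly n) \<delta>) (Suc m) = 0" by (auto simp: DZ ord_jets_def jets_def)
      then have "fps_nth (compose_arc (A_poly n) (contact_arc n m a b)) (Suc m) = 0"
        by (simp add: \<delta>_def compose_truncate_arc)
      then show False using contact_arc_locus[OF sum(1)] nth_subdegree_nonzero
        by (fastforce simp: contact_locus_def)
    qed
  qed
qed

text \<open>The sum a + b is m + 1 up to level n, so weights change there with every level. From
  level n on the sum stays n + 1, and above level n the set with the same orders one level down has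
  the same weight.\<close>

lemma EC_origin_A_poly:
  assumes n: "1 \<le> n"
  shows "EC_origin (A_poly n) = {(m, ord_jets n m a b) | m a b. 1 \<le> a \<and> 1 \<le> b \<and> a + b = m + 1 \<and> m \<le> n}"
proof (intro equalityI subsetI)
  fix z assume "z \<in> EC_origin (A_poly n)"
  then obtain m C where z: "z = (m, C)" and m: "1 \<le> m" and C: "jet_component (A_poly n) m C"
    and new: "\<And>D. m - 1 \<ge> 1 \<Longrightarrow> jet_component (A_poly n) (m - 1) D \<Longrightarrow> contact_cylinder (A_poly n) (m - 1) D \<noteq> {} \<Longrightarrow>
          truncate_arc (m - 1) ` C \<subseteq> D \<Longrightarrow> weight_vector (A_poly n) m C \<noteq> weight_vector (A_poly n) (m - 1) D"
    by (auto simp: EC_origin_def)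
  obtain a b where ab: "(a, b) \<in> jet_orders n m" and CZ: "C = ord_jets n m a b"
    using C jet_component_iff[OF m n, of C] by auto
  have s: "a + b = min (m + 1) (n + 1)" using ab by (simp add: jet_orders_def)
  have "m \<le> n"
  proof (rule ccontr)
    assume "\<not> m \<le> n"
    then obtain m' where m': "m = Suc m'" "n \<le> m'" using not0_implies_Suc[of m] by auto
    then have ab': "(a, b) \<in> jet_orders n m'" and s': "a + b = min (m' + 1) (n + 1)"
      using ab by (auto simp: jet_orders_def)
    have "jet_component (A_poly n) m' (ord_jets n m' a b)"
      using jet_component_iff[of m' n "ord_jets n m' a b"] n m' ab' by auto
    then have "weight_vector (A_poly n) m C \<noteq> weight_vector (A_poly n) m' (ord_jets n m' a b)"
      using new[of "ord_jets n m' a b"] n m' weight_ord_jets(2)[OF s'] truncate_ord_jets by (simp add: CZ)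
    then show False unfolding CZ weight_ord_jets(1)[OF s] weight_ord_jets(1)[OF s'] by simp
  qed
  then show "z \<in> {(m, ord_jets n m a b) | m a b. 1 \<le> a \<and> 1 \<le> b \<and> a + b = m + 1 \<and> m \<le> n}"
    using ab by (auto simp: z CZ jet_orders_def)
next
  fix z assume "z \<in> {(m, ord_jets n m a b) | m a b. 1 \<le> a \<and> 1 \<le> b \<and> a + b = m + 1 \<and> m \<le> n}"
  then obtain m a b where z: "z = (m, ord_jets n m a b)" and h: "1 \<le> a" "1 \<le> b" "a + b = m + 1" "m \<le> n" by blast
  then have ab: "(a, b) \<in> jet_orders n m" and m: "1 \<le> m" and s: "a + b = min (m + 1) (n + 1)"
    by (auto simp: jet_orders_def)
  have "weight_vector (A_poly n) m (ord_jets n m a b) \<noteq> weight_vector (A_poly n) (m - 1) D"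
    if D: "m - 1 \<ge> 1" "jet_component (A_poly n) (m - 1) D" for D
  proof -
    obtain a' b' where ab': "(a', b') \<in> jet_orders n (m - 1)" and DZ: "D = ord_jets n (m - 1) a' b'"
      using D jet_component_iff[OF D(1) n, of D] by auto
    have s': "a' + b' = min (m - 1 + 1) (n + 1)" using ab' by (simp add: jet_orders_def)
    show ?thesis
      unfolding DZ weight_ord_jets(1)[OF s] weight_ord_jets(1)[OF s'] weight_eq_iff using s s' h D(1) by auto
  qed
  moreover have "jet_component (A_poly n) m (ord_jets n m a b)" using jet_component_iff[OF m n] ab by blast
  ultimately show "z \<in> EC_origin (A_poly n)"
    using m star_ord_jets[OF n ab] by (auto simp: EC_origin_def z)
qed

section \<open>Components along the coordinate axes\<close>

lemma fps_mult_unit_zero: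
  fixes f g :: "complex fps"
  assumes "fps_nth f 0 \<noteq> 0" "\<And>j. j < E \<Longrightarrow> fps_nth (f * g) j = 0" "i < E"
  shows "fps_nth g i = 0"
proof -
  have "fps_nth g i = fps_nth (inverse f * (f * g)) i"
    using inverse_mult_eq_1[OF assms(1)] by (metis mult.assoc mult_1)
  also have "\<dots> = fps_nth (inverse f * 0) i"
    by (rule fps_mult_nth_cong) (use assms in auto)
  finally show ?thesis by simp
qed

text \<open>Away from the origin the coordinate along the axis is a unit, so the equation forces the
  other one, with index \<open>l\<close>, to vanish to order min(m + 1, n + 1). These are closed
  conditions and pass to the closure.\<close>

lemma axis_jets_bound:
  assumes k: "k = 1 \<or> k = 2" and l: "l = (if k = 1 then 2 else 1)"
    and g: "\<gamma> \<in> axis_jets (A_poly n) m k"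
  shows "(\<forall>i < min (m + 1) (n + 1). fps_nth (\<gamma> $ l) i = 0) \<and> fps_nth (\<gamma> $ 3) 0 = 0"
proof -
  define S where "S = {\<gamma> \<in> jets (A_poly n) m. arc_center \<gamma> \<in> coord_axis k - {0}}"
  have g: "\<gamma> \<in> zariski_jets m closure_of S" using g by (simp add: axis_jets_def S_def)
  have aff: "S \<subseteq> affine_jets m" by (auto simp: S_def jets_def)
  have S: "fps_nth (\<delta> $ 3) 0 = 0 \<and> (\<forall>i < min (m + 1) (n + 1). fps_nth (\<delta> $ l) i = 0)" if d: "\<delta> \<in> S" for \<delta>
  proof -
    obtain c where c: "arc_center \<delta> = axis k c" and c0: "axis k c \<noteq> 0" using d by (auto simp: S_def coord_axis_def)
    then have cn: "fps_nth (\<delta> $ j) 0 = (if j = k then c else 0)" for j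
      by (metis (mono_tags, lifting) arc_center_def axis_def vec_lambda_beta)
    have "c \<noteq> 0" using c0 by (auto simp: axis_eq_0_iff)
    have z0: "fps_nth (\<delta> $ 3) 0 = 0" using cn[of 3] k by auto
    then have "\<delta> $ 3 = fps_X * fps_shift 1 (\<delta> $ 3)" by (simp add: fps_eq_iff)
    then have z: "(\<delta> $ 3) ^ (n + 1) = fps_X ^ (n + 1) * (fps_shift 1 (\<delta> $ 3)) ^ (n + 1)"
      by (metis power_mult_distrib)
    have "fps_nth (\<delta> $ k * \<delta> $ l) j = 0" if "j < min (m + 1) (n + 1)" for j
    proof -
      have "fps_nth (compose_arc (A_poly n) \<delta>) j = 0" using d that by (simp add: S_def jets_def)
      then have "fps_nth (\<delta> $ 1 * \<delta> $ 2) j = fps_nth ((\<delta> $ 3) ^ (n + 1)) j" by (simp add: compose_A_poly)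
      also have "\<dots> = 0" unfolding z fps_X_power_mult_nth using that by simp
      finally show ?thesis using k l by (auto simp: mult.commute)
    qed
    moreover have "fps_nth (\<delta> $ k) 0 \<noteq> 0" using cn[of k] \<open>c \<noteq> 0\<close> by simp
    ultimately show ?thesis using z0 fps_mult_unit_zero by blast
  qed
  show ?thesis
    using zariski_closure_zero[OF g arc_ring.intros(2) _ aff] S by blast
qed

text \<open>Order zero in one coordinate means a nonzero constant term there, so the arc starts on
  the axis away from the origin.\<close>

lemma contact_arc_in_axis_jets:
  assumes k: "k = 1 \<and> a = 0 \<or> k = 2 \<and> b = 0" and ab: "a + b = min (m + 1) (n + 1)"
  shows "truncate_arc m (contact_arc n m a b) \<in> axis_jets (A_poly n) m k"
proof -
  define S where "S = {\<gamma> \<in> jets (A_poly n) m. arc_center \<gamma> \<in> coord_axis k - {0}}"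
  define \<gamma> where "\<gamma> = truncate_arc m (contact_arc n m a b)"
  have j: "\<gamma> \<in> jets (A_poly n) m" using truncate_contact_arc[OF ab] by (simp add: \<gamma>_def ord_jets_def)
  have E: "1 \<le> a + b" using ab by simp
  have "arc_center \<gamma> = axis k (fps_nth (\<gamma> $ k) 0)"
    using k E unfolding \<gamma>_def contact_arc_def
    by (auto simp: vec_eq_iff forall_3 arc_center_def truncate_shifted_nth axis_def)
  moreover have "fps_nth (\<gamma> $ k) 0 \<noteq> 0"
    using k contact_arc_orders(1,2)[OF ab] by (auto simp: \<gamma>_def truncate_arc_nth)
  ultimately have "\<gamma> \<in> S" using j by (auto simp: S_def coord_axis_def axis_eq_0_iff)
  moreover have "S \<subseteq> zariski_jets m closure_of S"
    by (intro closure_of_subset) (auto simp: S_def jets_def)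
  ultimately show ?thesis unfolding axis_jets_def S_def[symmetric] \<gamma>_def by blast
qed

lemma weight_axis_jets:
  "weight_vector (A_poly n) m (axis_jets (A_poly n) m 1) = weight 0 (min (m + 1) (n + 1))"
  "weight_vector (A_poly n) m (axis_jets (A_poly n) m 2) = weight (min (m + 1) (n + 1)) 0"
proof -
  show "weight_vector (A_poly n) m (axis_jets (A_poly n) m 1) = weight 0 (min (m + 1) (n + 1))"
    by (rule weight_vectorI(1)) (use axis_jets_bound[of 1 2] contact_arc_in_axis_jets[of 1 0] in auto)
  show "weight_vector (A_poly n) m (axis_jets (A_poly n) m 2) = weight (min (m + 1) (n + 1)) 0"
    by (rule weight_vectorI(1)) (use axis_jets_bound[of 2 1] contact_arc_in_axis_jets[of 2 _ 0] in auto)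
qed

lemma coord_axis_A_poly: "coord_axis k \<subseteq> zero_set (A_poly n) \<longleftrightarrow> k = 1 \<or> k = 2"
proof
  assume "coord_axis k \<subseteq> zero_set (A_poly n)"
  then have "axis k 1 \<in> zero_set (A_poly n)" by (auto simp: coord_axis_def)
  then show "k = 1 \<or> k = 2" using exhaust_3[of k] by (auto simp: zero_set_A_poly)
next
  assume "k = 1 \<or> k = 2"
  then show "coord_axis k \<subseteq> zero_set (A_poly n)" by (auto simp: coord_axis_def zero_set_A_poly)
qed

lemma EC_axes_A_poly: "EC_axes (A_poly n) = {(m, axis_jets (A_poly n) m k) | m k. (k = 1 \<or> k = 2) \<and> m \<le> n}"
proof -
  have "(m = 0 \<or> m \<ge> 1 \<and> weight_vector (A_poly n) m (axis_jets (A_poly n) m k)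
      \<noteq> weight_vector (A_poly n) (m - 1) (axis_jets (A_poly n) (m - 1) k)) \<longleftrightarrow> m \<le> n" if k: "k = 1 \<or> k = 2" for m k
  proof (cases m)
    case 0 then show ?thesis by simp
  next
    case (Suc m')
    then show ?thesis using k weight_axis_jets[of n m] weight_axis_jets[of n m'] by (auto simp: weight_eq_iff)
  qed
  then show ?thesis unfolding EC_axes_def coord_axis_A_poly by blast
qed

text \<open>The inverse of the weight map: (a, b) first occurs at level a + b - 1. A zero order of
  \<open>x\<close> belongs to the x-axis, along which \<open>x\<close> is a unit.\<close>

definition essential_component :: "nat \<Rightarrow> nat \<times> nat \<Rightarrow> nat \<times> arc set" where
  "essential_component n = (\<lambda>(a, b). (a + b - 1,
     if a = 0 then axis_jets (A_poly n) (a + b - 1) 1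
     else if b = 0 then axis_jets (A_poly n) (a + b - 1) 2
     else ord_jets n (a + b - 1) a b))"

definition essential_weights :: "nat \<Rightarrow> (nat \<times> nat) set" where
  "essential_weights n = {(a, b). a + b \<le> n + 1} - {(0, 0)}"

lemma EC_A_poly:
  assumes "1 \<le> n"
  shows "EC (A_poly n) = essential_component n ` essential_weights n"
proof (intro equalityI subsetI)
  fix z assume "z \<in> EC (A_poly n)"
  then consider m a b where "z = (m, ord_jets n m a b)" "1 \<le> a" "1 \<le> b" "a + b = m + 1" "m \<le> n"
    | m where "z = (m, axis_jets (A_poly n) m 1)" "m \<le> n" | m where "z = (m, axis_jets (A_poly n) m 2)" "m \<le> n"
    unfolding EC_def EC_origin_A_poly[OF assms] EC_axes_A_poly by blast
  then show "z \<in> essential_component n ` essential_weights n"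
  proof cases
    case (1 m a b)
    then show ?thesis by (intro image_eqI[of _ _ "(a, b)"]) (auto simp: essential_component_def essential_weights_def)
  next
    case (2 m)
    then show ?thesis by (intro image_eqI[of _ _ "(0, m + 1)"]) (auto simp: essential_component_def essential_weights_def)
  next
    case (3 m)
    then show ?thesis by (intro image_eqI[of _ _ "(m + 1, 0)"]) (auto simp: essential_component_def essential_weights_def)
  qed
next
  fix z assume "z \<in> essential_component n ` essential_weights n"
  then obtain a b where z: "z = essential_component n (a, b)" and "(a, b) \<in> essential_weights n" by auto
  then have ab: "a + b \<le> n + 1" "(a, b) \<noteq> (0, 0)" by (auto simp: essential_weights_def)
  consider "a = 0" | "a \<noteq> 0" "b = 0" | "1 \<le> a" "1 \<le> b" by linarith
  then show "z \<in> EC (A_poly n)"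
  proof cases
    case 1
    then have "z \<in> EC_axes (A_poly n)" unfolding EC_axes_A_poly using ab by (auto simp: z essential_component_def)
    then show ?thesis by (simp add: EC_def)
  next
    case 2
    then have "z \<in> EC_axes (A_poly n)" unfolding EC_axes_A_poly using ab by (auto simp: z essential_component_def)
    then show ?thesis by (simp add: EC_def)
  next
    case 3
    then have "z = (a + b - 1, ord_jets n (a + b - 1) a b)" "a + b = a + b - 1 + 1" "a + b - 1 \<le> n"
      using ab by (auto simp: z essential_component_def)
    then have "z \<in> EC_origin (A_poly n)" unfolding EC_origin_A_poly[OF assms] using 3 by blast
    then show ?thesis by (simp add: EC_def)
  qed
qed

lemma weight_ray_essential_component:
  assumes "(a, b) \<in> essential_weights n"
  shows "(\<lambda>(m, C). weight_ray (weight_vector (A_poly n) m C)) (essential_component n (a, b)) = ray (lat a b)"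
proof -
  define m where "m = a + b - 1"
  have s: "a + b = min (m + 1) (n + 1)" using assms by (auto simp: essential_weights_def m_def)
  have "weight_vector (A_poly n) m (if a = 0 then axis_jets (A_poly n) m 1
      else if b = 0 then axis_jets (A_poly n) m 2 else ord_jets n m a b) = weight a b"
    using weight_axis_jets[of n m] weight_ord_jets(1)[OF s] unfolding s[symmetric] by auto
  then show ?thesis
    by (simp only: essential_component_def prod.case m_def[symmetric] weight_ray_weight)
qed

theorem theorem4p2:
  fixes n :: nat
  assumes "n \<ge> 1"
  shows "(\<exists>\<Sigma>. regular_subdivision \<Sigma> (dual_fan (A_poly n))
              \<and> rays \<Sigma> = standard_rays
                    \<union> (\<lambda>(m, C). weight_ray (weight_vector (A_poly n) m C)) ` EC (A_poly n)
              \<and> minimal_toric_resolution (A_poly n) \<Sigma>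
              \<and> embedded_resolution (A_poly n) \<Sigma>)
       \<and> bij_betw (\<lambda>(m, C). weight_ray (weight_vector (A_poly n) m C))
           (EC (A_poly n))
           {\<rho>. \<forall>\<Sigma>. minimal_toric_resolution (A_poly n) \<Sigma> \<longrightarrow> \<rho> \<in> exceptional_rays \<Sigma>}"
proof -
  let ?wt = "\<lambda>(m, C). weight_ray (weight_vector (A_poly n) m C)"
  let ?\<Sigma> = "A_fan (n + 1)"
  let ?R = "(\<lambda>(a, b). ray (lat a b)) ` essential_weights n"
  have img: "?wt ` EC (A_poly n) = ?R"
    unfolding EC_A_poly[OF assms] image_image
  proof (rule image_cong[OF refl])
    fix p assume "p \<in> essential_weights n"
    then show "?wt (essential_component n p) = (\<lambda>(a, b). ray (lat a b)) p"
      using weight_ray_essential_component[of "fst p" "snd p" n] by (simp only: prod.collapse) (simp add: split_beta)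
  qed
  have inj: "inj_on ?wt (EC (A_poly n))"
  proof (rule inj_onI)
    fix y z assume "y \<in> EC (A_poly n)" "z \<in> EC (A_poly n)" and eq: "?wt y = ?wt z"
    then obtain a b c d where y: "y = essential_component n (a, b)" "(a, b) \<in> essential_weights n"
      and z: "z = essential_component n (c, d)" "(c, d) \<in> essential_weights n"
      unfolding EC_A_poly[OF assms] by auto
    have "ray (lat a b) = ray (lat c d)"
      using eq unfolding y(1) z(1) weight_ray_essential_component[OF y(2)] weight_ray_essential_component[OF z(2)] .
    then show "y = z" unfolding ray_lat_eq_iff y z by simp
  qed
  have rays: "rays ?\<Sigma> = standard_rays \<union> ?R"
  proof -
    \<comment> \<open>\<open>lat 0 0\<close> spans the ray of the third axis; this is a ray of the
      fan but not that of a weight vector.\<close>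
    have "{(a, b). a + b \<le> n + 1} = insert (0, 0) (essential_weights n)"
      by (auto simp: essential_weights_def)
    then have "rays ?\<Sigma> = standard_rays \<union> insert (ray (lat 0 0)) ?R"
      unfolding rays_A_fan' by (simp only: image_insert prod.case)
    moreover have "ray (lat 0 0) \<in> standard_rays" using ray_lat_standard_iff by blast
    ultimately show ?thesis by blast
  qed
  have nonstd: "\<rho> \<notin> standard_rays" if "\<rho> \<in> ?R" for \<rho>
    using that ray_lat_standard_iff by (auto simp: essential_weights_def)
  have min: "minimal_toric_resolution (A_poly n) ?\<Sigma>"
    unfolding minimal_toric_resolution_def using regular_subdivision_A_fan minimal_A_fan by blast
  \<comment> \<open>Indecomposability puts these rays into every minimal resolution, and the
    constructed fan, being one of them, has no further exceptional rays.\<close>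
  have target: "?R = {\<rho>. \<forall>\<Sigma>. minimal_toric_resolution (A_poly n) \<Sigma> \<longrightarrow> \<rho> \<in> exceptional_rays \<Sigma>}"
  proof (intro equalityI subsetI)
    fix \<rho> assume \<rho>: "\<rho> \<in> ?R"
    then obtain a b where "\<rho> = ray (lat a b)" "a + b \<le> n + 1" by (auto simp: essential_weights_def)
    then have "\<rho> \<in> rays \<Sigma>" if "minimal_toric_resolution (A_poly n) \<Sigma>" for \<Sigma>
      using that lat_ray_in_resolution by (auto simp: minimal_toric_resolution_def)
    then show "\<rho> \<in> {\<rho>. \<forall>\<Sigma>. minimal_toric_resolution (A_poly n) \<Sigma> \<longrightarrow> \<rho> \<in> exceptional_rays \<Sigma>}"
      using nonstd[OF \<rho>] by (simp add: exceptional_rays_def)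
  next
    fix \<rho> assume "\<rho> \<in> {\<rho>. \<forall>\<Sigma>. minimal_toric_resolution (A_poly n) \<Sigma> \<longrightarrow> \<rho> \<in> exceptional_rays \<Sigma>}"
    then have "\<rho> \<in> exceptional_rays ?\<Sigma>" using min by blast
    then show "\<rho> \<in> ?R" using rays by (auto simp: exceptional_rays_def)
  qed
  have "bij_betw ?wt (EC (A_poly n)) {\<rho>. \<forall>\<Sigma>. minimal_toric_resolution (A_poly n) \<Sigma> \<longrightarrow> \<rho> \<in> exceptional_rays \<Sigma>}"
    unfolding bij_betw_def target[symmetric] using inj img by blast
  moreover have "rays ?\<Sigma> = standard_rays \<union> ?wt ` EC (A_poly n)" unfolding img by (rule rays)
  ultimately show ?thesis
    using regular_subdivision_A_fan min embedded_resolution_A_fan by blast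
qed

end
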